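(* Let $p$ be a prime and let $G=(\mathbb{Z}_p)^{\mathbb{N}}$, regarded as an abstract Abelian group. Then the following assertions hold. 1. The set of all Hausdorff group topologies on $G$ contains a subset of cardinality $2^{2^{2^{\aleph_0}}}$ consisting of pairwise non-homeomorphic totally bounded topologies. 2. Assume the continuum hypothesis $\aleph_1=2^{\aleph_0}$. Then, up to equivalence, $\tau_c,\tau_d,\tau_0,\tau_1$ are the only locally compact Hausdorff group topologies on $G$. Only one of them, $\tau_c$, is compact.
   Context: $\mathbb{Z}_p=\mathbb{Z}/p\mathbb{Z}$. A group topology $\tau$ on an Abelian group $G$ is totally bounded if for every neighborhood $U$ of zero there is a finite set $\{0,g_1,\dots,g_k\}\subset G$ such that $U, g_1+U,\dots,g_k+U$ cover $G$. Two topologies on $G$ are equivalent if there is a homeomorphism between the two resulting topological spaces (not necessarily a group homomorphism). The four topologies on $G=(\mathbb{Z}_p)^{\mathbb{N}}$ are: $\tau_c$ is the product topology (each factor $\mathbb{Z}_p$ discrete), which is compact; $\tau_d$ is the discrete topology. The group of continuous characters $(G,\tau_c)^*=\bigoplus_{\aleph_0}\mathbb{Z}_p$ is a countable discrete group. The topological groups $(G,\tau_c)\times(G,\tau_c)^*$ and $(G,\tau_c)\times(G,\tau_d)$ are both algebraically isomorphic to $G$; $\tau_0$ and $\tau_1$ denote the topologies on $G$ obtained by transporting, along algebraic isomorphisms, the topologies of $(G,\tau_c)\times(G,\tau_c)^*$ and $(G,\tau_c)\times(G,\tau_d)$, respectively. *)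

theory Defs
  imports
    "HOL-Algebra.Product_Groups"
    "HOL-Analysis.Analysis"
    "HOL-Library.Equipollence"
    "HOL-Computational_Algebra.Primes"
begin

definition group_topology :: "('a, 'b) monoid_scheme \<Rightarrow> 'a topology \<Rightarrow> bool" where
  "group_topology G \<tau> \<longleftrightarrow>
     topspace \<tau> = carrier G \<and>
     continuous_map (prod_topology \<tau> \<tau>) \<tau> (\<lambda>(x, y). x \<otimes>\<^bsub>G\<^esub> y) \<and>
     continuous_map \<tau> \<tau> (\<lambda>x. inv\<^bsub>G\<^esub> x)"

definition hausdorff_group_topology :: "('a, 'b) monoid_scheme \<Rightarrow> 'a topology \<Rightarrow> bool" where
  "hausdorff_group_topology G \<tau> \<longleftrightarrow> group_topology G \<tau> \<and> Hausdorff_space \<tau>"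

text \<open>A neighborhood of the neutral element need not be open. HOL-Algebra writes groups
  multiplicatively, so the translate \<open>g + U\<close> is the left coset of \<open>U\<close> by \<open>g\<close>.\<close>

definition totally_bounded_topology :: "('a, 'b) monoid_scheme \<Rightarrow> 'a topology \<Rightarrow> bool" where
  "totally_bounded_topology G \<tau> \<longleftrightarrow>
     (\<forall>U. U \<subseteq> carrier G \<and> (\<exists>V. openin \<tau> V \<and> \<one>\<^bsub>G\<^esub> \<in> V \<and> V \<subseteq> U) \<longrightarrow>
       (\<exists>F. finite F \<and> \<one>\<^bsub>G\<^esub> \<in> F \<and> F \<subseteq> carrier G \<and> (\<Union>g\<in>F. g <#\<^bsub>G\<^esub> U) = carrier G))"

definition circle_group :: "complex monoid" where
  "circle_group = \<lparr>carrier = sphere 0 1, monoid.mult = (*), one = 1\<rparr>"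

definition circle_topology :: "complex topology" where
  "circle_topology = top_of_set (sphere 0 1)"

text \<open>Continuous characters are taken extensional (undefined off the carrier), so that two
  characters agreeing on the group are equal.\<close>

definition character_group :: "('a, 'b) monoid_scheme \<Rightarrow> 'a topology \<Rightarrow> ('a \<Rightarrow> complex) monoid" where
  "character_group G \<tau> =
     \<lparr>carrier = {f \<in> extensional (carrier G).
                  f \<in> hom G circle_group \<and> continuous_map \<tau> circle_topology f},
      monoid.mult = (\<lambda>f g. \<lambda>x\<in>carrier G. f x * g x),
      one = (\<lambda>x\<in>carrier G. 1)\<rparr>"

text \<open>The compact-open topology, i.e. the Pontryagin dual topology; it is discrete when \<open>\<tau>\<close> is
  compact. With \<open>K = {}\<close> the subbasis contains the whole character group.\<close>

definition character_topology ::
    "('a, 'b) monoid_scheme \<Rightarrow> 'a topology \<Rightarrow> ('a \<Rightarrow> complex) topology" where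
  "character_topology G \<tau> = topology_generated_by
     {{f \<in> carrier (character_group G \<tau>). f ` K \<subseteq> U} | K U.
        compactin \<tau> K \<and> openin circle_topology U}"

definition Zp_power :: "nat \<Rightarrow> (nat \<Rightarrow> int) monoid" where
  "Zp_power p = product_group UNIV (\<lambda>_. integer_mod_group p)"

definition tau_c :: "nat \<Rightarrow> (nat \<Rightarrow> int) topology" where
  "tau_c p = product_topology (\<lambda>_. discrete_topology (carrier (integer_mod_group p))) UNIV"

definition tau_d :: "nat \<Rightarrow> (nat \<Rightarrow> int) topology" where
  "tau_d p = discrete_topology (carrier (Zp_power p))"

text \<open>In \<open>tau_0\<close> and \<open>tau_1\<close> the argument \<open>\<phi>\<close> is the algebraic isomorphism from \<open>Zp_power p\<close>
  along which the product topology is transported (pulled back); different choices of \<open>\<phi>\<close> give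
  homeomorphic topologies.\<close>

definition prod_group_0 :: "nat \<Rightarrow> ((nat \<Rightarrow> int) \<times> ((nat \<Rightarrow> int) \<Rightarrow> complex)) monoid" where
  "prod_group_0 p = Zp_power p \<times>\<times> character_group (Zp_power p) (tau_c p)"

definition tau_0 ::
    "nat \<Rightarrow> ((nat \<Rightarrow> int) \<Rightarrow> (nat \<Rightarrow> int) \<times> ((nat \<Rightarrow> int) \<Rightarrow> complex)) \<Rightarrow> (nat \<Rightarrow> int) topology" where
  "tau_0 p \<phi> = pullback_topology (carrier (Zp_power p)) \<phi>
     (prod_topology (tau_c p) (character_topology (Zp_power p) (tau_c p)))"

definition prod_group_1 :: "nat \<Rightarrow> ((nat \<Rightarrow> int) \<times> (nat \<Rightarrow> int)) monoid" where
  "prod_group_1 p = Zp_power p \<times>\<times> Zp_power p"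

definition tau_1 ::
    "nat \<Rightarrow> ((nat \<Rightarrow> int) \<Rightarrow> (nat \<Rightarrow> int) \<times> (nat \<Rightarrow> int)) \<Rightarrow> (nat \<Rightarrow> int) topology" where
  "tau_1 p \<phi> = pullback_topology (carrier (Zp_power p)) \<phi> (prod_topology (tau_c p) (tau_d p))"

definition continuum_hypothesis :: bool where
  "continuum_hypothesis \<longleftrightarrow> (cardSuc natLeq, BNF_Cardinal_Arithmetic.cexp BNF_Cardinal_Arithmetic.ctwo natLeq) \<in> ordIso"

end

theory Submission
  imports Defs
begin

text \<open>Part 1. A family of characters with values in the \<open>p\<close>-th roots of unity induces a totally
  bounded topology, and the family can be recovered from it as long as its members are independent.
  There are \<open>2 ^ c\<close> characters of \<open>G\<close>, independent even modulo the coordinates, hence \<open>2 ^ 2 ^ c\<close>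
  topologies; as a homeomorphism class contains at most \<open>2 ^ c\<close> of them, there are as many classes.

  Part 2. In a locally compact group of exponent \<open>p\<close>, a compact neighborhood \<open>C\<close> of the neutral
  element satisfies \<open>C C \<subseteq> F C\<close> with \<open>F\<close> finite, and \<open>H C\<close> is a compact open subgroup for the finite
  group \<open>H\<close> generated by \<open>F\<close>. In a compact group of exponent \<open>p\<close>, Bogolyubov's lemma for the finite
  subgroups, combined with a compactness argument, shows that every neighborhood of the neutral element
  contains a subgroup of finite index, so continuous characters separate points and a maximal
  independent set \<open>B\<close> of them identifies the group with a power \<open>(Z_p)^B\<close>. Comparing cardinalities,
  the continuum hypothesis forces \<open>B\<close> to be countable. Hence the topology is discrete or that
  of \<open>tau_c\<close> times a discrete space, whose cardinality is finite, countable or that of the continuum.\<close>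

subsection \<open>Groups of prime exponent\<close>

text \<open>Haar measure and the Peter-Weyl theorem are replaced by Fourier sums on finite
  subgroups. Uniformity lets this pass to infinite groups: if N translates of V cover the group,
  every finite subgroup has at most 2 N^2 characters whose common kernel lies in 2A - 2A, where A =
  V - V, and this bound does not mention the subgroup. A fixed number of unknown characters is a
  point of a compact product of finite spaces, so the local solutions glue. The glued characters
  need not be continuous; passing to the closure of their common kernel, a subgroup of finite index,
  repairs this.

  The algebra is linear algebra over Z_p: complements of subgroups give both extensions of
  characters and separating characters.

  In part 1 the topologies must be Hausdorff, so all coordinate characters are put into each family;
  this is why the others must be independent modulo them. Limits along almost disjoint branches of
  the binary tree do not see finitely many coordinates and give continuum many new coordinates; an
  independent family of 2 ^ c sets of branches then gives the 2 ^ c characters.\<close>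

lemma root_of_unity_powers:
  fixes z y :: complex
  assumes p: "prime p" and z: "z ^ p = 1" "z \<noteq> 1" and y: "y ^ p = 1"
  shows "\<exists>k. y = z ^ k"
proof -
  have p0: "p > 0" using p prime_gt_0_nat by blast
  \<comment> \<open>z has exact order p: a smaller positive exponent d is invertible modulo p, and
    raising \<open>z ^ d = 1\<close> to that inverse gives z = 1.\<close>
  have no1: "z ^ d \<noteq> 1" if d: "0 < d" "d < p" for d
  proof
    assume zd: "z ^ d = 1"
    have "coprime d p"
      using p d by (meson coprime_commute nat_dvd_not_less prime_imp_coprime)
    then obtain a b where "a * d = b * p + 1"
      using coprime_bezout_strong[of d p] d prime_gt_1_nat[OF p] by (metis mult.commute less_numeral_extra(4))
    then have "z ^ (a * d) = z ^ (b * p + 1)" by simp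
    also have "z ^ (a * d) = 1" by (metis mult.commute power_mult zd power_one)
    also have "z ^ (b * p + 1) = z" by (metis Suc_eq_plus1 mult.commute power_Suc2 power_mult z(1) power_one mult_1)
    finally show False using z by simp
  qed
  have znz: "z \<noteq> 0" using z p0 by (metis power_0_left less_irrefl zero_neq_one)
  have "inj_on (\<lambda>k. z ^ k) {..<p}"
  proof (rule linorder_inj_onI)
    fix i j assume "i < j" "i \<in> {..<p}" "j \<in> {..<p}"
    then show "z ^ i \<noteq> z ^ j"
      using no1[of "j - i"] znz by (auto simp: power_diff less_imp_diff_less)
  qed auto
  then have "card ((\<lambda>k. z ^ k) ` {..<p}) = p" by (simp add: card_image)
  moreover have "(\<lambda>k. z ^ k) ` {..<p} \<subseteq> {x. x ^ p = 1}"
    using z by (auto simp: power_mult[symmetric] mult.commute[of _ p]) (simp add: power_mult)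
  moreover have "finite {x::complex. x ^ p = 1}" "card {x::complex. x ^ p = 1} = p"
    using p0 finite_roots_unity[of p] card_roots_unity_eq[of p] by auto
  ultimately have "(\<lambda>k. z ^ k) ` {..<p} = {x. x ^ p = 1}"
    by (metis card_subset_eq)
  then show ?thesis using y by blast
qed

lemma ex_root_of_unity_ne_1:
  assumes "prime p"
  obtains w :: complex where "w ^ p = 1" "w \<noteq> 1"
proof -
  have "card {x::complex. x ^ p = 1} = p" "p \<ge> 2"
    using card_roots_unity_eq[of p] assms prime_ge_2_nat prime_gt_0_nat by auto
  then have "\<not> {x::complex. x ^ p = 1} \<subseteq> {1}"
    by (metis card.empty card_insert_le_m1 card_mono finite.emptyI finite_insert
        card_1_singleton_iff Suc_1 not_less_eq_eq le_trans One_nat_def)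
  then show ?thesis using that by auto
qed

text \<open>A group of exponent p is a vector space over Z_p written multiplicatively; subgroups are
  its subspaces, and powers stand for scalar multiples.\<close>

locale prime_exponent_group = comm_group G for G (structure) +
  fixes p :: nat
  assumes prime_p: "prime p"
    and pow_p: "x \<in> carrier G \<Longrightarrow> x [^] p = \<one>"
begin

lemma p_pos: "p > 0"
  using prime_p prime_gt_0_nat by blast

lemma inv_eq_pow: "x \<in> carrier G \<Longrightarrow> inv x = x [^] (p - 1)"
  using p_pos pow_p[of x] by (metis inv_equality nat_pow_Suc Suc_diff_1 nat_pow_closed)

lemma pow_mod_p: "x \<in> carrier G \<Longrightarrow> x [^] (k mod p) = x [^] (k::nat)"
proof -
  assume x: "x \<in> carrier G"
  have "x [^] k = x [^] (p * (k div p) + k mod p)" by simp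
  also have "\<dots> = x [^] (k mod p)"
    unfolding nat_pow_mult[OF x, symmetric] nat_pow_pow[OF x, symmetric]
    using x pow_p by simp
  finally show ?thesis by simp
qed

lemma subgroup_pow_closed: "subgroup H G \<Longrightarrow> x \<in> H \<Longrightarrow> x [^] (k::nat) \<in> H"
  by (induction k) (auto simp: subgroup.one_closed subgroup.m_closed)

text \<open>Inverses come for free, being (p-1)-st powers.\<close>

lemma subgroup_mult_closedI:
  assumes "S \<subseteq> carrier G" "\<one> \<in> S" "\<And>x y. x \<in> S \<Longrightarrow> y \<in> S \<Longrightarrow> x \<otimes> y \<in> S"
  shows "subgroup S G"
proof (rule subgroupI)
  fix x assume x: "x \<in> S"
  have "x [^] (k::nat) \<in> S" for k
    by (induction k) (use assms x in auto)
  then show "inv x \<in> S" using inv_eq_pow assms(1) x by (metis subsetD)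
qed (use assms in auto)

lemma subgroup_powers:
  assumes x: "x \<in> carrier G"
  shows "subgroup (range (\<lambda>k::nat. x [^] k)) G"
proof (rule subgroup_mult_closedI)
  show "\<one> \<in> range (\<lambda>k::nat. x [^] k)" by (metis nat_pow_0 rangeI)
qed (use x in \<open>auto simp: nat_pow_mult\<close>)

lemma nat_pow_one_exp: "x \<in> carrier G \<Longrightarrow> x [^] (1::nat) = x"
  by simp

text \<open>Adjoining one element x multiplies a finite subgroup by the powers of x, of which there
  are at most p.\<close>

lemma subgroup_finite_adjoin:
  assumes "finite F" "F \<subseteq> carrier G"
  shows "\<exists>H. subgroup H G \<and> finite H \<and> F \<subseteq> H"
  using assms
proof (induction rule: finite_induct)
  case empty
  then show ?case using triv_subgroup by blast
next
  case (insert x F)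
  then obtain H where H: "subgroup H G" "finite H" "F \<subseteq> H" and x: "x \<in> carrier G" by auto
  let ?C = "range (\<lambda>k::nat. x [^] k)"
  have C: "subgroup ?C G" using x subgroup_powers by simp
  have "?C \<subseteq> (\<lambda>k. x [^] k) ` {..<p}"
    using pow_mod_p[OF x] p_pos by (smt (verit) image_iff image_subsetI lessThan_iff mod_less_divisor)
  then have "finite ?C" using finite_subset by blast
  moreover have "H <#> ?C = (\<lambda>(a,b). a \<otimes> b) ` (H \<times> ?C)" by (auto simp: set_mult_def)
  ultimately have "finite (H <#> ?C)" using H by auto
  moreover have "x \<in> H <#> ?C"
    unfolding set_mult_def using subgroup.one_closed[OF H(1)] x nat_pow_one_exp[OF x]
    by (auto intro!: bexI[of _ \<one>] exI[of _ "1::nat"])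
  moreover have "F \<subseteq> H <#> ?C"
  proof
    fix y assume "y \<in> F"
    then have "y \<in> H" "y \<in> carrier G" using H insert by auto
    then show "y \<in> H <#> ?C" unfolding set_mult_def
      by (auto intro!: bexI[of _ y] exI[of _ "0::nat"])
  qed
  ultimately show ?case using mult_subgroups[OF H(1) C] by blast
qed

text \<open>Modulo the prime p the exponent k has an inverse, so x is itself a power of
  \<open>x [^] k\<close>.\<close>

lemma pow_in_subgroup_cancel:
  assumes M: "subgroup M G" and x: "x \<in> carrier G" and k: "x [^] (k::nat) \<in> M" "\<not> p dvd k"
  shows "x \<in> M"
proof -
  have "coprime k p" using prime_p k by (meson coprime_commute prime_imp_coprime)
  then obtain a b where "a * k = b * p + 1"
    using coprime_bezout_strong[of k p] prime_gt_1_nat[OF prime_p] by (metis mult.commute less_numeral_extra(4))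
  then have "x [^] (k * a) = x [^] (p * b + 1)" by (simp add: mult.commute)
  also have "\<dots> = x" using x pow_p by (simp add: nat_pow_mult[symmetric] nat_pow_pow[symmetric])
  finally have "x = (x [^] k) [^] a" using x by (simp add: nat_pow_pow)
  then show ?thesis using subgroup_pow_closed[OF M k(1)] by metis
qed

text \<open>Subspaces have complements: Zorn's lemma gives a maximal N above L that meets M
  trivially, and maximality forces N M to be everything.\<close>

lemma complement_extend:
  assumes L: "subgroup L G" and M: "subgroup M G" and LM: "L \<inter> M = {\<one>}"
  obtains N where "subgroup N G" "L \<subseteq> N" "N \<inter> M = {\<one>}" "N <#> M = carrier G"
proof -
  define \<A> where "\<A> = {N. subgroup N G \<and> L \<subseteq> N \<and> N \<inter> M = {\<one>}}"
  have "\<exists>N\<in>\<A>. \<forall>X\<in>\<A>. N \<subseteq> X \<longrightarrow> X = N"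
  proof (rule subset_Zorn_nonempty)
    show "\<A> \<noteq> {}" using L LM by (auto simp: \<A>_def)
    show "\<Union>C \<in> \<A>" if nonempty: "C \<noteq> {}" and C: "subset.chain \<A> C" for C
    proof -
      have CA: "C \<subseteq> \<A>" and tot: "\<And>X Y. X \<in> C \<Longrightarrow> Y \<in> C \<Longrightarrow> X \<subseteq> Y \<or> Y \<subseteq> X"
        using C by (auto simp: subset.chain_def)
      have "subgroup (\<Union>C) G"
      proof (rule subgroup_mult_closedI)
        show "\<Union>C \<subseteq> carrier G" using CA subgroup.subset by (fastforce simp: \<A>_def)
        show "\<one> \<in> \<Union>C" using nonempty CA by (auto simp: \<A>_def dest: subgroup.one_closed)
        show "x \<otimes> y \<in> \<Union>C" if xy: "x \<in> \<Union>C" "y \<in> \<Union>C" for x y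
        proof -
          obtain X where X: "X \<in> C" "x \<in> X" "y \<in> X" using xy tot by blast
          moreover have "subgroup X G" using X CA by (auto simp: \<A>_def)
          ultimately show ?thesis by (auto dest: subgroup.m_closed)
        qed
      qed
      moreover have "L \<subseteq> \<Union>C" "\<Union>C \<inter> M = {\<one>}" using nonempty CA by (auto simp: \<A>_def)
      ultimately show "\<Union>C \<in> \<A>" by (auto simp: \<A>_def)
    qed
  qed
  then obtain N where N: "subgroup N G" "L \<subseteq> N" "N \<inter> M = {\<one>}"
    and max: "\<And>X. X \<in> \<A> \<Longrightarrow> N \<subseteq> X \<Longrightarrow> X = N" by (auto simp: \<A>_def)
  have NM: "subgroup (N <#> M) G" using mult_subgroups N M by blast
  have Nc: "N \<subseteq> carrier G" and Mc: "M \<subseteq> carrier G" using N M subgroup.subset by blast+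
  have "carrier G \<subseteq> N <#> M"
  proof
    fix x assume x: "x \<in> carrier G"
    let ?C = "range (\<lambda>k::nat. x [^] k)"
    have C: "subgroup ?C G" using x subgroup_powers by simp
    have NC: "subgroup (N <#> ?C) G" using mult_subgroups N C by blast
    have sub: "N \<subseteq> N <#> ?C"
    proof
      fix y assume "y \<in> N"
      then show "y \<in> N <#> ?C" using Nc unfolding set_mult_def
        by (auto intro!: bexI[of _ y] exI[of _ "0::nat"])
    qed
    show "x \<in> N <#> M"
    \<comment> \<open>Either N can absorb the line through x, so that maximality puts x into N, or
      some nontrivial m in M equals n x^k; then p does not divide k, and x^k, hence x, lies in N
      M.\<close>
    proof (cases "(N <#> ?C) \<inter> M = {\<one>}")
      case True
      then have "N <#> ?C = N" using max[of "N <#> ?C"] sub NC N by (auto simp: \<A>_def)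
      moreover have "x \<in> N <#> ?C"
        unfolding set_mult_def using subgroup.one_closed[OF N(1)] x nat_pow_one_exp[OF x]
        by (auto intro!: bexI[of _ \<one>] exI[of _ "1::nat"])
      ultimately have "x \<in> N" by simp
      moreover have "x = x \<otimes> \<one>" using x by simp
      ultimately show ?thesis unfolding set_mult_def using subgroup.one_closed[OF M] by blast
    next
      case False
      moreover have "\<one> \<in> (N <#> ?C) \<inter> M" using subgroup.one_closed NC M by blast
      ultimately obtain m where m: "m \<in> N <#> ?C" "m \<in> M" "m \<noteq> \<one>" by blast
      then obtain n k where nk: "n \<in> N" "m = n \<otimes> x [^] (k::nat)" by (auto simp: set_mult_def)
      have nc: "n \<in> carrier G" "m \<in> carrier G" using nk m Nc Mc by auto
      have "\<not> p dvd k"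
      proof
        assume "p dvd k"
        then have "x [^] k = \<one>" using x pow_p by (auto simp: nat_pow_pow[symmetric] elim!: dvdE)
        then show False using m nk N(3) nc by auto
      qed
      moreover have "x [^] k = inv n \<otimes> m" using nk nc x by (simp add: m_assoc[symmetric])
      then have "x [^] k \<in> N <#> M" unfolding set_mult_def
        using nk m subgroup.m_inv_closed[OF N(1)] by auto
      ultimately show ?thesis using pow_in_subgroup_cancel[OF NM x] by blast
    qed
  qed
  then have "N <#> M = carrier G" using subgroup.subset[OF NM] by blast
  then show ?thesis using that N by blast
qed

lemma complement_unique:
  assumes N: "subgroup N G" and M: "subgroup M G" and NM: "N \<inter> M = {\<one>}"
    and n: "n \<in> N" "n' \<in> N" and m: "m \<in> M" "m' \<in> M" and eq: "n \<otimes> m = n' \<otimes> m'"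
  shows "n = n' \<and> m = m'"
proof -
  have c: "n \<in> carrier G" "n' \<in> carrier G" "m \<in> carrier G" "m' \<in> carrier G"
    using assms subgroup.mem_carrier by metis+
  have "inv n' \<otimes> n = m' \<otimes> inv m"
    using eq c by (metis inv_closed inv_solve_left inv_solve_right m_assoc m_closed)
  moreover have "inv n' \<otimes> n \<in> N" "m' \<otimes> inv m \<in> M"
    using assms by (auto intro!: subgroup.m_closed subgroup.m_inv_closed)
  ultimately have "inv n' \<otimes> n = \<one>" "m' \<otimes> inv m = \<one>" using NM by auto
  then show ?thesis using c
    by (metis inv_closed inv_comm inv_equality inv_inv)
qed

section \<open>Characters with values in the p-th roots of unity\<close>

definition is_char :: "'a set \<Rightarrow> ('a \<Rightarrow> complex) \<Rightarrow> bool" where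
  "is_char H f \<longleftrightarrow> (\<forall>x\<in>H. \<forall>y\<in>H. f (x \<otimes> y) = f x * f y) \<and> (\<forall>x\<in>H. f x ^ p = 1)"

lemma is_char_mult: "is_char H f \<Longrightarrow> x \<in> H \<Longrightarrow> y \<in> H \<Longrightarrow> f (x \<otimes> y) = f x * f y"
  and is_char_pow_p: "is_char H f \<Longrightarrow> x \<in> H \<Longrightarrow> f x ^ p = 1"
  by (auto simp: is_char_def)

lemma is_char_nz: "is_char H f \<Longrightarrow> x \<in> H \<Longrightarrow> f x \<noteq> 0"
  using is_char_pow_p p_pos by (metis power_0_left less_irrefl zero_neq_one)

lemma is_char_one: "is_char H f \<Longrightarrow> subgroup H G \<Longrightarrow> f \<one> = 1"
  using is_char_mult[of H f \<one> \<one>] is_char_nz[of H f \<one>] subgroup.one_closed[of H G] by auto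

lemma is_char_norm: "is_char H f \<Longrightarrow> x \<in> H \<Longrightarrow> norm (f x) = 1"
  using is_char_pow_p p_pos power_eq_1_iff by blast

lemma is_char_pow: "is_char H f \<Longrightarrow> subgroup H G \<Longrightarrow> x \<in> H \<Longrightarrow> f (x [^] (k::nat)) = f x ^ k"
  by (induction k) (auto simp: is_char_one is_char_mult subgroup_pow_closed)

lemma is_char_inv:
  assumes "is_char H f" "subgroup H G" "x \<in> H"
  shows "f (inv x) = cnj (f x)"
proof -
  have "x \<in> carrier G" using assms subgroup.mem_carrier by metis
  then have "f x * f (inv x) = 1"
    using is_char_mult[of H f x "inv x"] is_char_one[of H f] assms by (simp add: subgroup.m_inv_closed)
  moreover have "f x * cnj (f x) = 1"
    using is_char_norm[OF assms(1,3)] by (simp add: complex_mult_cnj cmod_def)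
  ultimately show ?thesis using is_char_nz[OF assms(1,3)] by (metis mult_cancel_left)
qed

text \<open>Extend by 1 along a complement N of M: \<open>g\<close> evaluates \<open>f\<close> at
  the M-component.\<close>

lemma is_char_extend:
  assumes M: "subgroup M G" and f: "is_char M f"
  obtains g where "is_char (carrier G) g" "\<And>x. x \<in> M \<Longrightarrow> g x = f x"
proof -
  have "{\<one>} \<inter> M = {\<one>}" using subgroup.one_closed[OF M] by blast
  then obtain N where N: "subgroup N G" "N \<inter> M = {\<one>}" "N <#> M = carrier G"
    using complement_extend[OF triv_subgroup M] by metis
  define g where "g x = f (SOME m. m \<in> M \<and> (\<exists>n\<in>N. x = n \<otimes> m))" for x
  have Nc: "N \<subseteq> carrier G" and Mc: "M \<subseteq> carrier G" using N M subgroup.subset by blast+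
  have eq: "g (n \<otimes> m) = f m" if "n \<in> N" "m \<in> M" for n m
  proof -
    have "(SOME m'. m' \<in> M \<and> (\<exists>n'\<in>N. n \<otimes> m = n' \<otimes> m')) = m"
    proof (rule some_equality)
      fix m' assume "m' \<in> M \<and> (\<exists>n'\<in>N. n \<otimes> m = n' \<otimes> m')"
      then show "m' = m" using complement_unique[OF N(1) M N(2)] that by metis
    qed (use that in blast)
    then show ?thesis by (simp add: g_def)
  qed
  have "is_char (carrier G) g"
    unfolding is_char_def
  proof (intro conjI ballI)
    fix x y assume "x \<in> carrier G" "y \<in> carrier G"
    then obtain n m n' m' where nm: "n \<in> N" "m \<in> M" "x = n \<otimes> m" "n' \<in> N" "m' \<in> M" "y = n' \<otimes> m'"
      using N(3) unfolding set_mult_def by blast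
    moreover have "x \<otimes> y = (n \<otimes> n') \<otimes> (m \<otimes> m')"
      using nm Nc Mc by (simp add: subset_iff m_ac)
    ultimately show "g (x \<otimes> y) = g x * g y"
      using eq N(1) M f by (simp add: subgroup.m_closed is_char_mult)
    show "g x ^ p = 1" using nm eq f is_char_pow_p by simp
  qed
  moreover have "g x = f x" if "x \<in> M" for x
    using eq[OF subgroup.one_closed[OF N(1)] that] that Mc by auto
  ultimately show ?thesis using that by blast
qed

text \<open>The line through x meets L trivially, so L lies in a complement N of that line; the
  character sends \<open>n \<otimes> x [^] k\<close> to \<open>w ^ k\<close> for a nontrivial p-th
  root of unity w.\<close>

lemma is_char_separate:
  assumes L: "subgroup L G" and x: "x \<in> carrier G" "x \<notin> L"
  obtains f where "is_char (carrier G) f" "\<And>y. y \<in> L \<Longrightarrow> f y = 1" "f x \<noteq> 1"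
proof -
  obtain w :: complex where w: "w ^ p = 1" "w \<noteq> 1" using ex_root_of_unity_ne_1[OF prime_p] .
  let ?C = "range (\<lambda>k::nat. x [^] k)"
  have C: "subgroup ?C G" using x subgroup_powers by simp
  have pd: "p dvd k" if "x [^] (k::nat) \<in> L" for k
    using pow_in_subgroup_cancel[OF L x(1) that] x(2) by blast
  have one: "x [^] k = \<one>" "w ^ k = 1" if "p dvd k" for k :: nat
    using that x pow_p w by (auto simp: nat_pow_pow[symmetric] power_mult elim!: dvdE)
  have "L \<inter> ?C = {\<one>}"
    using subgroup.one_closed[OF L] subgroup.one_closed[OF C] one pd by blast
  then obtain N where N: "subgroup N G" "L \<subseteq> N" "N \<inter> ?C = {\<one>}" "N <#> ?C = carrier G"
    using complement_extend[OF L C] by metis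
  have Nc: "N \<subseteq> carrier G" using N subgroup.subset by blast
  define f where "f y = w ^ (SOME k::nat. \<exists>n\<in>N. y = n \<otimes> x [^] k)" for y
  \<comment> \<open>The exponent k is determined only modulo p, the order of x, and
    \<open>w ^ k\<close> depends only on k modulo p.\<close>
  have wcong: "w ^ k = w ^ l" if "x [^] k = x [^] l" for k l :: nat
    using that
  proof (induction k l rule: linorder_wlog)
    case (le k l)
    then have "x [^] k \<otimes> x [^] (l - k) = x [^] k"
      using nat_pow_mult[OF x(1), of k "l - k"] by (simp del: add_diff_assoc2 add_diff_assoc)
    then have "x [^] (l - k) = \<one>" using x by (metis l_cancel_one' nat_pow_closed)
    then have "p dvd l - k" using pd subgroup.one_closed[OF L] by metis
    then show ?case using one le by (metis le_add_diff_inverse mult_1_right power_add)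
  qed metis
  have eq: "f (n \<otimes> x [^] k) = w ^ k" if n: "n \<in> N" for n k
  proof -
    define l where "l = (SOME l::nat. \<exists>n'\<in>N. n \<otimes> x [^] k = n' \<otimes> x [^] l)"
    have "\<exists>n'\<in>N. n \<otimes> x [^] k = n' \<otimes> x [^] l"
      unfolding l_def by (rule someI[of _ k]) (use n in blast)
    then have "x [^] k = x [^] l" using complement_unique[OF N(1) C N(3)] n by blast
    then show ?thesis using wcong unfolding f_def l_def by metis
  qed
  have "is_char (carrier G) f"
    unfolding is_char_def
  proof (intro conjI ballI)
    fix a b assume "a \<in> carrier G" "b \<in> carrier G"
    then obtain n k m l where nm: "n \<in> N" "a = n \<otimes> x [^] (k::nat)" "m \<in> N" "b = m \<otimes> x [^] (l::nat)"
      using N(4) unfolding set_mult_def by blast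
    moreover have "a \<otimes> b = (n \<otimes> m) \<otimes> x [^] (k + l)"
      using nm Nc x by (simp add: subset_iff m_ac nat_pow_mult[symmetric])
    ultimately show "f (a \<otimes> b) = f a * f b"
      using eq N(1) by (simp add: subgroup.m_closed power_add)
    show "f a ^ p = 1" using nm eq w by (metis power_mult mult.commute power_one)
  qed
  moreover have "f y = 1" if "y \<in> L" for y
    using eq[of y 0] that N Nc by (simp add: subset_iff)
  moreover have "f x = w"
    using eq[of \<one> 1] N x subgroup.one_closed by auto
  ultimately show ?thesis using that w by metis
qed


subsection \<open>Fourier analysis and Bogolyubov's lemma\<close>

lemma subgroup_prime_exponent_group:
  assumes "subgroup H G"
  shows "prime_exponent_group (G\<lparr>carrier := H\<rparr>) p"
proof -
  interpret H: group "G\<lparr>carrier := H\<rparr>" using subgroup.subgroup_is_group[OF assms is_group] .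
  interpret H: comm_group "G\<lparr>carrier := H\<rparr>"
    by (rule H.group_comm_groupI) (use subgroup.mem_carrier[OF assms] m_comm in auto)
  show ?thesis
  proof
    fix x assume "x \<in> carrier (G\<lparr>carrier := H\<rparr>)"
    then have "x \<in> carrier G" using subgroup.mem_carrier[OF assms] by simp
    then show "x [^]\<^bsub>G\<lparr>carrier := H\<rparr>\<^esub> p = \<one>\<^bsub>G\<lparr>carrier := H\<rparr>\<^esub>"
      using pow_p by (simp add: nat_pow_consistent[symmetric])
  qed (use prime_p in auto)
qed

section \<open>Orthogonality relations on finite groups\<close>

definition chars :: "('a \<Rightarrow> complex) set" where
  "chars = {f \<in> extensional (carrier G). is_char (carrier G) f}"

lemma finite_chars: "finite (carrier G) \<Longrightarrow> finite chars"
proof -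
  assume "finite (carrier G)"
  then have "finite (\<Pi>\<^sub>E x\<in>carrier G. {z::complex. z ^ p = 1})"
    using finite_roots_unity[of p] p_pos by (intro finite_PiE) auto
  moreover have "chars \<subseteq> (\<Pi>\<^sub>E x\<in>carrier G. {z::complex. z ^ p = 1})"
    by (auto simp: chars_def is_char_def PiE_def)
  ultimately show ?thesis by (rule finite_subset[rotated])
qed

lemma charsD: "f \<in> chars \<Longrightarrow> is_char (carrier G) f"
  by (simp add: chars_def)

lemma one_chars: "(\<lambda>x\<in>carrier G. 1) \<in> chars"
  by (auto simp: chars_def is_char_def)

lemma times_chars: "f \<in> chars \<Longrightarrow> g \<in> chars \<Longrightarrow> (\<lambda>x\<in>carrier G. f x * g x) \<in> chars"
  by (auto simp: chars_def is_char_def power_mult_distrib)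

text \<open>Translation by y permutes the group and multiplies the sum by
  \<open>f y\<close>.\<close>

lemma sum_char_eq_0:
  assumes f: "is_char (carrier G) f" and y: "y \<in> carrier G" "f y \<noteq> 1"
  shows "(\<Sum>x\<in>carrier G. f x) = 0"
proof -
  have "(\<Sum>x\<in>carrier G. f x) = (\<Sum>x\<in>carrier G. f (y \<otimes> x))"
    by (rule sum.reindex_bij_witness[of _ "\<lambda>x. y \<otimes> x" "\<lambda>x. inv y \<otimes> x"])
       (use y in \<open>auto simp: m_assoc[symmetric]\<close>)
  also have "\<dots> = f y * (\<Sum>x\<in>carrier G. f x)"
    using f y by (simp add: is_char_mult sum_distrib_left)
  finally have "(f y - 1) * (\<Sum>x\<in>carrier G. f x) = 0" by (simp add: algebra_simps)
  then show ?thesis using y by simp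
qed

text \<open>The dual relation: some character g has \<open>g x \<noteq> 1\<close>, and
  multiplication by g permutes the characters while multiplying the sum by
  \<open>g x\<close>.\<close>

lemma sum_chars_eq_0:
  assumes x: "x \<in> carrier G" "x \<noteq> \<one>"
  shows "(\<Sum>f\<in>chars. f x) = 0"
proof -
  obtain g0 where g0: "is_char (carrier G) g0" "g0 x \<noteq> 1"
    using is_char_separate[OF triv_subgroup x(1)] x(2) by auto
  define g where "g = restrict g0 (carrier G)"
  have g: "g \<in> chars" "g x \<noteq> 1"
    using g0 x by (auto simp: g_def chars_def is_char_def)
  have gz: "g y * cnj (g y) = 1" "cnj (g y) * g y = 1" if "y \<in> carrier G" for y
    using is_char_norm[OF charsD[OF g(1)] that] by (simp_all add: complex_mult_cnj cmod_def mult.commute)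
  have ginv: "(\<lambda>x\<in>carrier G. cnj (g x)) \<in> chars"
    using g x by (auto simp: chars_def is_char_def simp flip: complex_cnj_power)
  have ext: "f = (\<lambda>y\<in>carrier G. f y)" if "f \<in> chars" for f
    using that by (auto simp: chars_def extensional_restrict)
  have "(\<Sum>f\<in>chars. f x) = (\<Sum>f\<in>chars. (\<lambda>y\<in>carrier G. g y * f y) x)"
  proof (rule sum.reindex_bij_witness[of _ "\<lambda>f. \<lambda>y\<in>carrier G. g y * f y" "\<lambda>f. \<lambda>y\<in>carrier G. cnj (g y) * f y"])
    fix f assume f: "f \<in> chars"
    show "(\<lambda>y\<in>carrier G. g y * (\<lambda>y\<in>carrier G. cnj (g y) * f y) y) = f"
      using f gz by (subst ext[OF f]) (auto simp: mult.assoc[symmetric] restrict_def)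
    show "(\<lambda>y\<in>carrier G. cnj (g y) * (\<lambda>y\<in>carrier G. g y * f y) y) = f"
      using f gz by (subst ext[OF f]) (auto simp: mult.assoc[symmetric] restrict_def)
    show "(\<lambda>y\<in>carrier G. g y * f y) \<in> chars" using times_chars g x f by blast
    show "(\<lambda>y\<in>carrier G. cnj (g y) * f y) \<in> chars"
      using times_chars[OF ginv f] by (simp add: restrict_def cong: if_cong)
    show "(\<lambda>y\<in>carrier G. g y * (\<lambda>y\<in>carrier G. cnj (g y) * f y) y) x = f x"
      using x gz[OF x(1)] by (simp add: mult.assoc[symmetric])
  qed
  also have "\<dots> = g x * (\<Sum>f\<in>chars. f x)" using x by (simp add: sum_distrib_left)
  finally have "(g x - 1) * (\<Sum>f\<in>chars. f x) = 0" by (simp add: algebra_simps)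
  then show ?thesis using g x by simp
qed

lemma sum_chars:
  assumes "x \<in> carrier G"
  shows "(\<Sum>f\<in>chars. f x) = (if x = \<one> then of_nat (card chars) else 0)"
proof (cases "x = \<one>")
  case True
  have "(\<Sum>f\<in>chars. f x) = (\<Sum>f\<in>chars. 1)"
    using True is_char_one[OF charsD subgroup_self] by (intro sum.cong) auto
  then show ?thesis using True by simp
qed (use assms sum_chars_eq_0 in simp)

text \<open>Both numbers are the double sum of all values \<open>f x\<close>: summing over f first
  leaves only the term at \<open>\<one>\<close>, summing over x first only that of the trivial
  character.\<close>

lemma card_chars:
  assumes fin: "finite (carrier G)"
  shows "card chars = card (carrier G)"
proof -
  let ?e = "\<lambda>x\<in>carrier G. 1 :: complex"
  have "(\<Sum>x\<in>carrier G. \<Sum>f\<in>chars. f x) = of_nat (card chars)"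
    using fin by (simp add: sum_chars cong: sum.cong)
  moreover have "(\<Sum>f\<in>chars. \<Sum>x\<in>carrier G. f x) = (\<Sum>f\<in>chars. if f = ?e then of_nat (card (carrier G)) else 0)"
  proof (rule sum.cong)
    fix f assume f: "f \<in> chars"
    show "(\<Sum>x\<in>carrier G. f x) = (if f = ?e then of_nat (card (carrier G)) else 0)"
    proof (cases "f = ?e")
      case False
      have "\<exists>y\<in>carrier G. f y \<noteq> 1"
      proof (rule ccontr)
        assume "\<not> (\<exists>y\<in>carrier G. f y \<noteq> 1)"
        then have "f = ?e" using f by (intro extensionalityI[of _ "carrier G"]) (auto simp: chars_def)
        then show False using False by simp
      qed
      then obtain y where "y \<in> carrier G" "f y \<noteq> 1" by blast
      then show ?thesis using sum_char_eq_0[OF charsD[OF f]] False by simp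
    qed simp
  qed simp
  moreover have "\<dots> = of_nat (card (carrier G))"
    using one_chars finite_chars[OF fin] by simp
  ultimately have "(of_nat (card chars) :: complex) = of_nat (card (carrier G))"
    using sum.swap[of "\<lambda>x f. f x" chars "carrier G"] by simp
  then show ?thesis by simp
qed

text \<open>Opening the square gives the values \<open>f (a \<otimes> inv b)\<close>; summed over
  all f, only the diagonal a = b survives.\<close>

lemma parseval:
  assumes fin: "finite (carrier G)" and A: "A \<subseteq> carrier G"
  shows "(\<Sum>f\<in>chars. (norm (\<Sum>a\<in>A. f a))\<^sup>2) = card (carrier G) * card A"
proof -
  have finA: "finite A" using fin A finite_subset by blast
  have "complex_of_real (\<Sum>f\<in>chars. (norm (\<Sum>a\<in>A. f a))\<^sup>2) = (\<Sum>f\<in>chars. (\<Sum>a\<in>A. f a) * cnj (\<Sum>b\<in>A. f b))"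
    by (simp only: complex_norm_square of_real_sum)
  also have "\<dots> = (\<Sum>f\<in>chars. \<Sum>a\<in>A. \<Sum>b\<in>A. f (a \<otimes> inv b))"
    unfolding cnj_sum sum_product
    by (intro sum.cong refl) (use A in \<open>auto simp: subset_iff is_char_mult[OF charsD] is_char_inv[OF charsD subgroup_self]\<close>)
  also have "\<dots> = (\<Sum>a\<in>A. \<Sum>b\<in>A. \<Sum>f\<in>chars. f (a \<otimes> inv b))"
    by (subst sum.swap) (rule sum.cong[OF refl], rule sum.swap)
  also have "\<dots> = (\<Sum>a\<in>A. \<Sum>b\<in>A. if a = b then of_nat (card chars) else 0)"
  proof (intro sum.cong refl)
    fix a b assume "a \<in> A" "b \<in> A"
    then have c: "a \<in> carrier G" "b \<in> carrier G" using A by auto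
    then have "a \<otimes> inv b = \<one> \<longleftrightarrow> a = b" by (metis inv_closed inv_equality inv_inv r_inv)
    then show "(\<Sum>f\<in>chars. f (a \<otimes> inv b)) = (if a = b then of_nat (card chars) else 0)"
      using c by (simp add: sum_chars)
  qed
  also have "\<dots> = of_nat (card A) * of_nat (card (carrier G))"
    using finA by (simp add: card_chars[OF fin])
  finally have "complex_of_real (\<Sum>f\<in>chars. (norm (\<Sum>a\<in>A. f a))\<^sup>2) = complex_of_real (card (carrier G) * card A)"
    by (simp add: mult.commute)
  then show ?thesis using of_real_eq_iff by blast
qed

text \<open>In additive notation this is \<open>2 A - 2 A\<close>.\<close>

definition bohr_set :: "'a set \<Rightarrow> 'a set" where
  "bohr_set A = {a \<otimes> inv b \<otimes> (c \<otimes> inv d) | a b c d. a \<in> A \<and> b \<in> A \<and> c \<in> A \<and> d \<in> A}"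

text \<open>Expanded, the sum is \<open>card chars\<close> times the number of quadruples with
  \<open>a \<otimes> inv b \<otimes> (c \<otimes> inv d) \<otimes> x = \<one>\<close>. There are
  none, because \<open>bohr_set A\<close> is closed under inversion.\<close>

lemma fourth_moment_eq_0:
  assumes fin: "finite (carrier G)" and A: "A \<subseteq> carrier G" and x: "x \<in> carrier G" "x \<notin> bohr_set A"
  shows "(\<Sum>f\<in>chars. complex_of_real ((norm (\<Sum>a\<in>A. f a)) ^ 4) * f x) = 0"
proof -
  have ne: "a \<otimes> inv b \<otimes> (c \<otimes> inv d) \<otimes> x \<noteq> \<one>" if abcd: "a \<in> A" "b \<in> A" "c \<in> A" "d \<in> A" for a b c d
  proof
    assume eq: "a \<otimes> inv b \<otimes> (c \<otimes> inv d) \<otimes> x = \<one>"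
    have c: "a \<in> carrier G" "b \<in> carrier G" "c \<in> carrier G" "d \<in> carrier G" using A abcd by auto
    then have "x = inv (a \<otimes> inv b \<otimes> (c \<otimes> inv d))"
      using eq x by (metis inv_closed inv_equality inv_inv m_closed m_comm)
    also have "\<dots> = b \<otimes> inv a \<otimes> (d \<otimes> inv c)" using c by (simp add: inv_mult m_ac)
    finally have "x \<in> bohr_set A" using abcd unfolding bohr_set_def by blast
    then show False using x by simp
  qed
  have "(\<Sum>f\<in>chars. complex_of_real ((norm (\<Sum>a\<in>A. f a)) ^ 4) * f x)
      = (\<Sum>f\<in>chars. ((\<Sum>a\<in>A. f a) * cnj (\<Sum>a\<in>A. f a)) * ((\<Sum>a\<in>A. f a) * cnj (\<Sum>a\<in>A. f a)) * f x)"
    by (simp only: complex_norm_square[symmetric]) (simp add: power2_eq_square[symmetric] power_mult[symmetric])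
  also have "\<dots> = (\<Sum>f\<in>chars. \<Sum>(a,b)\<in>A\<times>A. \<Sum>(c,d)\<in>A\<times>A. f (a \<otimes> inv b \<otimes> (c \<otimes> inv d) \<otimes> x))"
  proof (intro sum.cong refl)
    fix f assume f: "f \<in> chars"
    have sq: "(\<Sum>a\<in>A. f a) * cnj (\<Sum>a\<in>A. f a) = (\<Sum>(a,b)\<in>A\<times>A. f (a \<otimes> inv b))"
      unfolding cnj_sum sum_product sum.cartesian_product using A
      by (intro sum.cong refl) (auto simp: subset_iff is_char_mult[OF charsD[OF f]] is_char_inv[OF charsD[OF f] subgroup_self])
    show "((\<Sum>a\<in>A. f a) * cnj (\<Sum>a\<in>A. f a)) * ((\<Sum>a\<in>A. f a) * cnj (\<Sum>a\<in>A. f a)) * f x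
        = (\<Sum>(a,b)\<in>A\<times>A. \<Sum>(c,d)\<in>A\<times>A. f (a \<otimes> inv b \<otimes> (c \<otimes> inv d) \<otimes> x))"
      unfolding sq unfolding sum_product unfolding sum_distrib_right using A x
      by (intro sum.cong refl) (auto intro!: sum.cong simp: subset_iff is_char_mult[OF charsD[OF f]] sum_distrib_right)
  qed
  also have "\<dots> = (\<Sum>ab\<in>A\<times>A. \<Sum>cd\<in>A\<times>A. \<Sum>f\<in>chars. f (fst ab \<otimes> inv (snd ab) \<otimes> (fst cd \<otimes> inv (snd cd)) \<otimes> x))"
    unfolding case_prod_beta by (subst sum.swap) (rule sum.cong[OF refl], rule sum.swap)
  also have "\<dots> = 0"
  proof (rule sum.neutral, rule ballI, rule sum.neutral, rule ballI)
    fix ab cd assume "ab \<in> A \<times> A" "cd \<in> A \<times> A"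
    then obtain a b c d where *: "ab = (a,b)" "cd = (c,d)" "a \<in> A" "b \<in> A" "c \<in> A" "d \<in> A" by blast
    then have "a \<otimes> inv b \<otimes> (c \<otimes> inv d) \<otimes> x \<in> carrier G" using A x by (auto simp: subset_iff)
    then show "(\<Sum>f\<in>chars. f (fst ab \<otimes> inv (snd ab) \<otimes> (fst cd \<otimes> inv (snd cd)) \<otimes> x)) = 0"
      using * sum_chars_eq_0 ne by simp
  qed
  finally show ?thesis .
qed

text \<open>The number of characters is controlled by the density 1/N of A alone, whatever the size
  of the group.\<close>

lemma bogolyubov:
  fixes N :: nat
  assumes fin: "finite (carrier G)" and A: "A \<subseteq> carrier G"
    and dense: "card (carrier G) \<le> N * card A"
  obtains \<Gamma> where "\<Gamma> \<subseteq> chars" "\<Gamma> \<noteq> {}" "card \<Gamma> \<le> 2 * N\<^sup>2"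
    "\<And>x. x \<in> carrier G \<Longrightarrow> (\<And>f. f \<in> \<Gamma> \<Longrightarrow> f x = 1) \<Longrightarrow> x \<in> bohr_set A"
proof -
  define g where "g = real (card (carrier G))"
  define \<alpha> where "\<alpha> = real (card A)"
  define S where "S f = norm (\<Sum>a\<in>A. f a)" for f :: "'a \<Rightarrow> complex"
  \<comment> \<open>The threshold makes the remaining fourth moment at most
    \<open>t * (g * \<alpha>)\<close>, that is \<open>\<alpha> ^ 4 / 2\<close>, half the term of the
    trivial character, while Parseval bounds the size of the spectrum by
    \<open>g * \<alpha> / t\<close>, that is \<open>2 * g\<^sup>2 / \<alpha>\<^sup>2\<close>, at
    most 2 N^2.\<close>
  define t where "t = \<alpha> ^ 3 / (2 * g)"
  \<comment> \<open>The large spectrum of \<open>A\<close>: by Parseval it is small, and the fourth moment of the remaining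
    Fourier coefficients is too small to cancel its contribution at a point of its kernel.\<close>
  define \<Gamma> where "\<Gamma> = {f \<in> chars. t \<le> (S f)\<^sup>2}"
  let ?e = "\<lambda>x\<in>carrier G. 1 :: complex"
  have finA: "finite A" using fin A finite_subset by blast
  have gpos: "g > 0" using fin by (auto simp: g_def card_gt_0_iff)
  have gle: "g \<le> N * \<alpha>" using dense unfolding g_def \<alpha>_def by (metis of_nat_le_iff of_nat_mult)
  have apos: "\<alpha> > 0" using gle gpos by (metis \<alpha>_def less_le_trans mult_eq_0_iff of_nat_0_less_iff of_nat_eq_0_iff neq0_conv less_irrefl)
  have ale: "\<alpha> \<le> g" using A fin by (simp add: \<alpha>_def g_def card_mono)
  have finc: "finite chars" using finite_chars fin by blast
  have tpos: "t > 0" using apos gpos by (simp add: t_def)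
  have P: "(\<Sum>f\<in>chars. (S f)\<^sup>2) = g * \<alpha>" using parseval[OF fin A] by (simp add: S_def g_def \<alpha>_def)
  have "(\<Sum>a\<in>A. ?e a) = (\<Sum>a\<in>A. 1)" using A by (intro sum.cong) auto
  then have Se: "S ?e = \<alpha>" by (simp add: S_def \<alpha>_def)
  have "\<alpha> * \<alpha>\<^sup>2 \<le> (2 * g) * \<alpha>\<^sup>2" using ale gpos by (intro mult_right_mono) auto
  then have "t \<le> \<alpha>\<^sup>2" using gpos by (simp add: t_def field_simps power3_eq_cube power2_eq_square)
  then have e: "?e \<in> \<Gamma>" using one_chars Se by (simp add: \<Gamma>_def)
  have "card \<Gamma> * t = (\<Sum>f\<in>\<Gamma>. t)" by simp
  also have "\<dots> \<le> (\<Sum>f\<in>\<Gamma>. (S f)\<^sup>2)" by (intro sum_mono) (auto simp: \<Gamma>_def)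
  also have "\<dots> \<le> g * \<alpha>" unfolding P[symmetric] using finc by (intro sum_mono2) (auto simp: \<Gamma>_def)
  finally have "card \<Gamma> * \<alpha> ^ 3 \<le> 2 * g\<^sup>2 * \<alpha>" using gpos by (simp add: t_def field_simps power2_eq_square)
  then have "card \<Gamma> * \<alpha>\<^sup>2 * \<alpha> \<le> 2 * g\<^sup>2 * \<alpha>" by (simp add: power3_eq_cube power2_eq_square mult.assoc)
  then have "card \<Gamma> * \<alpha>\<^sup>2 \<le> 2 * g\<^sup>2" using apos by (simp only: mult_le_cancel_right_pos)
  also have "\<dots> \<le> 2 * (N * \<alpha>)\<^sup>2" using gle gpos by (intro mult_left_mono power_mono) auto
  also have "\<dots> = (2 * N\<^sup>2) * \<alpha>\<^sup>2" by (simp add: power_mult_distrib)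
  finally have "real (card \<Gamma>) \<le> 2 * N\<^sup>2" using apos by (simp add: mult_le_cancel_right_pos)
  then have cardG: "card \<Gamma> \<le> 2 * N\<^sup>2" by (metis of_nat_le_iff of_nat_mult of_nat_numeral of_nat_power)
  have "x \<in> bohr_set A" if x: "x \<in> carrier G" and ker: "\<And>f. f \<in> \<Gamma> \<Longrightarrow> f x = 1" for x
  proof (rule ccontr)
    assume "x \<notin> bohr_set A"
    then have "(\<Sum>f\<in>chars. complex_of_real (S f ^ 4) * f x) = 0"
      using fourth_moment_eq_0[OF fin A x] by (simp add: S_def)
    then have "Re (\<Sum>f\<in>chars. complex_of_real (S f ^ 4) * f x) = 0" by simp
    then have "0 = (\<Sum>f\<in>chars. S f ^ 4 * Re (f x))"
      unfolding Re_sum times_complex.sel Re_complex_of_real Im_complex_of_real by simp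
    also have "\<dots> = (\<Sum>f\<in>\<Gamma>. S f ^ 4 * Re (f x)) + (\<Sum>f\<in>chars - \<Gamma>. S f ^ 4 * Re (f x))"
      using finc by (subst add.commute) (intro sum.subset_diff, auto simp: \<Gamma>_def)
    \<comment> \<open>On the spectrum all values \<open>f x\<close> are 1, and the trivial character
      alone gives \<open>\<alpha> ^ 4\<close>; elsewhere \<open>Re (f x)\<close> is at least -1 and
      \<open>(S f)\<^sup>2\<close> is below t.\<close>
    also have "\<dots> \<ge> \<alpha> ^ 4 + (\<Sum>f\<in>chars - \<Gamma>. - (t * (S f)\<^sup>2))"
    proof (rule add_mono)
      have "\<alpha> ^ 4 = (\<Sum>f\<in>{?e}. S f ^ 4)" using Se by simp
      also have "\<dots> \<le> (\<Sum>f\<in>\<Gamma>. S f ^ 4)" using e finc by (intro sum_mono2) (auto simp: \<Gamma>_def)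
      also have "\<dots> = (\<Sum>f\<in>\<Gamma>. S f ^ 4 * Re (f x))" 
        by (intro sum.cong refl) (metis ker mult.right_neutral one_complex.sel(1))
      finally show "\<alpha> ^ 4 \<le> (\<Sum>f\<in>\<Gamma>. S f ^ 4 * Re (f x))" .
      show "(\<Sum>f\<in>chars - \<Gamma>. - (t * (S f)\<^sup>2)) \<le> (\<Sum>f\<in>chars - \<Gamma>. S f ^ 4 * Re (f x))"
      proof (rule sum_mono)
        fix f assume f: "f \<in> chars - \<Gamma>"
        then have "norm (f x) = 1" using is_char_norm[OF charsD] x by blast
        then have "- 1 \<le> Re (f x)" using abs_Re_le_cmod[of "f x"] by linarith
        then have "S f ^ 4 * (- 1) \<le> S f ^ 4 * Re (f x)" by (intro mult_left_mono) auto
        moreover have "(S f)\<^sup>2 * (S f)\<^sup>2 \<le> t * (S f)\<^sup>2" using f by (intro mult_right_mono) (auto simp: \<Gamma>_def)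
        then have "S f ^ 4 \<le> t * (S f)\<^sup>2" by (simp add: power2_eq_square power4_eq_xxxx mult.assoc)
        ultimately show "- (t * (S f)\<^sup>2) \<le> S f ^ 4 * Re (f x)" by linarith
      qed
    qed
    finally have "\<alpha> ^ 4 \<le> t * (\<Sum>f\<in>chars - \<Gamma>. (S f)\<^sup>2)" by (simp add: sum_negf sum_distrib_left)
    also have "\<dots> \<le> t * (g * \<alpha>)" unfolding P[symmetric] using finc tpos
      by (intro mult_left_mono sum_mono2) auto
    also have "\<dots> = \<alpha> ^ 4 / 2" using gpos by (simp add: t_def field_simps power4_eq_xxxx power3_eq_cube)
    finally show False using apos by simp
  qed
  moreover have "\<Gamma> \<subseteq> chars" "\<Gamma> \<noteq> {}" using e by (auto simp: \<Gamma>_def)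
  ultimately show ?thesis using that cardG by blast
qed


section \<open>From finite subgroups to a subgroup of finite index\<close>

definition quotients :: "'a set \<Rightarrow> 'a set" where
  "quotients V = {inv a \<otimes> b | a b. a \<in> V \<and> b \<in> V}"

lemma bohr_set_mono: "A \<subseteq> B \<Longrightarrow> bohr_set A \<subseteq> bohr_set B"
  unfolding bohr_set_def by blast

text \<open>The centers g need not lie in H. A nonempty piece of H in the translate g V is moved by
  \<open>inv h\<close>, for some h in it, injectively into \<open>H \<inter> quotients V\<close>;
  this is why \<open>quotients V\<close> replaces V.\<close>

lemma card_Int_quotients:
  assumes V: "V \<subseteq> carrier G" and F: "finite F" "F \<subseteq> carrier G"
    and cover: "carrier G \<subseteq> (\<Union>g\<in>F. (\<lambda>x. g \<otimes> x) ` V)"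
    and H: "subgroup H G" "finite H"
  shows "card H \<le> card F * card (H \<inter> quotients V)"
proof -
  have Hc: "H \<subseteq> carrier G" using H subgroup.subset by blast
  have "card (H \<inter> (\<lambda>x. g \<otimes> x) ` V) \<le> card (H \<inter> quotients V)" if g: "g \<in> F" for g
  proof (cases "H \<inter> (\<lambda>x. g \<otimes> x) ` V = {}")
    case False
    then obtain h v where h: "h \<in> H" "h = g \<otimes> v" "v \<in> V" by blast
    have hc: "h \<in> carrier G" "g \<in> carrier G" "v \<in> carrier G" using h Hc g F V by auto
    show ?thesis
    proof (rule card_inj_on_le[of "\<lambda>x. inv h \<otimes> x"])
      show "inj_on (\<lambda>x. inv h \<otimes> x) (H \<inter> (\<lambda>x. g \<otimes> x) ` V)"
        using hc Hc inj_on_cmult[of "inv h"] by (auto intro: inj_on_subset)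
      show "(\<lambda>x. inv h \<otimes> x) ` (H \<inter> (\<lambda>x. g \<otimes> x) ` V) \<subseteq> H \<inter> quotients V"
      proof clarify
        fix v' assume v': "v' \<in> V" "g \<otimes> v' \<in> H"
        then have vc: "v' \<in> carrier G" using V by blast
        have "inv h \<otimes> (g \<otimes> v') = inv v \<otimes> (inv g \<otimes> (g \<otimes> v'))"
          using hc(2,3) vc by (simp add: h(2) inv_mult_group m_assoc)
        also have "inv g \<otimes> (g \<otimes> v') = v'" using hc(2) vc by (simp add: m_assoc[symmetric])
        finally have "inv h \<otimes> (g \<otimes> v') = inv v \<otimes> v'" .
        moreover have "inv h \<otimes> (g \<otimes> v') \<in> H" using H h v' by (simp add: subgroup.m_closed subgroup.m_inv_closed)
        ultimately show "inv h \<otimes> (g \<otimes> v') \<in> H \<inter> quotients V" using v' h by (auto simp: quotients_def)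
      qed
      show "finite (H \<inter> quotients V)" using H by auto
    qed
  qed simp
  then have "(\<Sum>g\<in>F. card (H \<inter> (\<lambda>x. g \<otimes> x) ` V)) \<le> (\<Sum>g\<in>F. card (H \<inter> quotients V))"
    by (intro sum_mono) auto
  moreover have "card H \<le> (\<Sum>g\<in>F. card (H \<inter> (\<lambda>x. g \<otimes> x) ` V))"
  proof -
    have "H = (\<Union>g\<in>F. H \<inter> (\<lambda>x. g \<otimes> x) ` V)" using cover Hc by auto
    then show ?thesis using card_UN_le[OF F(1), of "\<lambda>g. H \<inter> (\<lambda>x. g \<otimes> x) ` V"] by simp
  qed
  ultimately show ?thesis by simp
qed

text \<open>This is \<open>bogolyubov\<close> inside H. The family is indexed by the same range of j
  for every H, as needed for gluing the families of different subgroups.\<close>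

lemma finite_subgroup_chars:
  assumes V: "V \<subseteq> carrier G" and F: "finite F" "F \<subseteq> carrier G"
    and cover: "carrier G \<subseteq> (\<Union>g\<in>F. (\<lambda>x. g \<otimes> x) ` V)"
    and H: "subgroup H G" "finite H"
  shows "\<exists>f. (\<forall>j<2 * (card F)\<^sup>2. is_char H (f j)) \<and>
           (\<forall>x\<in>H. (\<forall>j<2 * (card F)\<^sup>2. f j x = 1) \<longrightarrow> x \<in> bohr_set (quotients V))"
proof -
  let ?H = "G\<lparr>carrier := H\<rparr>"
  let ?A = "H \<inter> quotients V"
  interpret H: prime_exponent_group ?H p using subgroup_prime_exponent_group[OF H(1)] .
  have char: "H.is_char H = is_char H" by (simp add: fun_eq_iff H.is_char_def is_char_def)
  have inv: "x \<in> H \<Longrightarrow> inv\<^bsub>?H\<^esub> x = inv x" for x using m_inv_consistent[OF H(1)] by simp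
  have "card (carrier ?H) \<le> card F * card ?A" using card_Int_quotients[OF assms] by simp
  then obtain \<Gamma> where G: "\<Gamma> \<subseteq> H.chars" "\<Gamma> \<noteq> {}" "card \<Gamma> \<le> 2 * (card F)\<^sup>2"
    and ker: "\<And>x. x \<in> H \<Longrightarrow> (\<And>f. f \<in> \<Gamma> \<Longrightarrow> f x = 1) \<Longrightarrow> x \<in> H.bohr_set ?A"
    using H.bogolyubov[of ?A "card F"] H(2) by auto
  have finG: "finite \<Gamma>" using G(1) H.finite_chars H(2) finite_subset by auto
  then have "\<Gamma> \<lesssim> {..<2 * (card F)\<^sup>2}" using G(3) lepoll_iff_finite_card by blast
  then obtain f where f: "\<Gamma> \<subseteq> f ` {..<2 * (card F)\<^sup>2}" unfolding lepoll_iff by blast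
  \<comment> \<open>Indices that miss \<open>\<Gamma>\<close> repeat one of its members, so the
    common kernel is unchanged.\<close>
  define f' where "f' j = (if f j \<in> \<Gamma> then f j else (SOME g. g \<in> \<Gamma>))" for j
  have "f' j \<in> \<Gamma>" for j using G(2) by (simp add: f'_def some_in_eq)
  then have "is_char H (f' j)" for j using G(1) H.charsD[of "f' j"] char by auto
  moreover have "x \<in> bohr_set (quotients V)" if x: "x \<in> H" "\<forall>j<2 * (card F)\<^sup>2. f' j x = 1" for x
  proof -
    have "g x = 1" if "g \<in> \<Gamma>" for g
      using f x that by (force simp: f'_def)
    then have "x \<in> H.bohr_set ?A" using ker x by blast
    then obtain a b c d where abcd: "a \<in> ?A" "b \<in> ?A" "c \<in> ?A" "d \<in> ?A"
      and "x = a \<otimes>\<^bsub>?H\<^esub> inv\<^bsub>?H\<^esub> b \<otimes>\<^bsub>?H\<^esub> (c \<otimes>\<^bsub>?H\<^esub> inv\<^bsub>?H\<^esub> d)"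
      unfolding H.bohr_set_def by blast
    then have "x = a \<otimes> inv b \<otimes> (c \<otimes> inv d)" using inv by simp
    then have "x \<in> bohr_set ?A" using abcd unfolding bohr_set_def by blast
    then show ?thesis using bohr_set_mono[of ?A "quotients V"] by blast
  qed
  ultimately show ?thesis by blast
qed

text \<open>A tuple of m functions is a point of the compact space X. Multiplicativity at x, y and
  the kernel condition at x are closed, and finitely many of these conditions concern a finite
  subgroup only, where \<open>loc\<close> solves them.\<close>

lemma chars_compactness:
  fixes m :: nat and Q :: "'a set"
  assumes loc: "\<And>H. subgroup H G \<Longrightarrow> finite H \<Longrightarrow>
      \<exists>f. (\<forall>j<m. is_char H (f j)) \<and> (\<forall>x\<in>H. (\<forall>j<m. f j x = 1) \<longrightarrow> x \<in> Q)"
  obtains f where "\<And>j. j < m \<Longrightarrow> is_char (carrier G) (f j)"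
    "\<And>x. x \<in> carrier G \<Longrightarrow> (\<And>j. j < m \<Longrightarrow> f j x = 1) \<Longrightarrow> x \<in> Q"
proof -
  let ?R = "{z::complex. z ^ p = 1}"
  let ?I = "{..<m} \<times> carrier G"
  define X where "X = product_topology (\<lambda>_::nat \<times> 'a. discrete_topology ?R) ?I"
  have ts: "topspace X = (\<Pi>\<^sub>E i\<in>?I. ?R)" by (simp add: X_def)
  have "compact_space X" unfolding X_def using finite_roots_unity[of p] p_pos
    by (auto simp: compact_space_product_topology compact_space_discrete_topology)
  define E where "E = (\<lambda>(x, y). {f \<in> topspace X. (\<forall>j<m. f (j, x \<otimes> y) = f (j, x) * f (j, y)) \<and> ((\<forall>j<m. f (j, x) = 1) \<longrightarrow> x \<in> Q)})"
  have clo: "closedin X (E xy)" if xyc: "xy \<in> carrier G \<times> carrier G" for xy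
  proof -
    obtain x y where xy: "xy = (x, y)" "x \<in> carrier G" "y \<in> carrier G" using xyc by blast
    have proj: "continuous_map X (discrete_topology UNIV) (\<lambda>f. f (j, z))" if "j < m" "z \<in> carrier G" for j z
    proof -
      have "continuous_map X (discrete_topology ?R) (\<lambda>f. f (j, z))"
        unfolding X_def using that continuous_map_product_projection[of "(j,z)" ?I "\<lambda>_. discrete_topology ?R"] by simp
      then show ?thesis by (rule continuous_map_into_fulltopology[of X "discrete_topology UNIV" ?R, simplified subtopology_discrete_topology, simplified])
    qed
    \<comment> \<open>Coordinates take values in a discrete space, so any condition on finitely many
      of them is closed.\<close>
    have clopen: "closedin X {f \<in> topspace X. P (f (j, u)) (f (j, v)) (f (j, w))}"
      if "j < m" "u \<in> carrier G" "v \<in> carrier G" "w \<in> carrier G" for j u v w and P :: "complex \<Rightarrow> complex \<Rightarrow> complex \<Rightarrow> bool"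
    proof -
      have "continuous_map X (prod_topology (discrete_topology UNIV) (prod_topology (discrete_topology UNIV) (discrete_topology UNIV)))
        (\<lambda>f. (f (j, u), f (j, v), f (j, w)))"
        using proj that by (auto simp: continuous_map_pairwise o_def)
      then have "closedin X {f \<in> topspace X. (f (j, u), f (j, v), f (j, w)) \<in> {(a, b, c). P a b c}}"
        by (rule closedin_continuous_map_preimage) (simp add: prod_topology_discrete_topology[symmetric] del: prod_topology_discrete_topology)
      then show ?thesis by simp
    qed
    \<comment> \<open>For x outside Q the kernel condition says that
      \<open>f (j, x) \<noteq> 1\<close> for some j < m, which gives a finite union of closed
      sets.\<close>
    have "E xy = topspace X \<inter> (\<Inter>j\<in>{..<m}. {f \<in> topspace X. f (j, x \<otimes> y) = f (j, x) * f (j, y)})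
        \<inter> (if x \<in> Q then topspace X else (\<Union>j\<in>{..<m}. {f \<in> topspace X. f (j, x) \<noteq> 1}))"
      by (auto simp: E_def xy)
    moreover have "closedin X (topspace X \<inter> (\<Inter>j\<in>{..<m}. {f \<in> topspace X. f (j, x \<otimes> y) = f (j, x) * f (j, y)}))"
    proof (cases "m = 0")
      case False
      have "closedin X (\<Inter>j\<in>{..<m}. {f \<in> topspace X. f (j, x \<otimes> y) = f (j, x) * f (j, y)})"
        using False xy clopen[of _ "x \<otimes> y" x y "\<lambda>a b c. a = b * c"] by (intro closedin_INT) auto
      then show ?thesis by blast
    qed simp
    moreover have "closedin X (if x \<in> Q then topspace X else (\<Union>j\<in>{..<m}. {f \<in> topspace X. f (j, x) \<noteq> 1}))"
      using xy clopen[of _ x x x "\<lambda>a b c. a \<noteq> 1"] by (auto intro!: closedin_Union)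
    ultimately show ?thesis by (simp only:) (rule closedin_Int)
  qed
  have fip: "\<Inter>\<F> \<noteq> {}" if fin: "finite \<F>" "\<F> \<subseteq> E ` (carrier G \<times> carrier G)" for \<F>
  proof -
    obtain T where T: "T \<subseteq> carrier G \<times> carrier G" "finite T" "\<F> = E ` T"
      using fin by (metis finite_subset_image)
    have "finite (fst ` T \<union> snd ` T)" "fst ` T \<union> snd ` T \<subseteq> carrier G"
      using T by auto
    then obtain H where H: "subgroup H G" "finite H" "fst ` T \<union> snd ` T \<subseteq> H"
      by (meson subgroup_finite_adjoin)
    obtain f where f: "\<And>j. j < m \<Longrightarrow> is_char H (f j)" "\<And>x. x \<in> H \<Longrightarrow> (\<And>j. j < m \<Longrightarrow> f j x = 1) \<Longrightarrow> x \<in> Q"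
      using loc[OF H(1,2)] by blast
    have Hc: "H \<subseteq> carrier G" using H subgroup.subset by blast
    \<comment> \<open>Outside H the value 1 is a placeholder: the conditions in T only test points
      of H.\<close>
    define g where "g = (\<lambda>(j, x)\<in>?I. if x \<in> H then f j x else 1)"
    have gH: "g (j, x) = f j x" if "j < m" "x \<in> H" for j x using that Hc by (auto simp: g_def)
    have "g \<in> topspace X" unfolding ts g_def using is_char_pow_p[OF f(1)] by auto
    moreover have "g \<in> E t" if "t \<in> T" for t
    proof -
      obtain x y where t: "t = (x, y)" by fastforce
      then have xy: "x \<in> H" "y \<in> H" "x \<otimes> y \<in> H" using that H(1,3) by (force simp: subgroup.m_closed)+
      show ?thesis unfolding E_def t using xy gH f(2) \<open>g \<in> topspace X\<close> by (auto simp: is_char_mult[OF f(1)])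
    qed
    ultimately show ?thesis using T by blast
  qed
  have "\<Inter>(E ` (carrier G \<times> carrier G)) \<noteq> {}"
  proof (rule iffD1[OF compact_space_fip \<open>compact_space X\<close>, rule_format])
    show "(\<forall>C\<in>E ` (carrier G \<times> carrier G). closedin X C) \<and>
      (\<forall>\<F>. finite \<F> \<and> \<F> \<subseteq> E ` (carrier G \<times> carrier G) \<longrightarrow> \<Inter>\<F> \<noteq> {})"
      using clo fip by (auto simp del: mem_Sigma_iff)
  qed
  then obtain f where "f \<in> \<Inter>(E ` (carrier G \<times> carrier G))" by (meson all_not_in_conv)
  then have f: "\<And>x y. x \<in> carrier G \<Longrightarrow> y \<in> carrier G \<Longrightarrow> f \<in> E (x, y)" by simp
  show ?thesis
  proof
    fix j assume j: "j < m"
    show "is_char (carrier G) (\<lambda>x. f (j, x))"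
      using f j unfolding is_char_def E_def ts by (auto simp: PiE_iff)
  next
    fix x assume "x \<in> carrier G" "\<And>j. j < m \<Longrightarrow> f (j, x) = 1"
    then show "x \<in> Q" using f[of x x] by (auto simp: E_def)
  qed
qed

text \<open>Only finitely many tuples of values on I occur, and two elements with the same tuple
  differ by an element of the kernel; one representative per tuple suffices.\<close>

lemma finite_chars_kernel_index:
  assumes I: "finite I" "\<And>f. f \<in> I \<Longrightarrow> is_char (carrier G) f"
  obtains T where "finite T" "T \<subseteq> carrier G"
    "carrier G \<subseteq> (\<Union>g\<in>T. (\<lambda>x. g \<otimes> x) ` {x \<in> carrier G. \<forall>f\<in>I. f x = 1})"
proof -
  define \<Phi> where "\<Phi> x = (\<lambda>f\<in>I. f x)" for x
  have "\<Phi> ` carrier G \<subseteq> (\<Pi>\<^sub>E f\<in>I. {z. z ^ p = 1})"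
    using is_char_pow_p[OF I(2)] by (auto simp: \<Phi>_def simp del: PiE_restrict intro!: restrict_PiE_iff[THEN iffD2])
  moreover have "finite (\<Pi>\<^sub>E f\<in>I. {z::complex. z ^ p = 1})"
    using finite_roots_unity[of p] p_pos I(1) by (intro finite_PiE) auto
  ultimately have "finite (\<Phi> ` carrier G)" using finite_subset by blast
  then obtain T where T: "T \<subseteq> carrier G" "finite T" "\<Phi> ` carrier G = \<Phi> ` T"
    by (metis finite_subset_image subset_refl)
  have "carrier G \<subseteq> (\<Union>g\<in>T. (\<lambda>x. g \<otimes> x) ` {x \<in> carrier G. \<forall>f\<in>I. f x = 1})"
  proof
    fix x assume x: "x \<in> carrier G"
    then obtain g where g: "g \<in> T" "\<Phi> x = \<Phi> g" using T by (metis imageE imageI)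
    have gc: "g \<in> carrier G" using g T by auto
    have "f (inv g \<otimes> x) = 1" if f: "f \<in> I" for f
    proof -
      have "f x = f g" using g f by (metis \<Phi>_def restrict_apply')
      then show ?thesis
        using gc x is_char_mult[OF I(2)[OF f], of "inv g" g] is_char_one[OF I(2)[OF f] subgroup_self]
        by (simp add: is_char_mult[OF I(2)[OF f]])
    qed
    then have "inv g \<otimes> x \<in> {x \<in> carrier G. \<forall>f\<in>I. f x = 1}" using x gc by simp
    moreover have "x = g \<otimes> (inv g \<otimes> x)" using x gc by (simp add: m_assoc[symmetric])
    ultimately show "x \<in> (\<Union>g\<in>T. (\<lambda>x. g \<otimes> x) ` {x \<in> carrier G. \<forall>f\<in>I. f x = 1})" using g by blast
  qed
  then show ?thesis using that T by blast
qed

text \<open>Purely algebraic: the characters come from the compactness argument and need not be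
  continuous for a given group topology, so L need not be closed.\<close>

lemma ex_finite_index_subgroup:
  assumes V: "V \<subseteq> carrier G" and F: "finite F" "F \<subseteq> carrier G"
    and cover: "carrier G \<subseteq> (\<Union>g\<in>F. (\<lambda>x. g \<otimes> x) ` V)"
  obtains L T where "subgroup L G" "L \<subseteq> bohr_set (quotients V)"
    "finite T" "T \<subseteq> carrier G" "carrier G \<subseteq> (\<Union>g\<in>T. (\<lambda>x. g \<otimes> x) ` L)"
proof -
  define m where "m = 2 * (card F)\<^sup>2"
  obtain f where f: "\<And>j. j < m \<Longrightarrow> is_char (carrier G) (f j)"
    and ker: "\<And>x. x \<in> carrier G \<Longrightarrow> (\<And>j. j < m \<Longrightarrow> f j x = 1) \<Longrightarrow> x \<in> bohr_set (quotients V)"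
    using chars_compactness[of m "bohr_set (quotients V)"] finite_subgroup_chars[OF assms] unfolding m_def by blast
  define I where "I = f ` {..<m}"
  have char: "is_char (carrier G) h" if "h \<in> I" for h using f that by (auto simp: I_def)
  have finI: "finite I" by (simp add: I_def)
  define L where "L = {x \<in> carrier G. \<forall>h\<in>I. h x = 1}"
  obtain T where T: "finite T" "T \<subseteq> carrier G" "carrier G \<subseteq> (\<Union>g\<in>T. (\<lambda>x. g \<otimes> x) ` L)"
    unfolding L_def by (rule finite_chars_kernel_index[OF finI char])
  have "subgroup L G"
    by (rule subgroup_mult_closedI)
       (auto simp: L_def is_char_mult[OF char] is_char_one[OF char subgroup_self])
  moreover have "L \<subseteq> bohr_set (quotients V)" using ker by (auto simp: L_def I_def)
  ultimately show ?thesis using that T by blast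
qed

end

subsection \<open>Hausdorff group topologies of prime exponent\<close>

locale hausdorff_exponent_group = prime_exponent_group +
  fixes \<tau> :: "'a topology"
  assumes group_top: "group_topology G \<tau>" and Hausdorff: "Hausdorff_space \<tau>"
begin

lemma topspace [simp]: "topspace \<tau> = carrier G"
  using group_top by (simp add: group_topology_def)

lemma continuous_mult: "continuous_map (prod_topology \<tau> \<tau>) \<tau> (\<lambda>(x, y). x \<otimes> y)"
  and continuous_inv: "continuous_map \<tau> \<tau> (\<lambda>x. inv x)"
  using group_top by (auto simp: group_topology_def)

lemma continuous_map_mult:
  assumes "continuous_map X \<tau> f" "continuous_map X \<tau> g"
  shows "continuous_map X \<tau> (\<lambda>x. f x \<otimes> g x)"
  using continuous_map_compose[OF _ continuous_mult, of X "\<lambda>x. (f x, g x)"] assms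
  by (simp add: continuous_map_paired o_def)

lemma continuous_map_inv:
  assumes "continuous_map X \<tau> f"
  shows "continuous_map X \<tau> (\<lambda>x. inv (f x))"
  using continuous_map_compose[OF assms continuous_inv] by (simp add: o_def)

lemma continuous_translate: "g \<in> carrier G \<Longrightarrow> continuous_map \<tau> \<tau> (\<lambda>x. g \<otimes> x)"
  by (rule continuous_map_mult) auto

lemma translate_eq_preimage:
  assumes "U \<subseteq> carrier G" "g \<in> carrier G"
  shows "(\<lambda>x. g \<otimes> x) ` U = {x \<in> topspace \<tau>. inv g \<otimes> x \<in> U}"
proof safe
  fix x assume "x \<in> topspace \<tau>" "inv g \<otimes> x \<in> U"
  moreover then have "x = g \<otimes> (inv g \<otimes> x)" using assms by (simp add: m_assoc[symmetric])
  ultimately show "x \<in> (\<lambda>x. g \<otimes> x) ` U" by blast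
qed (use assms in \<open>auto simp: subset_iff m_assoc[symmetric]\<close>)

lemma openin_translate:
  assumes "openin \<tau> U" "g \<in> carrier G"
  shows "openin \<tau> ((\<lambda>x. g \<otimes> x) ` U)"
  using openin_continuous_map_preimage[OF continuous_translate[of "inv g"] assms(1)] assms openin_subset[OF assms(1)]
  by (simp add: translate_eq_preimage)

lemma closedin_translate:
  assumes "closedin \<tau> U" "g \<in> carrier G"
  shows "closedin \<tau> ((\<lambda>x. g \<otimes> x) ` U)"
  using closedin_continuous_map_preimage[OF continuous_translate[of "inv g"] assms(1)] assms closedin_subset[OF assms(1)]
  by (simp add: translate_eq_preimage)

lemma openin_subgroupI:
  assumes S: "subgroup S G" and U: "openin \<tau> U" "\<one> \<in> U" "U \<subseteq> S"
  shows "openin \<tau> S"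
proof -
  have Sc: "S \<subseteq> carrier G" using S subgroup.subset by blast
  have "S = (\<Union>g\<in>S. (\<lambda>x. g \<otimes> x) ` U)"
  proof safe
    fix g assume g: "g \<in> S"
    then have "g = g \<otimes> \<one>" using Sc by auto
    then show "g \<in> (\<Union>g\<in>S. (\<lambda>x. g \<otimes> x) ` U)" using U(2) g by blast
  qed (use U S in \<open>auto simp: subgroup.m_closed\<close>)
  moreover have "openin \<tau> (\<Union>g\<in>S. (\<lambda>x. g \<otimes> x) ` U)"
    using openin_translate[OF U(1)] Sc by blast
  ultimately show ?thesis by simp
qed

lemma nhd_mult_inv:
  assumes U: "openin \<tau> U" "\<one> \<in> U"
  shows "\<exists>V. openin \<tau> V \<and> \<one> \<in> V \<and> (\<forall>a\<in>V. \<forall>b\<in>V. a \<otimes> b \<in> U \<and> inv a \<otimes> b \<in> U)"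
proof -
  have nhd: "\<exists>A B. openin \<tau> A \<and> openin \<tau> B \<and> \<one> \<in> A \<and> \<one> \<in> B \<and> (\<forall>a\<in>A. \<forall>b\<in>B. f (a, b) \<in> U)"
    if f: "continuous_map (prod_topology \<tau> \<tau>) \<tau> f" "f (\<one>, \<one>) = \<one>" for f :: "'a \<times> 'a \<Rightarrow> 'a"
  proof -
    have "openin (prod_topology \<tau> \<tau>) {x \<in> topspace (prod_topology \<tau> \<tau>). f x \<in> U}"
      by (rule openin_continuous_map_preimage[OF f(1) U(1)])
    moreover have "(\<one>, \<one>) \<in> {x \<in> topspace (prod_topology \<tau> \<tau>). f x \<in> U}" using f U by simp
    ultimately obtain A B where "openin \<tau> A" "openin \<tau> B" "\<one> \<in> A" "\<one> \<in> B"
      "A \<times> B \<subseteq> {x \<in> topspace (prod_topology \<tau> \<tau>). f x \<in> U}"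
      unfolding openin_prod_topology_alt by meson
    then show ?thesis by blast
  qed
  obtain A B where AB: "openin \<tau> A" "openin \<tau> B" "\<one> \<in> A" "\<one> \<in> B" "\<forall>a\<in>A. \<forall>b\<in>B. a \<otimes> b \<in> U"
    using nhd[OF continuous_mult] by auto
  have "continuous_map (prod_topology \<tau> \<tau>) \<tau> (\<lambda>x. inv (fst x) \<otimes> snd x)"
    by (intro continuous_map_mult continuous_map_inv continuous_map_fst continuous_map_snd)
  from nhd[OF this] obtain A' B' where AB': "openin \<tau> A'" "openin \<tau> B'" "\<one> \<in> A'" "\<one> \<in> B'" "\<forall>a\<in>A'. \<forall>b\<in>B'. inv a \<otimes> b \<in> U"
    by auto
  show ?thesis
    by (rule exI[of _ "U \<inter> A \<inter> B \<inter> A' \<inter> B'"]) (use U AB AB' in auto)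
qed

lemma closure_of_subgroup:
  assumes "subgroup L G"
  shows "subgroup (\<tau> closure_of L) G"
proof (rule subgroup_mult_closedI)
  have Lc: "L \<subseteq> carrier G" using assms subgroup.subset by blast
  show "\<tau> closure_of L \<subseteq> carrier G" using closure_of_subset_topspace[of \<tau> L] by simp
  show "\<one> \<in> \<tau> closure_of L" using closure_of_subset[of L \<tau>] Lc subgroup.one_closed[OF assms] by auto
  have "(\<lambda>(x, y). x \<otimes> y) ` (prod_topology \<tau> \<tau> closure_of (L \<times> L)) \<subseteq> \<tau> closure_of ((\<lambda>(x, y). x \<otimes> y) ` (L \<times> L))"
    by (rule continuous_map_image_closure_subset[OF continuous_mult])
  moreover have "\<tau> closure_of ((\<lambda>(x, y). x \<otimes> y) ` (L \<times> L)) \<subseteq> \<tau> closure_of L"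
    by (rule closure_of_mono) (use assms in \<open>auto simp: subgroup.m_closed\<close>)
  ultimately show "x \<otimes> y \<in> \<tau> closure_of L" if "x \<in> \<tau> closure_of L" "y \<in> \<tau> closure_of L" for x y
    using that unfolding closure_of_Times by blast
qed

text \<open>The complement is a finite union of translates of M, namely those by the members of T
  outside M, hence closed.\<close>

lemma openin_finite_index_closed_subgroup:
  assumes M: "subgroup M G" "closedin \<tau> M"
    and T: "finite T" "T \<subseteq> carrier G" "carrier G \<subseteq> (\<Union>g\<in>T. (\<lambda>x. g \<otimes> x) ` M)"
  shows "openin \<tau> M"
proof -
  have Mc: "M \<subseteq> carrier G" using M subgroup.subset by blast
  have "carrier G - M = (\<Union>g\<in>T - M. (\<lambda>x. g \<otimes> x) ` M)"
  proof safe
    fix x assume x: "x \<in> carrier G" "x \<notin> M"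
    then obtain g m where gm: "g \<in> T" "m \<in> M" "x = g \<otimes> m" using T by blast
    then have "g \<notin> M" using x M by (auto simp: subgroup.m_closed)
    then show "x \<in> (\<Union>g\<in>T - M. (\<lambda>x. g \<otimes> x) ` M)" using gm by blast
  next
    fix g m assume g: "g \<in> T" "g \<notin> M" "m \<in> M" "g \<otimes> m \<in> M"
    then have "g = (g \<otimes> m) \<otimes> inv m" using T Mc by (simp add: subset_iff m_assoc)
    then show False using g M by (metis subgroup.m_closed subgroup.m_inv_closed)
  qed (use T Mc in auto)
  moreover have "closedin \<tau> (\<Union>g\<in>T - M. (\<lambda>x. g \<otimes> x) ` M)"
    using T closedin_translate[OF M(2)] by (intro closedin_Union) auto
  ultimately show ?thesis using Mc by (simp add: openin_closedin)
qed

section \<open>Compactness and continuous characters\<close>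

lemma compact_translates:
  assumes C: "compactin \<tau> C" and U: "openin \<tau> U" "\<one> \<in> U"
  obtains F where "finite F" "F \<subseteq> C" "C \<subseteq> (\<Union>g\<in>F. (\<lambda>x. g \<otimes> x) ` U)"
proof -
  let ?\<W> = "(\<lambda>g. (\<lambda>x. g \<otimes> x) ` U) ` C"
  have Cc: "C \<subseteq> carrier G" using compactin_subset_topspace[OF C] by simp
  have 1: "\<And>W. W \<in> ?\<W> \<Longrightarrow> openin \<tau> W" using openin_translate[OF U(1)] Cc by auto
  have 2: "C \<subseteq> \<Union>?\<W>"
  proof
    fix x assume x: "x \<in> C"
    then have "x = x \<otimes> \<one>" using Cc by auto
    then show "x \<in> \<Union>?\<W>" using U(2) x by blast
  qed
  obtain \<F> where "finite \<F>" "\<F> \<subseteq> ?\<W>" "C \<subseteq> \<Union>\<F>"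
    using compactinD[OF C 1 2] by blast
  then show ?thesis using that by (metis finite_subset_image)
qed

text \<open>f is constant on the translate of M by x, a neighborhood of x.\<close>

lemma continuous_map_char:
  assumes f: "is_char (carrier G) f" and M: "openin \<tau> M" "\<one> \<in> M" "\<And>x. x \<in> M \<Longrightarrow> f x = 1"
  shows "continuous_map \<tau> (discrete_topology {z. z ^ p = 1}) f"
proof -
  have "openin \<tau> {x \<in> carrier G. f x \<in> W}" for W
  proof (subst openin_subopen, intro ballI)
    fix x assume x: "x \<in> {x \<in> carrier G. f x \<in> W}"
    have Mc: "M \<subseteq> carrier G" using openin_subset[OF M(1)] by simp
    show "\<exists>T. openin \<tau> T \<and> x \<in> T \<and> T \<subseteq> {x \<in> carrier G. f x \<in> W}"
    proof (intro exI conjI)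
      show "openin \<tau> ((\<lambda>y. x \<otimes> y) ` M)" using openin_translate M x by blast
      show "x \<in> (\<lambda>y. x \<otimes> y) ` M" using x M(2) by (force intro!: image_eqI[of _ _ \<one>])
      show "(\<lambda>y. x \<otimes> y) ` M \<subseteq> {x \<in> carrier G. f x \<in> W}"
        using x M Mc by (auto simp: subset_iff is_char_mult[OF f])
    qed
  qed
  then show ?thesis using is_char_pow_p[OF f] by (auto simp: continuous_map)
qed

text \<open>A neighborhood of \<open>\<one>\<close> small enough to keep its products away from x
  contains a subgroup L of finite index. The closure of L is open and still misses x, and any
  algebraic character trivial on it is continuous.\<close>

lemma compact_char_separate:
  assumes comp: "compact_space \<tau>" and x: "x \<in> carrier G" "x \<noteq> \<one>"
  obtains f where "is_char (carrier G) f" "continuous_map \<tau> (discrete_topology {z. z ^ p = 1}) f" "f x \<noteq> 1"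
proof -
  have "closedin \<tau> {x}" using Hausdorff x by (simp add: closedin_Hausdorff_singleton)
  then have U0: "openin \<tau> (carrier G - {x})" by (metis closedin_def topspace)
  have one: "\<one> \<in> carrier G - {x}" using x by simp
  \<comment> \<open>Repeated halving: products of two elements of U1 avoid x,
    \<open>bohr_set U3\<close> will lie in U1, and \<open>quotients V\<close> in U3.\<close>
  obtain U1 where U1: "openin \<tau> U1" "\<one> \<in> U1" "\<forall>a\<in>U1. \<forall>b\<in>U1. a \<otimes> b \<in> carrier G - {x}"
    using nhd_mult_inv[OF U0 one] by blast
  obtain U2 where U2: "openin \<tau> U2" "\<one> \<in> U2" "\<forall>a\<in>U2. \<forall>b\<in>U2. a \<otimes> b \<in> U1"
    using nhd_mult_inv[OF U1(1,2)] by blast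
  obtain U3 where U3: "openin \<tau> U3" "\<one> \<in> U3" "\<forall>a\<in>U3. \<forall>b\<in>U3. inv a \<otimes> b \<in> U2"
    using nhd_mult_inv[OF U2(1,2)] by blast
  obtain V0 where V0: "openin \<tau> V0" "\<one> \<in> V0" "\<forall>a\<in>V0. \<forall>b\<in>V0. inv a \<otimes> b \<in> U3"
    using nhd_mult_inv[OF U3(1,2)] by blast
  \<comment> \<open>V is also kept inside U1 for the closure argument: a point l of L near x has l
    in U1 and \<open>inv l \<otimes> x\<close> in V, and the product of the two would be x.\<close>
  define V where "V = V0 \<inter> U1"
  have V: "openin \<tau> V" "\<one> \<in> V" using V0 U1 by (auto simp: V_def)
  have Vc: "V \<subseteq> carrier G" and U3c: "U3 \<subseteq> carrier G" using openin_subset[OF V(1)] openin_subset[OF U3(1)] by auto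
  have "quotients V \<subseteq> U3" using V0(3) unfolding quotients_def V_def by blast
  moreover have "bohr_set U3 \<subseteq> U1"
  proof
    fix y assume "y \<in> bohr_set U3"
    then obtain a b c d where *: "y = a \<otimes> inv b \<otimes> (c \<otimes> inv d)" "a \<in> U3" "b \<in> U3" "c \<in> U3" "d \<in> U3"
      unfolding bohr_set_def by blast
    then have "a \<otimes> inv b = inv b \<otimes> a" "c \<otimes> inv d = inv d \<otimes> c" using U3c by (auto intro!: m_comm)
    then show "y \<in> U1" using * U2 U3 by simp
  qed
  ultimately have Q: "bohr_set (quotients V) \<subseteq> U1" using bohr_set_mono by blast
  obtain F where F: "finite F" "F \<subseteq> carrier G" "carrier G \<subseteq> (\<Union>g\<in>F. (\<lambda>x. g \<otimes> x) ` V)"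
    using compact_translates[OF _ V, of "carrier G"] comp by (metis compact_space_def topspace)
  obtain L T where L: "subgroup L G" "L \<subseteq> bohr_set (quotients V)"
    and T: "finite T" "T \<subseteq> carrier G" "carrier G \<subseteq> (\<Union>g\<in>T. (\<lambda>x. g \<otimes> x) ` L)"
    using ex_finite_index_subgroup[OF Vc F] by blast
  have Lc: "L \<subseteq> carrier G" using L subgroup.subset by blast
  define M where "M = \<tau> closure_of L"
  have M: "subgroup M G" using closure_of_subgroup[OF L(1)] by (simp add: M_def)
  have "L \<subseteq> M" using closure_of_subset[of L \<tau>] Lc by (simp add: M_def)
  then have "carrier G \<subseteq> (\<Union>g\<in>T. (\<lambda>x. g \<otimes> x) ` M)" using T(3) by blast
  then have oM: "openin \<tau> M"
    using openin_finite_index_closed_subgroup[OF M _ T(1,2)] by (simp add: M_def)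
  have "x \<notin> M"
  proof
    assume "x \<in> M"
    define W where "W = {y \<in> topspace \<tau>. inv y \<otimes> x \<in> V}"
    have "continuous_map \<tau> \<tau> (\<lambda>y. inv y \<otimes> x)" using x by (intro continuous_map_mult continuous_inv) auto
    then have "openin \<tau> W" unfolding W_def by (rule openin_continuous_map_preimage[OF _ V(1)])
    moreover have "x \<in> W" using x V by (simp add: W_def)
    ultimately obtain l where l: "l \<in> L" "l \<in> W" using \<open>x \<in> M\<close> unfolding M_def in_closure_of by blast
    then have "l \<in> U1" "inv l \<otimes> x \<in> U1" using L Q by (auto simp: W_def V_def)
    then have "l \<otimes> (inv l \<otimes> x) \<in> carrier G - {x}" using U1(3) by blast
    moreover have "l \<otimes> (inv l \<otimes> x) = x" using l Lc x by (simp add: subset_iff m_assoc[symmetric])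
    ultimately show False by simp
  qed
  then obtain f where f: "is_char (carrier G) f" "\<And>y. y \<in> M \<Longrightarrow> f y = 1" "f x \<noteq> 1"
    using is_char_separate[OF M x(1)] by blast
  moreover have "continuous_map \<tau> (discrete_topology {z. z ^ p = 1}) f"
    using continuous_map_char[OF f(1) oM _ f(2)] subgroup.one_closed[OF M] by blast
  ultimately show ?thesis using that by blast
qed


lemma subgroup_hausdorff_exponent_group:
  assumes K: "subgroup K G"
  shows "hausdorff_exponent_group (G\<lparr>carrier := K\<rparr>) p (subtopology \<tau> K)"
proof -
  interpret K: prime_exponent_group "G\<lparr>carrier := K\<rparr>" p
    using subgroup_prime_exponent_group[OF K] .
  have Kc: "K \<subseteq> carrier G" using K subgroup.subset by blast
  have "continuous_map (prod_topology (subtopology \<tau> K) (subtopology \<tau> K)) \<tau> (\<lambda>z. fst z \<otimes> snd z)"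
    by (intro continuous_map_mult continuous_map_into_fulltopology[OF continuous_map_fst] continuous_map_into_fulltopology[OF continuous_map_snd])
  then have m: "continuous_map (prod_topology (subtopology \<tau> K) (subtopology \<tau> K)) (subtopology \<tau> K) (\<lambda>(x, y). x \<otimes> y)"
    using K Kc by (auto simp: continuous_map_in_subtopology case_prod_unfold subgroup.m_closed)
  have "continuous_map (subtopology \<tau> K) (subtopology \<tau> K) (\<lambda>x. inv x)"
    using K continuous_inv by (auto simp: continuous_map_in_subtopology continuous_map_from_subtopology subgroup.m_inv_closed)
  then have "continuous_map (subtopology \<tau> K) (subtopology \<tau> K) (\<lambda>x. inv\<^bsub>G\<lparr>carrier := K\<rparr>\<^esub> x)"
    by (rule continuous_map_eq) (use m_inv_consistent[OF K] in auto)
  moreover have "Hausdorff_space (subtopology \<tau> K)" using Hausdorff Hausdorff_space_subtopology by blast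
  ultimately show ?thesis
    using m Kc by unfold_locales (auto simp: group_topology_def)
qed

text \<open>Evaluation at the members of B is injective by maximality and surjective by independence
  and compactness; a continuous bijection from a compact to a Hausdorff space is a
  homeomorphism.\<close>

lemma compact_homeomorphic_power:
  assumes comp: "compact_space \<tau>"
  obtains B :: "('a \<Rightarrow> complex) set"
    where "\<tau> homeomorphic_space product_topology (\<lambda>_. discrete_topology {z::complex. z ^ p = 1}) B"
proof -
  let ?R = "{z::complex. z ^ p = 1}"
  define X where "X = {f. is_char (carrier G) f \<and> continuous_map \<tau> (discrete_topology ?R) f}"
  \<comment> \<open>Linear independence over Z_p, stated as solvability: all prescribed values on a
    finite subset are attained. In this form it supplies the finite intersection property for
    surjectivity.\<close>
  define indep where "indep B \<longleftrightarrow> (\<forall>F a. finite F \<and> F \<subseteq> B \<and> (\<forall>f\<in>F. a f ^ p = 1)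
      \<longrightarrow> (\<exists>x\<in>carrier G. \<forall>f\<in>F. f x = a f))" for B :: "('a \<Rightarrow> complex) set"
  have indepD: "\<exists>x\<in>carrier G. \<forall>f\<in>F. f x = a f"
    if "indep C" "finite F" "F \<subseteq> C" "\<And>f. f \<in> F \<Longrightarrow> a f ^ p = 1" for C F a
    using that(1)[unfolded indep_def, THEN spec, THEN spec, THEN mp, of F a] that(2-) by simp
  have "\<exists>B\<in>{B. B \<subseteq> X \<and> indep B}. \<forall>C\<in>{B. B \<subseteq> X \<and> indep B}. B \<subseteq> C \<longrightarrow> C = B"
  proof (rule subset_Zorn_nonempty)
    have "{} \<in> {B. B \<subseteq> X \<and> indep B}" by (auto simp: indep_def)
    then show "{B. B \<subseteq> X \<and> indep B} \<noteq> {}" by blast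
    show "\<Union>\<C> \<in> {B. B \<subseteq> X \<and> indep B}" if ne: "\<C> \<noteq> {}" and ch: "subset.chain {B. B \<subseteq> X \<and> indep B} \<C>" for \<C>
    proof -
      have sub: "\<C> \<subseteq> {B. B \<subseteq> X \<and> indep B}" using ch by (simp add: subset.chain_def)
      have "\<exists>x\<in>carrier G. \<forall>f\<in>F. f x = a f"
        if F: "finite F" "F \<subseteq> \<Union>\<C>" "\<forall>f\<in>F. a f ^ p = 1" for F a
      proof -
        obtain B where "B \<in> \<C>" "F \<subseteq> B" using finite_subset_Union_chain[OF F(1,2) ne ch] .
        then have "indep B" using sub by blast
        from indepD[OF this F(1) \<open>F \<subseteq> B\<close>, of a] show ?thesis using F(3) by simp
      qed
      then have "indep (\<Union>\<C>)" unfolding indep_def by blast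
      then show ?thesis using sub by blast
    qed
  qed
  then obtain B where B: "B \<in> {B. B \<subseteq> X \<and> indep B}"
    and max: "\<forall>C\<in>{B. B \<subseteq> X \<and> indep B}. B \<subseteq> C \<longrightarrow> C = B" by (rule bexE)
  have BX: "B \<subseteq> X" and ind: "indep B" using B by auto
  have Bchar: "is_char (carrier G) f" and Bcont: "continuous_map \<tau> (discrete_topology ?R) f" if "f \<in> B" for f
    using BX that by (auto simp: X_def)
  \<comment> \<open>If B did not separate x from \<open>\<one>\<close>, a continuous g with
    \<open>g x \<noteq> 1\<close> could be added to B: multiplying y by powers of x adjusts
    \<open>g y\<close> to any p-th root of unity and leaves the values of B alone.\<close>
  have ker: "x = \<one>" if x: "x \<in> carrier G" "\<And>f. f \<in> B \<Longrightarrow> f x = 1" for x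
  proof (rule ccontr)
    assume "x \<noteq> \<one>"
    then obtain g where g: "is_char (carrier G) g" "continuous_map \<tau> (discrete_topology ?R) g" "g x \<noteq> 1"
      using compact_char_separate[OF comp x(1)] by blast
    have "\<exists>y\<in>carrier G. \<forall>f\<in>F. f y = a f" if F: "finite F" "F \<subseteq> insert g B" "\<forall>f\<in>F. a f ^ p = 1" for F a
    proof -
      have "finite (F - {g})" "F - {g} \<subseteq> B" "\<forall>f\<in>F - {g}. a f ^ p = 1" using F by auto
      then obtain y where y: "y \<in> carrier G" "\<forall>f\<in>F - {g}. f y = a f" using indepD[OF ind, of "F - {g}" a] by auto
      have "\<exists>k. g y * g x ^ k = a g" if "g \<in> F"
      proof -
        have gy: "g y ^ p = 1" "g x ^ p = 1" using is_char_pow_p[OF g(1)] x(1) y(1) by auto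
        then have "(a g / g y) ^ p = 1" using F(3) that by (simp add: power_divide)
        then obtain k where "a g / g y = g x ^ k" using root_of_unity_powers[OF prime_p gy(2) g(3)] by blast
        moreover have "g y \<noteq> 0" using is_char_nz[OF g(1) y(1)] .
        ultimately show ?thesis by (metis nonzero_mult_div_cancel_left times_divide_eq_right)
      qed
      then obtain k where k: "g \<in> F \<Longrightarrow> g y * g x ^ k = a g" by blast
      have "f (y \<otimes> x [^] k) = a f" if f: "f \<in> F" for f
      proof (cases "f = g")
        case True
        then show ?thesis
          using f k x(1) y(1) by (simp add: is_char_mult[OF g(1)] is_char_pow[OF g(1) subgroup_self])
      next
        case False
        then have fB: "f \<in> B" using f F(2) by blast
        have "f y = a f" "f x = 1" using False f y(2) x(2)[OF fB] by blast+
        then show ?thesis using x(1) y(1)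
          by (simp add: is_char_mult[OF Bchar[OF fB]] is_char_pow[OF Bchar[OF fB] subgroup_self])
      qed
      then show ?thesis using x(1) y(1) by (intro bexI[of _ "y \<otimes> x [^] k"]) auto
    qed
    then have "indep (insert g B)" unfolding indep_def by blast
    moreover have "insert g B \<subseteq> X" using BX g by (auto simp: X_def)
    ultimately have "insert g B = B" using max by (simp add: subset_insertI)
    then have "g \<in> B" by (metis insertI1)
    then show False using x(2) g(3) by blast
  qed
  let ?Y = "product_topology (\<lambda>_. discrete_topology ?R) B"
  define e where "e x = (\<lambda>f\<in>B. f x)" for x
  have cont: "continuous_map \<tau> ?Y e"
    unfolding continuous_map_componentwise e_def using Bcont by (auto simp: continuous_map_eq)
  have inj: "inj_on e (topspace \<tau>)"
  proof (rule inj_onI)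
    fix x y assume xy: "x \<in> topspace \<tau>" "y \<in> topspace \<tau>" "e x = e y"
    have "f (inv y \<otimes> x) = 1" if f: "f \<in> B" for f
    proof -
      have "f x = f y" using xy(3) f unfolding e_def by (metis restrict_apply')
      then show ?thesis using xy(1,2) is_char_mult[OF Bchar[OF f], of "inv y" y] is_char_one[OF Bchar[OF f] subgroup_self]
        by (simp add: is_char_mult[OF Bchar[OF f]])
    qed
    then have "inv y \<otimes> x = \<one>" using ker[of "inv y \<otimes> x"] xy(1,2) by simp
    then show "x = y" using xy(1,2) by (metis inv_closed inv_equality inv_inv topspace)
  qed
  have "topspace ?Y \<subseteq> e ` topspace \<tau>"
  proof
    fix a assume a: "a \<in> topspace ?Y"
    then have aR: "a f ^ p = 1" if "f \<in> B" for f using that by auto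
    define S where "S = (\<lambda>f. {x \<in> topspace \<tau>. f x \<in> {a f}})"
    \<comment> \<open>Including the whole space keeps the intersection inside the group even when B
      is empty.\<close>
    have "\<Inter>(insert (topspace \<tau>) (S ` B)) \<noteq> {}"
    proof (rule iffD1[OF compact_space_fip comp, rule_format], intro conjI ballI allI impI)
      fix C assume "C \<in> insert (topspace \<tau>) (S ` B)"
      moreover have "closedin \<tau> (S f)" if f: "f \<in> B" for f
        unfolding S_def using aR[OF f] by (intro closedin_continuous_map_preimage[OF Bcont[OF f]]) auto
      ultimately show "closedin \<tau> C" using closedin_topspace[of \<tau>] by auto
    next
      fix \<F> assume \<F>: "finite \<F> \<and> \<F> \<subseteq> insert (topspace \<tau>) (S ` B)"
      then have "finite (\<F> - {topspace \<tau>})" "\<F> - {topspace \<tau>} \<subseteq> S ` B" by auto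
      then obtain F where F: "F \<subseteq> B" "finite F" "\<F> - {topspace \<tau>} = S ` F"
        by (meson finite_subset_image)
      then obtain x where x: "x \<in> carrier G" "\<forall>f\<in>F. f x = a f"
        using indepD[OF ind F(2,1), of a] aR by blast
      then have "x \<in> W" if "W \<in> \<F>" for W
        using that F(3) by (cases "W = topspace \<tau>") (auto simp: S_def)
      then show "\<Inter>\<F> \<noteq> {}" by blast
    qed
    then obtain x where "x \<in> \<Inter>(insert (topspace \<tau>) (S ` B))" by (meson all_not_in_conv)
    then have xc: "x \<in> topspace \<tau>" and xS: "\<forall>f\<in>B. x \<in> S f" by auto
    have "e x f = a f" if "f \<in> B" for f using xS that by (simp add: e_def S_def)
    then have "e x = a"
      by (intro extensionalityI[of "e x" B a]) (use a in \<open>auto simp: e_def PiE_iff\<close>)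
    then show "a \<in> e ` topspace \<tau>" using xc by blast
  qed
  moreover have "e ` topspace \<tau> \<subseteq> topspace ?Y" using cont continuous_map_image_subset_topspace by blast
  ultimately have "homeomorphic_map \<tau> ?Y e"
    using continuous_imp_homeomorphic_map[OF cont comp _ _ inj]
    by (simp add: Hausdorff_space_product_topology subset_antisym)
  then show ?thesis by (rule that[OF homeomorphic_map_imp_homeomorphic_space])
qed

section \<open>Locally compact groups\<close>

lemma ex_compact_open_subgroup:
  assumes "locally_compact_space \<tau>"
  obtains K where "subgroup K G" "openin \<tau> K" "compactin \<tau> K"
proof -
  obtain U C where UC: "openin \<tau> U" "compactin \<tau> C" "\<one> \<in> U" "U \<subseteq> C"
    using assms unfolding locally_compact_space_def by (metis one_closed topspace)
  have Cc: "C \<subseteq> carrier G" using compactin_subset_topspace[OF UC(2)] by simp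
  let ?CC = "(\<lambda>(x, y). x \<otimes> y) ` (C \<times> C)"
  have "compactin \<tau> ?CC"
    using image_compactin[OF _ continuous_mult] UC(2) compactin_Times by blast
  then obtain F where F: "finite F" "F \<subseteq> ?CC" "?CC \<subseteq> (\<Union>g\<in>F. (\<lambda>x. g \<otimes> x) ` U)"
    using compact_translates[OF _ UC(1,3)] by metis
  have "?CC \<subseteq> carrier G" using Cc by auto
  then have "F \<subseteq> carrier G" using F(2) by blast
  then obtain H where H: "subgroup H G" "finite H" "F \<subseteq> H"
    using subgroup_finite_adjoin F(1) by meson
  have Hc: "H \<subseteq> carrier G" using H subgroup.subset by blast
  \<comment> \<open>K is closed under multiplication: \<open>c \<otimes> c'\<close> has the form
    \<open>g \<otimes> u\<close> with g in F and u in U, so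
    \<open>(h \<otimes> c) \<otimes> (h' \<otimes> c')\<close> equals
    \<open>(h \<otimes> h' \<otimes> g) \<otimes> u\<close>, where g lies in H and u in C.\<close>
  define K where "K = (\<Union>h\<in>H. (\<lambda>x. h \<otimes> x) ` C)"
  have UK: "U \<subseteq> K"
  proof
    fix u assume "u \<in> U"
    then have "u \<in> C" "u = \<one> \<otimes> u" using UC(4) Cc by auto
    then show "u \<in> K" using subgroup.one_closed[OF H(1)] unfolding K_def by blast
  qed
  have K: "subgroup K G"
  proof (rule subgroup_mult_closedI)
    show "K \<subseteq> carrier G" using Hc Cc by (auto simp: K_def)
    show "\<one> \<in> K" using UK UC by blast
    show "x \<otimes> y \<in> K" if xy: "x \<in> K" "y \<in> K" for x y
    proof -
      obtain h c h' c' where *: "h \<in> H" "c \<in> C" "x = h \<otimes> c" "h' \<in> H" "c' \<in> C" "y = h' \<otimes> c'"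
        using xy unfolding K_def by blast
      then obtain g u where gu: "g \<in> F" "u \<in> U" "c \<otimes> c' = g \<otimes> u" using F(3) by blast
      have car: "h \<in> carrier G" "c \<in> carrier G" "h' \<in> carrier G" "c' \<in> carrier G" "g \<in> carrier G" "u \<in> carrier G"
        using * gu Hc Cc H(3) UC(4) by auto
      have "x \<otimes> y = (h \<otimes> h') \<otimes> (c \<otimes> c')" using * car by (simp add: m_ac)
      also have "\<dots> = (h \<otimes> h' \<otimes> g) \<otimes> u" using car by (simp add: gu(3) m_assoc)
      finally have "x \<otimes> y = (h \<otimes> h' \<otimes> g) \<otimes> u" .
      moreover have "h \<otimes> h' \<otimes> g \<in> H" using * gu H by (auto intro: subgroup.m_closed)
      moreover have "u \<in> C" using gu UC(4) by blast
      ultimately show ?thesis unfolding K_def by blast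
    qed
  qed
  moreover have "openin \<tau> K" using openin_subgroupI[OF K UC(1,3) UK] .
  moreover have "compactin \<tau> K"
    unfolding K_def
  proof (rule compactin_Union)
    fix S assume "S \<in> (\<lambda>h. (\<lambda>x. h \<otimes> x) ` C) ` H"
    then obtain h where "h \<in> carrier G" "S = (\<lambda>x. h \<otimes> x) ` C" using Hc by blast
    then show "compactin \<tau> S" using image_compactin[OF UC(2) continuous_translate] by blast
  qed (use H(2) in blast)
  ultimately show ?thesis using that by blast
qed

text \<open>A point is given by the representative of its coset and its position in that coset, and
  both depend continuously on it because cosets are open. The representatives need not form a
  subgroup, so this is in general no isomorphism of groups.\<close>

lemma open_subgroup_homeomorphic_prod:
  assumes K: "subgroup K G" "openin \<tau> K"
  obtains D where "D \<subseteq> carrier G" "\<tau> homeomorphic_space prod_topology (subtopology \<tau> K) (discrete_topology D)"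
proof -
  have Kc: "K \<subseteq> carrier G" using K subgroup.subset by blast
  define co where "co x = (\<lambda>k. x \<otimes> k) ` K" for x
  \<comment> \<open>The choice depends on the set \<open>co x\<close> only, so all elements of one
    coset get the same representative.\<close>
  define r where "r x = (SOME y. y \<in> co x)" for x
  define D where "D = r ` carrier G"
  have self: "x \<in> co x" if "x \<in> carrier G" for x
    unfolding co_def using that subgroup.one_closed[OF K(1)] by (force intro: image_eqI[of _ _ \<one>])
  have r: "r x \<in> co x" if "x \<in> carrier G" for x
    unfolding r_def using self[OF that] by (rule someI)
  have co_eq: "co (x \<otimes> k) = co x" if xk: "x \<in> carrier G" "k \<in> K" for x k
  proof -
    have kc: "k \<in> carrier G" using xk Kc by auto
    have "co (x \<otimes> k) \<subseteq> co x" if xk: "x \<in> carrier G" "k \<in> K" for x k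
      unfolding co_def using xk Kc K(1) by (auto simp: m_assoc subset_iff subgroup.m_closed)
    from this[OF xk] this[of "x \<otimes> k" "inv k"] show ?thesis
      using xk kc K(1) by (simp add: m_assoc subgroup.m_inv_closed subset_antisym)
  qed
  have rc: "r x \<in> carrier G" if "x \<in> carrier G" for x
    using r[OF that] that Kc unfolding co_def by auto
  have r_co: "r (x \<otimes> k) = r x" if "x \<in> carrier G" "k \<in> K" for x k
    using co_eq[OF that] by (simp add: r_def)
  have quo: "inv (r x) \<otimes> x \<in> K" if x: "x \<in> carrier G" for x
  proof -
    obtain k where k: "k \<in> K" "r x = x \<otimes> k" using r[OF x] unfolding co_def by blast
    then have "inv (r x) \<otimes> x = inv k" using x Kc by (simp add: subset_iff inv_mult_group m_assoc)
    then show ?thesis using k K(1) by (simp add: subgroup.m_inv_closed)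
  qed
  have rr: "r (r x) = r x" if x: "x \<in> carrier G" for x
  proof -
    obtain k where k: "k \<in> K" "r x = x \<otimes> k" using r[OF x] unfolding co_def by blast
    then show ?thesis using r_co[OF x k(1)] by simp
  qed
  have Dc: "D \<subseteq> carrier G" using rc by (auto simp: D_def)
  let ?P = "prod_topology (subtopology \<tau> K) (discrete_topology D)"
  have rcont: "continuous_map \<tau> (discrete_topology D) r"
  proof -
    have "openin \<tau> {x \<in> carrier G. r x \<in> W}" for W
    proof (subst openin_subopen, intro ballI)
      fix x assume x: "x \<in> {x \<in> carrier G. r x \<in> W}"
      show "\<exists>T. openin \<tau> T \<and> x \<in> T \<and> T \<subseteq> {x \<in> carrier G. r x \<in> W}"
      proof (intro exI conjI)
        show "openin \<tau> (co x)" using openin_translate K(2) x unfolding co_def by blast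
        show "x \<in> co x" using self x by blast
        show "co x \<subseteq> {x \<in> carrier G. r x \<in> W}"
          using x Kc by (auto simp: subset_iff co_def r_co)
      qed
    qed
    then show ?thesis by (auto simp: continuous_map D_def)
  qed
  have "continuous_map ?P \<tau> (\<lambda>z. snd z \<otimes> fst z)"
  proof (rule continuous_map_mult)
    show "continuous_map ?P \<tau> fst" by (rule continuous_map_into_fulltopology[OF continuous_map_fst])
    have "continuous_map (discrete_topology D) \<tau> (\<lambda>x. x)" using Dc by auto
    from continuous_map_compose[OF continuous_map_snd this] show "continuous_map ?P \<tau> snd" by (simp add: o_def)
  qed
  moreover have "continuous_map \<tau> ?P (\<lambda>x. (inv (r x) \<otimes> x, r x))"
  proof -
    have "continuous_map (discrete_topology D) \<tau> (\<lambda>x. x)" using Dc by auto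
    from continuous_map_compose[OF rcont this] have "continuous_map \<tau> \<tau> r" by (simp add: o_def)
    then have "continuous_map \<tau> \<tau> (\<lambda>x. inv (r x) \<otimes> x)" by (intro continuous_map_mult continuous_map_inv) auto
    then have "continuous_map \<tau> (subtopology \<tau> K) (\<lambda>x. inv (r x) \<otimes> x)"
      using quo by (auto simp: continuous_map_in_subtopology)
    then show ?thesis using rcont by (simp add: continuous_map_paired)
  qed
  moreover have "inv (r (d \<otimes> k)) \<otimes> (d \<otimes> k) = k" "r (d \<otimes> k) = d" if "k \<in> K" "d \<in> D" for k d
  proof -
    have c: "d \<in> carrier G" "k \<in> carrier G" using that Dc Kc by auto
    have "r d = d" using that rr by (auto simp: D_def)
    then have "r (d \<otimes> k) = d" using r_co[of d k] c that by simp
    then show "inv (r (d \<otimes> k)) \<otimes> (d \<otimes> k) = k" "r (d \<otimes> k) = d"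
      using c by (simp_all add: m_assoc[symmetric])
  qed
  moreover have "r x \<otimes> (inv (r x) \<otimes> x) = x" if "x \<in> carrier G" for x
    using that rc by (simp add: m_assoc[symmetric])
  ultimately have "homeomorphic_maps \<tau> ?P (\<lambda>x. (inv (r x) \<otimes> x, r x)) (\<lambda>z. snd z \<otimes> fst z)"
    using Kc Dc unfolding homeomorphic_maps_def by (simp add: subset_iff)
  then show ?thesis using that Dc homeomorphic_maps_imp_homeomorphic_space by blast
qed

end

subsection \<open>Transport of topologies\<close>

lemma continuous_map_comp2:
  "continuous_map X Y f \<Longrightarrow> continuous_map Y Z g \<Longrightarrow> continuous_map X Z (\<lambda>x. g (f x))"
  using continuous_map_compose[of X Y f Z g] by (simp add: o_def)

lemma homeomorphic_space_product_discrete: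
  assumes "A \<approx> B" "R \<approx> S"
  shows "product_topology (\<lambda>_. discrete_topology R) A homeomorphic_space product_topology (\<lambda>_. discrete_topology S) B"
proof -
  obtain a b where ab: "a \<in> A \<rightarrow> B" "b \<in> B \<rightarrow> A" "\<And>x. x \<in> A \<Longrightarrow> b (a x) = x" "\<And>y. y \<in> B \<Longrightarrow> a (b y) = y"
    using assms(1) unfolding eqpoll_iff_bijections by auto
  obtain g h where gh: "g \<in> R \<rightarrow> S" "h \<in> S \<rightarrow> R" "\<And>x. x \<in> R \<Longrightarrow> h (g x) = x" "\<And>y. y \<in> S \<Longrightarrow> g (h y) = y"
    using assms(2) unfolding eqpoll_iff_bijections by auto
  have cont: "continuous_map (product_topology (\<lambda>_. discrete_topology R') A') (product_topology (\<lambda>_. discrete_topology S') B')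
      (\<lambda>x. \<lambda>j\<in>B'. g' (x (b' j)))"
    if "b' \<in> B' \<rightarrow> A'" "g' \<in> R' \<rightarrow> S'"
    for A' :: "'i set" and B' :: "'j set" and R' :: "'k set" and S' :: "'l set" and b' g'
  proof (subst continuous_map_componentwise, intro conjI ballI)
    fix j assume j: "j \<in> B'"
    then have "b' j \<in> A'" using that by auto
    then have "continuous_map (product_topology (\<lambda>_. discrete_topology R') A') (discrete_topology R') (\<lambda>x. x (b' j))"
      by (rule continuous_map_product_projection)
    moreover have "continuous_map (discrete_topology R') (discrete_topology S') g'" using that by auto
    ultimately have "continuous_map (product_topology (\<lambda>_. discrete_topology R') A') (discrete_topology S') (g' \<circ> (\<lambda>x. x (b' j)))"
      by (rule continuous_map_compose)
    then show "continuous_map (product_topology (\<lambda>_. discrete_topology R') A') (discrete_topology S') (\<lambda>x. (\<lambda>j\<in>B'. g' (x (b' j))) j)"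
      using j by (simp add: o_def)
  qed auto
  have "homeomorphic_maps (product_topology (\<lambda>_. discrete_topology R) A) (product_topology (\<lambda>_. discrete_topology S) B)
      (\<lambda>x. \<lambda>j\<in>B. g (x (b j))) (\<lambda>x. \<lambda>i\<in>A. h (x (a i)))"
    unfolding homeomorphic_maps_def using cont[OF ab(2) gh(1)] cont[OF ab(1) gh(2)] ab gh
    by (auto simp: fun_eq_iff PiE_iff Pi_iff extensional_def)
  then show ?thesis by (rule homeomorphic_maps_imp_homeomorphic_space)
qed

lemma homeomorphic_space_discrete:
  assumes "A \<approx> B"
  shows "discrete_topology A homeomorphic_space discrete_topology B"
proof -
  obtain f g where "f \<in> A \<rightarrow> B" "g \<in> B \<rightarrow> A" "\<And>x. x \<in> A \<Longrightarrow> g (f x) = x" "\<And>y. y \<in> B \<Longrightarrow> f (g y) = y"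
    using assms unfolding eqpoll_iff_bijections by auto
  then have "homeomorphic_maps (discrete_topology A) (discrete_topology B) f g"
    by (auto simp: homeomorphic_maps_def)
  then show ?thesis by (rule homeomorphic_maps_imp_homeomorphic_space)
qed

lemma homeomorphic_map_pullback_topology:
  assumes "bij_betw f A (topspace T)"
  shows "homeomorphic_map (pullback_topology A f T) T f"
proof -
  have fA: "f ` A = topspace T" and inj: "inj_on f A" using assms by (auto simp: bij_betw_def)
  have ts: "topspace (pullback_topology A f T) = A" using fA by (auto simp: topspace_pullback_topology)
  show ?thesis
  proof (rule bijective_open_imp_homeomorphic_map)
    show "open_map (pullback_topology A f T) T f"
      unfolding open_map_def
    proof (intro allI impI)
      fix U assume "openin (pullback_topology A f T) U"
      then obtain W where W: "openin T W" "U = f -` W \<inter> A" by (auto simp: openin_pullback_topology)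
      then have "f ` U = W" using fA openin_subset by fastforce
      then show "openin T (f ` U)" using W by simp
    qed
    show "continuous_map (pullback_topology A f T) T f"
      unfolding continuous_map ts using fA by (auto simp: openin_pullback_topology)
  qed (use ts fA inj in auto)
qed

lemma group_topology_pullback:
  assumes G: "group G" and H: "group H" and \<phi>: "\<phi> \<in> iso G H" and T: "group_topology H T"
  shows "group_topology G (pullback_topology (carrier G) \<phi> T)"
proof -
  interpret G: group G by fact
  interpret H: group H by fact
  interpret group_hom G H \<phi> using \<phi> by unfold_locales (simp add: iso_def)
  let ?P = "pullback_topology (carrier G) \<phi> T"
  have ts: "topspace T = carrier H" using T by (simp add: group_topology_def)
  have bij: "bij_betw \<phi> (carrier G) (topspace T)" using \<phi> ts by (simp add: iso_def)
  have tsP: "topspace ?P = carrier G" using bij by (auto simp: topspace_pullback_topology bij_betw_def)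
  have hm: "homeomorphic_map ?P T \<phi>" by (rule homeomorphic_map_pullback_topology[OF bij])
  then have cont: "continuous_map ?P T \<phi>" by (rule homeomorphic_imp_continuous_map)
  have lift: "continuous_map X ?P f" if "continuous_map X T (\<phi> \<circ> f)" "f \<in> topspace X \<rightarrow> carrier G" for X :: "'x topology" and f
    using that by (intro continuous_map_pullback') auto
  have "continuous_map (prod_topology ?P ?P) T (\<lambda>z. \<phi> (fst z) \<otimes>\<^bsub>H\<^esub> \<phi> (snd z))"
  proof -
    have "continuous_map (prod_topology ?P ?P) (prod_topology T T) (\<lambda>z. (\<phi> (fst z), \<phi> (snd z)))"
      unfolding continuous_map_paired
      by (intro conjI continuous_map_comp2[OF continuous_map_fst cont] continuous_map_comp2[OF continuous_map_snd cont])
    from continuous_map_compose[OF this, of T "\<lambda>(x, y). x \<otimes>\<^bsub>H\<^esub> y"] T show ?thesis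
      by (simp add: group_topology_def o_def)
  qed
  then have "continuous_map (prod_topology ?P ?P) T (\<phi> \<circ> (\<lambda>(x, y). x \<otimes>\<^bsub>G\<^esub> y))"
    by (rule continuous_map_eq) (auto simp: tsP)
  then have m: "continuous_map (prod_topology ?P ?P) ?P (\<lambda>(x, y). x \<otimes>\<^bsub>G\<^esub> y)"
    by (rule lift) (auto simp: tsP)
  have "continuous_map ?P T (\<lambda>x. inv\<^bsub>H\<^esub> (\<phi> x))"
    using continuous_map_compose[OF cont, of T "\<lambda>x. inv\<^bsub>H\<^esub> x"] T by (simp add: group_topology_def o_def)
  then have "continuous_map ?P T (\<phi> \<circ> (\<lambda>x. inv\<^bsub>G\<^esub> x))"
    by (rule continuous_map_eq) (auto simp: tsP)
  then have "continuous_map ?P ?P (\<lambda>x. inv\<^bsub>G\<^esub> x)"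
    by (rule lift) (auto simp: tsP)
  then show ?thesis using m tsP by (simp add: group_topology_def)
qed

lemma group_topology_DirProd:
  assumes G: "group G" and H: "group H" and S: "group_topology G S" and T: "group_topology H T"
  shows "group_topology (G \<times>\<times> H) (prod_topology S T)"
proof -
  let ?P = "prod_topology S T"
  have ts: "topspace S = carrier G" "topspace T = carrier H" using S T by (auto simp: group_topology_def)
  have mS: "continuous_map X S (\<lambda>z. f z \<otimes>\<^bsub>G\<^esub> g z)" if "continuous_map X S f" "continuous_map X S g" for X :: "'x topology" and f g
    using continuous_map_compose[of X "prod_topology S S" "\<lambda>x. (f x, g x)" S "\<lambda>(x, y). x \<otimes>\<^bsub>G\<^esub> y"] that S
    by (simp add: continuous_map_paired o_def group_topology_def)
  have mT: "continuous_map X T (\<lambda>z. f z \<otimes>\<^bsub>H\<^esub> g z)" if "continuous_map X T f" "continuous_map X T g" for X :: "'x topology" and f g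
    using continuous_map_compose[of X "prod_topology T T" "\<lambda>x. (f x, g x)" T "\<lambda>(x, y). x \<otimes>\<^bsub>H\<^esub> y"] that T
    by (simp add: continuous_map_paired o_def group_topology_def)
  note fs = continuous_map_compose[OF continuous_map_fst continuous_map_fst, unfolded o_def]
    continuous_map_compose[OF continuous_map_fst continuous_map_snd, unfolded o_def]
    continuous_map_compose[OF continuous_map_snd continuous_map_fst, unfolded o_def]
    continuous_map_compose[OF continuous_map_snd continuous_map_snd, unfolded o_def]
  have "continuous_map (prod_topology ?P ?P) ?P (\<lambda>z. (fst (fst z) \<otimes>\<^bsub>G\<^esub> fst (snd z), snd (fst z) \<otimes>\<^bsub>H\<^esub> snd (snd z)))"
    unfolding continuous_map_paired by (intro conjI mS mT fs)
  then have m: "continuous_map (prod_topology ?P ?P) ?P (\<lambda>(x, y). x \<otimes>\<^bsub>G \<times>\<times> H\<^esub> y)"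
    by (rule continuous_map_eq) (auto simp: mult_DirProd')
  have iS: "continuous_map S S (\<lambda>x. inv\<^bsub>G\<^esub> x)" and iT: "continuous_map T T (\<lambda>x. inv\<^bsub>H\<^esub> x)"
    using S T by (auto simp: group_topology_def)
  have "continuous_map ?P ?P (\<lambda>z. (inv\<^bsub>G\<^esub> (fst z), inv\<^bsub>H\<^esub> (snd z)))"
    unfolding continuous_map_paired
    by (intro conjI continuous_map_comp2[OF continuous_map_fst iS] continuous_map_comp2[OF continuous_map_snd iT])
  then have "continuous_map ?P ?P (\<lambda>x. inv\<^bsub>G \<times>\<times> H\<^esub> x)"
    by (rule continuous_map_eq) (use G H ts in auto)
  then show ?thesis using m ts by (simp add: group_topology_def)
qed

lemma group_topology_discrete: "group G \<Longrightarrow> group_topology G (discrete_topology (carrier G))"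
  by (auto simp: group_topology_def group.is_monoid simp flip: prod_topology_discrete_topology)
    (auto simp: group_def monoid.m_closed)

subsection \<open>The group of sequences\<close>

locale prime_power_group =
  fixes p :: nat
  assumes prime: "prime p"
begin

abbreviation G where "G \<equiv> Zp_power p"

lemma p_gt_1: "p > 1" using prime prime_gt_1_nat by blast

lemma carrier_G: "carrier G = {x. \<forall>n. x n \<in> {0..<int p}}"
  using p_gt_1 by (auto simp: Zp_power_def carrier_integer_mod_group PiE_def Pi_def)

lemma mult_G: "x \<otimes>\<^bsub>G\<^esub> y = (\<lambda>n. (x n + y n) mod int p)"
  by (simp add: Zp_power_def restrict_def)

lemma one_G: "\<one>\<^bsub>G\<^esub> = (\<lambda>n. 0)"
  by (simp add: Zp_power_def restrict_def)

lemma group_G: "group G" by (simp add: Zp_power_def)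

sublocale G: prime_exponent_group G p
proof -
  interpret G: group G by (rule group_G)
  interpret G: comm_group G by (rule G.group_comm_groupI) (simp add: mult_G add.commute)
  show "prime_exponent_group G p"
  proof
    fix x assume x: "x \<in> carrier G"
    have "x [^]\<^bsub>G\<^esub> k = (\<lambda>n. (int k * x n) mod int p)" for k :: nat
      by (induction k) (use x in \<open>auto simp: one_G mult_G algebra_simps mod_simps\<close>)
    then show "x [^]\<^bsub>G\<^esub> p = \<one>\<^bsub>G\<^esub>" by (simp add: one_G)
  qed (rule prime)
qed

lemma pow_G: "x [^]\<^bsub>G\<^esub> k = (\<lambda>n. (int k * x n) mod int p)" for k :: nat
  by (induction k) (auto simp: one_G mult_G algebra_simps mod_simps)

lemma inv_G: "x \<in> carrier G \<Longrightarrow> inv\<^bsub>G\<^esub> x = (\<lambda>n. (- x n) mod int p)"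
  by (rule G.inv_equality) (use p_gt_1 in \<open>auto simp: mult_G one_G carrier_G mod_simps\<close>)

lemma mem_G: "x \<in> carrier G \<Longrightarrow> 0 \<le> x n" "x \<in> carrier G \<Longrightarrow> x n < int p"
  by (auto simp: carrier_G)

lemma topspace_tau_c [simp]: "topspace (tau_c p) = carrier G"
  by (simp add: tau_c_def Zp_power_def)

lemma tau_c_eq: "tau_c p = product_topology (\<lambda>_. discrete_topology {0..<int p}) UNIV"
  using p_gt_1 by (simp add: tau_c_def carrier_integer_mod_group)

lemma hausdorff_tau_c: "hausdorff_group_topology G (tau_c p)"
proof -
  let ?D = "discrete_topology {0..<int p}"
  have proj: "continuous_map (tau_c p) ?D (\<lambda>x. x n)" for n
    unfolding tau_c_eq by (rule continuous_map_product_projection) simp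
  have "continuous_map (prod_topology (tau_c p) (tau_c p)) (tau_c p) (\<lambda>z n. (fst z n + snd z n) mod int p)"
  proof (subst (3) tau_c_eq, subst continuous_map_componentwise_UNIV, intro allI)
    fix n
    have 1: "continuous_map (prod_topology (tau_c p) (tau_c p)) (prod_topology ?D ?D) (\<lambda>z. (fst z n, snd z n))"
      unfolding continuous_map_paired
      by (intro conjI continuous_map_comp2[OF continuous_map_fst proj] continuous_map_comp2[OF continuous_map_snd proj])
    have "continuous_map (prod_topology ?D ?D) ?D (\<lambda>(a, b). (a + b) mod int p)"
      using p_gt_1 by (auto simp flip: prod_topology_discrete_topology)
    from continuous_map_compose[OF 1 this]
    show "continuous_map (prod_topology (tau_c p) (tau_c p)) ?D (\<lambda>z. (fst z n + snd z n) mod int p)"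
      by (simp add: o_def)
  qed
  then have "continuous_map (prod_topology (tau_c p) (tau_c p)) (tau_c p) (\<lambda>(x, y). x \<otimes>\<^bsub>G\<^esub> y)"
    by (simp add: mult_G case_prod_unfold)
  moreover have "continuous_map (tau_c p) (tau_c p) (\<lambda>x n. (- x n) mod int p)"
  proof (subst (2) tau_c_eq, subst continuous_map_componentwise_UNIV, intro allI)
    fix n
    have "continuous_map ?D ?D (\<lambda>a. (- a) mod int p)" using p_gt_1 by auto
    from continuous_map_compose[OF proj this] show "continuous_map (tau_c p) ?D (\<lambda>x. (- x n) mod int p)"
      by (simp add: o_def)
  qed
  then have "continuous_map (tau_c p) (tau_c p) (\<lambda>x. inv\<^bsub>G\<^esub> x)"
    by (rule continuous_map_eq) (simp add: inv_G)
  moreover have "Hausdorff_space (tau_c p)" by (simp add: tau_c_eq Hausdorff_space_product_topology)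
  ultimately show ?thesis by (simp add: hausdorff_group_topology_def group_topology_def)
qed

lemma compact_tau_c: "compact_space (tau_c p)"
  by (simp add: tau_c_eq compact_space_product_topology compact_space_discrete_topology)

lemma hausdorff_tau_d: "hausdorff_group_topology G (tau_d p)"
  by (simp add: hausdorff_group_topology_def tau_d_def group_topology_discrete group_G)

lemma topspace_tau_d [simp]: "topspace (tau_d p) = carrier G"
  by (simp add: tau_d_def)

text \<open>A sequence is coded by its graph, and conversely a set of naturals by its characteristic
  sequence.\<close>

lemma carrier_G_eqpoll: "carrier G \<approx> (UNIV :: nat set set)"
proof (rule lepoll_antisym)
  have "inj_on (\<lambda>x. {prod_encode (n, nat (x n)) | n. True}) (carrier G)"
  proof (rule inj_onI)
    fix x y assume x: "x \<in> carrier G" "y \<in> carrier G"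
      and eq: "{prod_encode (n, nat (x n)) | n. True} = {prod_encode (n, nat (y n)) | n. True}"
    have "nat (x n) = nat (y n)" for n
    proof -
      have "prod_encode (n, nat (x n)) \<in> {prod_encode (n, nat (y n)) | n. True}" using eq by blast
      then show ?thesis by auto
    qed
    then have "x n = y n" for n using x by (metis mem_G(1) eq_nat_nat_iff)
    then show "x = y" by (simp add: fun_eq_iff)
  qed
  then show "carrier G \<lesssim> (UNIV :: nat set set)" unfolding lepoll_def by blast
  have "inj (\<lambda>A n. if n \<in> A then 1 else 0 :: int)" by (rule injI) (auto simp: fun_eq_iff split: if_splits)
  moreover have "range (\<lambda>A n. if n \<in> A then 1 else 0 :: int) \<subseteq> carrier G"
    using p_gt_1 by (auto simp: carrier_G)
  ultimately show "(UNIV :: nat set set) \<lesssim> carrier G" unfolding lepoll_def by blast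
qed

lemma uncountable_G: "uncountable (carrier G)"
proof
  assume "countable (carrier G)"
  then have "countable (UNIV :: nat set set)" using carrier_G_eqpoll countable_eqpoll eqpoll_sym by blast
  then obtain f :: "nat \<Rightarrow> nat set" where "surj f" by (metis UNIV_not_empty uncountable_def)
  then show False using Cantors_theorem[of UNIV] by (metis Pow_UNIV)
qed

end

text \<open>An uncountable set has at least the cardinality of the successor of
  \<open>natLeq\<close>, which the hypothesis equates with the continuum. This is the only place
  where \<open>continuum_hypothesis\<close> is unfolded.\<close>

lemma continuum_hypothesis_uncountable:
  assumes CH: continuum_hypothesis and A: "uncountable A"
  shows "(UNIV :: nat set set) \<lesssim> A"
proof -
  have "(card_of A, natLeq) \<notin> ordLeq"
  proof
    assume "(card_of A, natLeq) \<in> ordLeq"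
    then have "(card_of A, card_of (UNIV :: nat set)) \<in> ordLeq"
      using card_of_nat ordIso_symmetric ordLeq_ordIso_trans by blast
    then obtain f :: "'a \<Rightarrow> nat" where "inj_on f A" unfolding card_of_ordLeq[symmetric] by blast
    then show False using A by (auto simp: countable_def)
  qed
  then have "(natLeq, card_of A) \<in> ordLess"
    by (simp add: not_ordLeq_iff_ordLess card_of_Well_order natLeq_Well_order)
  then have "(cardSuc natLeq, card_of A) \<in> ordLeq"
    using cardSuc_ordLess_ordLeq[OF natLeq_Card_order card_of_Card_order] by blast
  moreover have "(card_of (UNIV :: nat set set), BNF_Cardinal_Arithmetic.cexp BNF_Cardinal_Arithmetic.ctwo natLeq) \<in> ordIso"
  proof -
    have "(card_of (Pow (UNIV :: nat set)), BNF_Cardinal_Arithmetic.cexp BNF_Cardinal_Arithmetic.ctwo natLeq) \<in> ordIso"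
      unfolding BNF_Cardinal_Arithmetic.ctwo_def BNF_Cardinal_Arithmetic.cexp_def Field_card_of Field_natLeq
      by (rule card_of_Pow_Func)
    then show ?thesis by simp
  qed
  ultimately have "(card_of (UNIV :: nat set set), card_of A) \<in> ordLeq"
    using CH unfolding continuum_hypothesis_def by (meson ordIso_symmetric ordIso_ordLeq_trans ordIso_transitive)
  then show ?thesis unfolding lepoll_def by (simp add: card_of_ordLeq)
qed

context prime_power_group
begin

subsection \<open>The dual group\<close>

definition unit_root :: complex where
  "unit_root = (SOME w. w ^ p = 1 \<and> w \<noteq> 1)"

text \<open>The isomorphism from Z_p onto the p-th roots of unity, defined on all integers so that
  reduction modulo p can be left to \<open>root_exp_mod\<close>.\<close>

definition root_exp :: "int \<Rightarrow> complex" where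
  "root_exp a = unit_root powi a"

lemma unit_root: "unit_root ^ p = 1" "unit_root \<noteq> 1"
proof -
  have "unit_root ^ p = 1 \<and> unit_root \<noteq> 1"
    unfolding unit_root_def by (rule someI_ex) (metis ex_root_of_unity_ne_1 prime)
  then show "unit_root ^ p = 1" "unit_root \<noteq> 1" by auto
qed

lemma unit_root_nz: "unit_root \<noteq> 0"
  using unit_root(1) p_gt_1 by (metis power_0_left not_less_zero zero_neq_one)

lemma root_exp_add: "root_exp (a + b) = root_exp a * root_exp b"
  unfolding root_exp_def using unit_root_nz by (simp add: power_int_add)

lemma root_exp_0 [simp]: "root_exp 0 = 1"
  by (simp add: root_exp_def)

lemma root_exp_power: "root_exp (int k * a) = root_exp a ^ k"
  by (induction k) (auto simp: root_exp_add distrib_right)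

lemma root_exp_pow_p: "root_exp a ^ p = 1"
proof -
  have "root_exp a ^ p = (unit_root powi a) powi int p" by (simp add: root_exp_def)
  also have "\<dots> = (unit_root powi int p) powi a" by (simp only: power_int_mult[symmetric] mult.commute)
  also have "\<dots> = 1" using unit_root(1) by simp
  finally show ?thesis .
qed

lemma root_exp_p_mult: "root_exp (int p * a) = 1"
  by (simp add: root_exp_power root_exp_pow_p)

lemma root_exp_mod: "root_exp (a mod int p) = root_exp a"
proof -
  have "root_exp a = root_exp (int p * (a div int p) + a mod int p)" by simp
  also have "\<dots> = root_exp (a mod int p)" unfolding root_exp_add root_exp_p_mult by simp
  finally show ?thesis by simp
qed

lemma root_exp_cong: "a mod int p = b mod int p \<Longrightarrow> root_exp a = root_exp b"
  by (metis root_exp_mod)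

lemma root_exp_surj:
  assumes "z ^ p = 1"
  obtains a where "0 \<le> a" "a < int p" "root_exp a = z"
proof -
  obtain k where "z = unit_root ^ k" using root_of_unity_powers[OF prime unit_root assms] by blast
  then have "root_exp (int k mod int p) = z" by (simp add: root_exp_mod) (simp add: root_exp_def)
  then show ?thesis using that[of "int k mod int p"] p_gt_1 by simp
qed

lemma root_exp_bij: "bij_betw root_exp {0..<int p} {z. z ^ p = 1}"
proof -
  have surj: "root_exp ` {0..<int p} = {z. z ^ p = 1}"
  proof
    show "{z. z ^ p = 1} \<subseteq> root_exp ` {0..<int p}"
    proof
      fix z assume "z \<in> {z::complex. z ^ p = 1}"
      then obtain a where "0 \<le> a" "a < int p" "root_exp a = z" using root_exp_surj by auto
      then show "z \<in> root_exp ` {0..<int p}" by force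
    qed
  qed (auto simp: root_exp_pow_p)
  moreover have "card {z::complex. z ^ p = 1} = card {0..<int p}"
    using card_roots_unity_eq[of p] p_gt_1 by simp
  ultimately show ?thesis by (metis bij_betw_def eq_card_imp_inj_on finite_atLeastLessThan_int)
qed

lemma roots_eqpoll: "{z::complex. z ^ p = 1} \<approx> {0..<int p}"
  using root_exp_bij by (meson eqpoll_def eqpoll_sym)

text \<open>The direct sum of countably many copies of Z_p; \<open>pairing\<close> identifies it
  with the dual of \<open>tau_c p\<close>.\<close>

definition fin_supp :: "(nat \<Rightarrow> int) set" where
  "fin_supp = {x \<in> carrier G. finite {i. x i \<noteq> 0}}"

definition unit_vec :: "nat \<Rightarrow> nat \<Rightarrow> int" where
  "unit_vec i = (\<lambda>j. if j = i then 1 else 0)"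

definition trunc :: "nat set \<Rightarrow> (nat \<Rightarrow> int) \<Rightarrow> nat \<Rightarrow> int" where
  "trunc I x = (\<lambda>i. if i \<in> I then x i else 0)"

text \<open>The character whose exponent is the dot product of v and x. Restriction to the carrier
  makes it extensional, as the members of \<open>dual\<close> are.\<close>

definition pairing :: "(nat \<Rightarrow> int) \<Rightarrow> (nat \<Rightarrow> int) \<Rightarrow> complex" where
  "pairing v = (\<lambda>x\<in>carrier G. \<Prod>i | v i \<noteq> 0. root_exp (v i * x i))"

abbreviation dual where "dual \<equiv> character_group G (tau_c p)"

lemma subgroup_fin_supp: "subgroup fin_supp G"
proof (rule G.subgroup_mult_closedI)
  show "\<one>\<^bsub>G\<^esub> \<in> fin_supp" using p_gt_1 by (auto simp: fin_supp_def one_G carrier_G)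
  fix x y assume "x \<in> fin_supp" "y \<in> fin_supp"
  then have "finite ({i. x i \<noteq> 0} \<union> {i. y i \<noteq> 0})" "x \<in> carrier G" "y \<in> carrier G" by (auto simp: fin_supp_def)
  moreover have "{i. (x \<otimes>\<^bsub>G\<^esub> y) i \<noteq> 0} \<subseteq> {i. x i \<noteq> 0} \<union> {i. y i \<noteq> 0}" by (auto simp: mult_G)
  ultimately show "x \<otimes>\<^bsub>G\<^esub> y \<in> fin_supp" unfolding fin_supp_def using finite_subset by auto
qed (auto simp: fin_supp_def)

lemma unit_vec: "unit_vec i \<in> fin_supp"
  using p_gt_1 by (auto simp: unit_vec_def fin_supp_def carrier_G)

lemma unit_vec_G: "unit_vec i \<in> carrier G"
  using unit_vec by (simp add: fin_supp_def)

lemma trunc_G: "x \<in> carrier G \<Longrightarrow> trunc I x \<in> carrier G"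
  using p_gt_1 by (auto simp: trunc_def carrier_G)

text \<open>Lets the products for different v be compared over one common index set.\<close>

lemma pairing_superset:
  assumes "finite I" "{i. v i \<noteq> 0} \<subseteq> I" "x \<in> carrier G"
  shows "pairing v x = (\<Prod>i\<in>I. root_exp (v i * x i))"
proof -
  have "(\<Prod>i\<in>I. root_exp (v i * x i)) = (\<Prod>i | v i \<noteq> 0. root_exp (v i * x i))"
    using assms by (intro prod.mono_neutral_right) auto
  then show ?thesis using assms by (simp add: pairing_def)
qed

lemma pairing_is_char:
  assumes "v \<in> fin_supp"
  shows "G.is_char (carrier G) (pairing v)"
  unfolding G.is_char_def
proof (intro conjI ballI)
  fix x y assume xy: "x \<in> carrier G" "y \<in> carrier G"
  have "root_exp (v i * ((x i + y i) mod int p)) = root_exp (v i * x i) * root_exp (v i * y i)" for i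
    unfolding root_exp_add[symmetric] distrib_left[symmetric] by (rule root_exp_cong) (simp add: mod_simps)
  then show "pairing v (x \<otimes>\<^bsub>G\<^esub> y) = pairing v x * pairing v y"
    using xy G.m_closed[OF xy] by (simp add: pairing_def mult_G prod.distrib)
  show "pairing v x ^ p = 1" using xy by (simp add: pairing_def prod_power_distrib root_exp_pow_p)
qed

lemma pairing_mult:
  assumes v: "v \<in> fin_supp" "w \<in> fin_supp" and x: "x \<in> carrier G"
  shows "pairing (v \<otimes>\<^bsub>G\<^esub> w) x = pairing v x * pairing w x"
proof -
  let ?I = "{i. v i \<noteq> 0} \<union> {i. w i \<noteq> 0}"
  have I: "finite ?I" using v by (auto simp: fin_supp_def)
  have "root_exp (((v i + w i) mod int p) * x i) = root_exp (v i * x i) * root_exp (w i * x i)" for i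
    unfolding root_exp_add[symmetric] distrib_right[symmetric] by (rule root_exp_cong) (simp add: mod_simps)
  moreover have "{i. (v \<otimes>\<^bsub>G\<^esub> w) i \<noteq> 0} \<subseteq> ?I" by (auto simp: mult_G)
  ultimately show ?thesis
    using pairing_superset[OF I _ x, of "v \<otimes>\<^bsub>G\<^esub> w"] pairing_superset[OF I _ x, of v] pairing_superset[OF I _ x, of w]
    by (auto simp: mult_G prod.distrib)
qed

lemma pairing_unit_vec:
  assumes "v \<in> fin_supp"
  shows "pairing v (unit_vec i) = root_exp (v i)"
proof -
  have "pairing v (unit_vec i) = (\<Prod>j\<in>insert i {i. v i \<noteq> 0}. root_exp (v j * unit_vec i j))"
    using assms unit_vec_G by (intro pairing_superset) (auto simp: fin_supp_def)
  also have "\<dots> = (\<Prod>j\<in>{i}. root_exp (v j * unit_vec i j))"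
    using assms by (intro prod.mono_neutral_right) (auto simp: fin_supp_def unit_vec_def)
  finally show ?thesis by (simp add: unit_vec_def)
qed

lemma pairing_inj: "inj_on pairing fin_supp"
proof (rule inj_onI)
  fix v w assume vw: "v \<in> fin_supp" "w \<in> fin_supp" "pairing v = pairing w"
  then have "root_exp (v i) = root_exp (w i)" for i by (metis pairing_unit_vec)
  moreover have "v i \<in> {0..<int p}" "w i \<in> {0..<int p}" for i using vw by (auto simp: fin_supp_def carrier_G)
  ultimately have "v i = w i" for i using root_exp_bij by (meson bij_betw_def inj_onD)
  then show "v = w" by blast
qed

section \<open>Neighborhoods in the product topology and continuous characters\<close>

lemma openin_cylinder:
  assumes "finite I"
  shows "openin (tau_c p) {x \<in> carrier G. \<forall>i\<in>I. x i = 0}"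
proof -
  have proj: "continuous_map (tau_c p) (discrete_topology {0..<int p}) (\<lambda>x. x n)" for n
    unfolding tau_c_eq by (rule continuous_map_product_projection) simp
  have "openin (tau_c p) {x \<in> topspace (tau_c p). x i \<in> {0}}" for i
    by (rule openin_continuous_map_preimage[OF proj]) (use p_gt_1 in simp)
  then have "openin (tau_c p) (topspace (tau_c p) \<inter> \<Inter>((\<lambda>i. {x \<in> topspace (tau_c p). x i \<in> {0}}) ` I))"
    using assms openin_topspace[of "tau_c p"] by (cases "I = {}") (auto intro!: openin_Int openin_Inter)
  moreover have "topspace (tau_c p) \<inter> \<Inter>((\<lambda>i. {x \<in> topspace (tau_c p). x i \<in> {0}}) ` I) = {x \<in> carrier G. \<forall>i\<in>I. x i = 0}"
    by auto
  ultimately show ?thesis by simp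
qed

lemma nhd_cylinder:
  assumes "openin (tau_c p) U" "\<one>\<^bsub>G\<^esub> \<in> U"
  obtains I where "finite I" "{x \<in> carrier G. \<forall>i\<in>I. x i = 0} \<subseteq> U"
proof -
  obtain W where W: "finite {i. W i \<noteq> {0..<int p}}" "\<one>\<^bsub>G\<^esub> \<in> Pi\<^sub>E UNIV W" "Pi\<^sub>E UNIV W \<subseteq> U"
    using assms unfolding tau_c_eq openin_product_topology_alt by auto
  have "x \<in> U" if x: "x \<in> carrier G" "\<forall>i\<in>{i. W i \<noteq> {0..<int p}}. x i = 0" for x
  proof -
    have "x i \<in> W i" for i
      using x W(2) by (cases "W i = {0..<int p}") (auto simp: one_G carrier_G PiE_iff)
    then show ?thesis using W(3) by (auto simp: PiE_iff)
  qed
  then show ?thesis using that[OF W(1)] by blast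
qed

interpretation C: hausdorff_exponent_group G p "tau_c p"
  using hausdorff_tau_c by unfold_locales (auto simp: hausdorff_group_topology_def)

lemma pairing_continuous:
  assumes v: "v \<in> fin_supp"
  shows "continuous_map (tau_c p) (discrete_topology {z. z ^ p = 1}) (pairing v)"
proof (rule C.continuous_map_char[OF pairing_is_char[OF v] openin_cylinder])
  show "finite {i. v i \<noteq> 0}" using v by (simp add: fin_supp_def)
  show "\<one>\<^bsub>G\<^esub> \<in> {x \<in> carrier G. \<forall>i\<in>{i. v i \<noteq> 0}. x i = 0}" by (auto simp: one_G[symmetric]) (simp add: one_G)
qed (auto simp: pairing_def)

lemma roots_subset_sphere: "{z::complex. z ^ p = 1} \<subseteq> sphere 0 1"
  using p_gt_1 by (auto dest!: power_eq_1_iff)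

lemma finite_roots: "finite {z::complex. z ^ p = 1}"
  using finite_roots_unity[of p] p_gt_1 by auto

lemma carrier_dual: "f \<in> carrier dual \<longleftrightarrow> f \<in> extensional (carrier G) \<and>
    (\<forall>x\<in>carrier G. norm (f x) = 1) \<and> (\<forall>x\<in>carrier G. \<forall>y\<in>carrier G. f (x \<otimes>\<^bsub>G\<^esub> y) = f x * f y) \<and>
    continuous_map (tau_c p) circle_topology f"
  by (auto simp: character_group_def hom_def circle_group_def)

lemma pairing_in_dual: "v \<in> fin_supp \<Longrightarrow> pairing v \<in> carrier dual"
proof -
  assume v: "v \<in> fin_supp"
  have "continuous_map (discrete_topology {z. z ^ p = 1}) circle_topology id"
    using roots_subset_sphere by (auto simp: circle_topology_def)
  from continuous_map_compose[OF pairing_continuous[OF v] this]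
  have "continuous_map (tau_c p) circle_topology (pairing v)" by simp
  then show ?thesis unfolding carrier_dual
    using G.is_char_norm[OF pairing_is_char[OF v]] G.is_char_mult[OF pairing_is_char[OF v]]
    by (auto simp: pairing_def)
qed

lemma openin_circle_finite_complement:
  assumes "finite F"
  shows "openin circle_topology (sphere 0 1 - F)"
proof -
  have "open (- F)" using assms finite_imp_closed by auto
  then have "openin circle_topology (sphere 0 1 \<inter> - F)" unfolding circle_topology_def by (rule openin_open_Int)
  then show ?thesis by (simp add: Diff_eq)
qed

lemma dual_is_char:
  assumes f: "f \<in> carrier dual"
  shows "G.is_char (carrier G) f"
proof -
  have mult: "f (x \<otimes>\<^bsub>G\<^esub> y) = f x * f y" if "x \<in> carrier G" "y \<in> carrier G" for x y
    using f that by (simp add: carrier_dual)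
  have "f \<one>\<^bsub>G\<^esub> * f \<one>\<^bsub>G\<^esub> = f \<one>\<^bsub>G\<^esub>" "f \<one>\<^bsub>G\<^esub> \<noteq> 0"
    using mult[of "\<one>\<^bsub>G\<^esub>" "\<one>\<^bsub>G\<^esub>"] f G.one_closed unfolding carrier_dual by (auto, metis norm_zero zero_neq_one)
  then have one: "f \<one>\<^bsub>G\<^esub> = 1" by simp
  have "f (x [^]\<^bsub>G\<^esub> k) = f x ^ k" if "x \<in> carrier G" for x and k :: nat
    by (induction k) (auto simp: one mult that)
  then have "f x ^ p = 1" if "x \<in> carrier G" for x using G.pow_p[OF that] one that by metis
  then show ?thesis using mult by (simp add: G.is_char_def)
qed

text \<open>Near 1 the circle contains no other p-th root of unity, so by continuity f is trivial on
  a cylinder over finitely many coordinates I; v collects the exponents of f on the unit vectors in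
  I.\<close>

lemma pairing_surj:
  assumes f: "f \<in> carrier dual"
  obtains v where "v \<in> fin_supp" "f = pairing v"
proof -
  note fc = dual_is_char[OF f]
  have one: "f \<one>\<^bsub>G\<^esub> = 1" using G.is_char_one[OF fc G.subgroup_self] .
  \<comment> \<open>The circle without the nontrivial p-th roots of unity: the only value of f in W
    is 1.\<close>
  define W where "W = sphere 0 1 - ({z::complex. z ^ p = 1} - {1})"
  have "openin (tau_c p) {x \<in> topspace (tau_c p). f x \<in> W}"
  proof (rule openin_continuous_map_preimage)
    show "continuous_map (tau_c p) circle_topology f" using f by (simp add: carrier_dual)
    show "openin circle_topology W" unfolding W_def by (rule openin_circle_finite_complement) (simp add: finite_roots)
  qed
  moreover have "\<one>\<^bsub>G\<^esub> \<in> {x \<in> topspace (tau_c p). f x \<in> W}" using one by (simp add: W_def)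
  ultimately obtain I where I: "finite I" "{x \<in> carrier G. \<forall>i\<in>I. x i = 0} \<subseteq> {x \<in> topspace (tau_c p). f x \<in> W}"
    using nhd_cylinder by blast
  have triv: "f x = 1" if "x \<in> carrier G" "\<forall>i\<in>I. x i = 0" for x
    using I(2) that G.is_char_pow_p[OF fc that(1)] by (auto simp: W_def)
  have "\<exists>a. 0 \<le> a \<and> a < int p \<and> root_exp a = f (unit_vec i)" for i
    using root_exp_surj[OF G.is_char_pow_p[OF fc unit_vec_G[of i]]] by metis
  then obtain a where a: "\<And>i. 0 \<le> a i \<and> a i < int p \<and> root_exp (a i) = f (unit_vec i)" by metis
  \<comment> \<open>\<open>trunc I\<close> discards the exponents outside I, where f is 1 on the
    unit vectors anyway, and makes the support finite.\<close>
  define v where "v = trunc I a"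
  have "finite {i. v i \<noteq> 0}" by (rule finite_subset[OF _ I(1)]) (auto simp: v_def trunc_def)
  then have v: "v \<in> fin_supp" using a p_gt_1 by (auto simp: fin_supp_def carrier_G v_def trunc_def)
  have part: "f (trunc J x) = (\<Prod>i\<in>J. root_exp (v i * x i))" if x: "x \<in> carrier G" and J: "finite J" "J \<subseteq> I" for x J
    using J
  proof (induction J rule: finite_induct)
    case empty
    then show ?case using one by (simp add: trunc_def one_G)
  next
    case (insert j J)
    have "trunc (insert j J) x = trunc J x \<otimes>\<^bsub>G\<^esub> (unit_vec j [^]\<^bsub>G\<^esub> nat (x j))"
      using insert x by (auto simp: trunc_def mult_G pow_G unit_vec_def mem_G fun_eq_iff)
    then have "f (trunc (insert j J) x) = f (trunc J x) * f (unit_vec j) ^ nat (x j)"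
      using trunc_G[OF x] unit_vec_G by (simp add: G.is_char_mult[OF fc] G.is_char_pow[OF fc G.subgroup_self])
    also have "f (unit_vec j) ^ nat (x j) = root_exp (v j * x j)"
      using insert.prems a[of j] root_exp_power[of "nat (x j)" "a j"] mem_G(1)[OF x]
      by (simp add: v_def trunc_def mult.commute)
    finally show ?case using insert by (simp add: mult.commute)
  qed
  have "f x = pairing v x" if x: "x \<in> carrier G" for x
  proof -
    have "x = trunc I x \<otimes>\<^bsub>G\<^esub> trunc (- I) x"
      using x by (auto simp: trunc_def mult_G mem_G fun_eq_iff)
    then have "f x = f (trunc I x) * f (trunc (- I) x)"
      using G.is_char_mult[OF fc trunc_G[OF x] trunc_G[OF x], of I "- I"] by simp
    also have "f (trunc (- I) x) = 1" by (rule triv[OF trunc_G[OF x]]) (simp add: trunc_def)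
    also have "f (trunc I x) = (\<Prod>i\<in>I. root_exp (v i * x i))" using part[OF x I(1)] by simp
    also have "\<dots> = pairing v x"
      by (rule pairing_superset[symmetric, OF I(1) _ x]) (auto simp: v_def trunc_def)
    finally show ?thesis by simp
  qed
  then have "f = pairing v"
    using f by (intro extensionalityI[of f "carrier G"]) (auto simp: carrier_dual pairing_def)
  then show ?thesis using that v by blast
qed

lemma pairing_bij: "bij_betw pairing fin_supp (carrier dual)"
  unfolding bij_betw_def using pairing_inj pairing_in_dual pairing_surj by blast

lemma mult_dual: "f \<otimes>\<^bsub>dual\<^esub> g = (\<lambda>x\<in>carrier G. f x * g x)"
  and one_dual: "\<one>\<^bsub>dual\<^esub> = (\<lambda>x\<in>carrier G. 1)"
  by (auto simp: character_group_def)

lemma pairing_mult_dual: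
  "v \<in> fin_supp \<Longrightarrow> w \<in> fin_supp \<Longrightarrow> pairing v \<otimes>\<^bsub>dual\<^esub> pairing w = pairing (v \<otimes>\<^bsub>G\<^esub> w)"
  by (rule extensionalityI[of _ "carrier G"], simp add: mult_dual, simp add: pairing_def)
     (simp add: mult_dual pairing_mult)

lemma pairing_one: "pairing \<one>\<^bsub>G\<^esub> = \<one>\<^bsub>dual\<^esub>"
  by (simp add: pairing_def one_dual one_G)

lemma group_dual: "group dual"
proof (rule groupI)
  fix f g assume fg: "f \<in> carrier dual" "g \<in> carrier dual"
  then obtain v w where vw: "v \<in> fin_supp" "f = pairing v" "w \<in> fin_supp" "g = pairing w" by (metis pairing_surj)
  then show "f \<otimes>\<^bsub>dual\<^esub> g \<in> carrier dual"
    using pairing_in_dual subgroup.m_closed[OF subgroup_fin_supp] by (simp add: pairing_mult_dual)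
  have "inv\<^bsub>G\<^esub> v \<in> fin_supp" "inv\<^bsub>G\<^esub> v \<otimes>\<^bsub>G\<^esub> v = \<one>\<^bsub>G\<^esub>"
    using vw(1) subgroup.m_inv_closed[OF subgroup_fin_supp] subgroup.mem_carrier[OF subgroup_fin_supp] by auto
  then show "\<exists>h\<in>carrier dual. h \<otimes>\<^bsub>dual\<^esub> f = \<one>\<^bsub>dual\<^esub>"
    using vw pairing_in_dual pairing_mult_dual pairing_one by metis
  show "\<one>\<^bsub>dual\<^esub> \<otimes>\<^bsub>dual\<^esub> f = f"
    using fg by (intro extensionalityI[of _ "carrier G"]) (auto simp: mult_dual one_dual carrier_dual)
next
  show "\<one>\<^bsub>dual\<^esub> \<in> carrier dual"
    using pairing_in_dual[OF subgroup.one_closed[OF subgroup_fin_supp]] by (simp add: pairing_one)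
qed (auto simp: mult_dual mult.assoc)

lemma fin_supp_countable: "countable fin_supp"
proof -
  have "fin_supp \<subseteq> (\<Union>n. (\<lambda>xs i. if i < n then xs ! i else 0) ` (UNIV :: int list set))"
  proof
    fix v assume "v \<in> fin_supp"
    then have "finite {i. v i \<noteq> 0}" by (simp add: fin_supp_def)
    then obtain n where "{i. v i \<noteq> 0} \<subseteq> {..<n}" using finite_nat_bounded by blast
    then have n: "i < n" if "v i \<noteq> 0" for i using that by auto
    have "v = (\<lambda>i. if i < n then map v [0..<n] ! i else 0)" using n by (auto simp: fun_eq_iff)
    then show "v \<in> (\<Union>n. (\<lambda>xs i. if i < n then xs ! i else 0) ` (UNIV :: int list set))" by blast
  qed
  then show ?thesis by (rule countable_subset) auto
qed

lemma fin_supp_infinite: "infinite fin_supp"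
proof -
  have "inj unit_vec" by (rule injI) (metis unit_vec_def zero_neq_one)
  then have "infinite (range unit_vec)" using finite_imageD by blast
  then show ?thesis using unit_vec by (meson finite_subset image_subsetI)
qed

lemma dual_eqpoll_nat: "carrier dual \<approx> (UNIV :: nat set)"
proof -
  have "fin_supp \<approx> (UNIV :: nat set)"
    using fin_supp_countable fin_supp_infinite by (meson eqpoll_def countableE_infinite)
  then show ?thesis using pairing_bij by (meson eqpoll_def eqpoll_sym eqpoll_trans)
qed

text \<open>A character f is isolated by finitely many subbasic sets: for each root z the set
  \<open>N z\<close> requires g to avoid all other roots on the compact level set of f at z, which
  forces g = z there.\<close>

lemma character_topology_discrete:
  "character_topology G (tau_c p) = discrete_topology (carrier dual)"
proof -
  define \<B> where "\<B> = {{f \<in> carrier dual. f ` K \<subseteq> U} | K U. compactin (tau_c p) K \<and> openin circle_topology U}"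
  have T: "character_topology G (tau_c p) = topology_generated_by \<B>"
    by (simp add: character_topology_def \<B>_def)
  have "carrier dual \<in> \<B>" unfolding \<B>_def by (rule CollectI, rule exI[of _ "{}"], rule exI[of _ "{}"]) auto
  then have ts: "topspace (topology_generated_by \<B>) = carrier dual"
    unfolding topology_generated_by_topspace by (auto simp: \<B>_def)
  have "openin (topology_generated_by \<B>) {f}" if f: "f \<in> carrier dual" for f
  proof -
    let ?R = "{z::complex. z ^ p = 1}"
    obtain v where v: "v \<in> fin_supp" "f = pairing v" using pairing_surj[OF f] .
    define N where "N z = {g \<in> carrier dual. g ` {x \<in> topspace (tau_c p). f x \<in> {z}} \<subseteq> sphere 0 1 - (?R - {z})}" for z
    have "N z \<in> \<B>" if "z \<in> ?R" for z
    proof -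
      have "closedin (tau_c p) {x \<in> topspace (tau_c p). f x \<in> {z}}"
        unfolding v(2) by (rule closedin_continuous_map_preimage[OF pairing_continuous[OF v(1)]]) (use that in auto)
      then have "compactin (tau_c p) {x \<in> topspace (tau_c p). f x \<in> {z}}"
        using compact_tau_c closedin_compact_space by blast
      moreover have "openin circle_topology (sphere 0 1 - (?R - {z}))"
        by (rule openin_circle_finite_complement) (simp add: finite_roots)
      ultimately show ?thesis unfolding \<B>_def N_def by blast
    qed
    then have "openin (topology_generated_by \<B>) (\<Inter>z\<in>?R. N z)"
      using finite_roots p_gt_1 by (intro openin_INT2 topology_generated_by_Basis) (auto intro!: exI[of _ 1])
    moreover have "(\<Inter>z\<in>?R. N z) = {f}"
    proof
      show "(\<Inter>z\<in>?R. N z) \<subseteq> {f}"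
      proof
        fix g assume g: "g \<in> (\<Inter>z\<in>?R. N z)"
        then have "g \<in> N 1" by (rule INT_D) simp
        then have gd: "g \<in> carrier dual" by (simp add: N_def)
        have "g x = f x" if x: "x \<in> carrier G" for x
        proof -
          have "f x \<in> ?R" "g x \<in> ?R"
            using G.is_char_pow_p[OF dual_is_char[OF f] x] G.is_char_pow_p[OF dual_is_char[OF gd] x] by auto
          then show ?thesis using g x by (auto simp: N_def)
        qed
        then have "g = f" using f gd by (intro extensionalityI[of g "carrier G"]) (auto simp: carrier_dual)
        then show "g \<in> {f}" by simp
      qed
      show "{f} \<subseteq> (\<Inter>z\<in>?R. N z)" using f by (auto simp: N_def carrier_dual)
    qed
    ultimately show ?thesis by simp
  qed
  then show ?thesis unfolding T using ts discrete_topology_unique by (metis (no_types, lifting))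
qed


subsection \<open>The algebraic isomorphisms\<close>

definition evens :: "(nat \<Rightarrow> int) \<Rightarrow> nat \<Rightarrow> int" where "evens x = (\<lambda>n. x (2 * n))"
definition odds :: "(nat \<Rightarrow> int) \<Rightarrow> nat \<Rightarrow> int" where "odds x = (\<lambda>n. x (2 * n + 1))"
definition interleave :: "(nat \<Rightarrow> int) \<Rightarrow> (nat \<Rightarrow> int) \<Rightarrow> nat \<Rightarrow> int" where
  "interleave a b = (\<lambda>n. if even n then a (n div 2) else b (n div 2))"

lemma evens_interleave: "evens (interleave a b) = a" "odds (interleave a b) = b"
  by (auto simp: evens_def odds_def interleave_def)

lemma evens_odds_eqD: "evens x = evens y \<Longrightarrow> odds x = odds y \<Longrightarrow> x = y"
proof
  fix n assume "evens x = evens y" "odds x = odds y"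
  then have "x (2 * k) = y (2 * k)" "x (2 * k + 1) = y (2 * k + 1)" for k
    unfolding evens_def odds_def by meson+
  then show "x n = y n" by (cases "even n") (auto elim!: evenE oddE)
qed

lemma evens_mult: "evens (x \<otimes>\<^bsub>G\<^esub> y) = evens x \<otimes>\<^bsub>G\<^esub> evens y" "odds (x \<otimes>\<^bsub>G\<^esub> y) = odds x \<otimes>\<^bsub>G\<^esub> odds y"
  by (auto simp: evens_def odds_def mult_G)

lemma evens_closed: "x \<in> carrier G \<Longrightarrow> evens x \<in> carrier G" "x \<in> carrier G \<Longrightarrow> odds x \<in> carrier G"
  by (auto simp: evens_def odds_def carrier_G)

lemma interleave_closed: "a \<in> carrier G \<Longrightarrow> b \<in> carrier G \<Longrightarrow> interleave a b \<in> carrier G"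
  by (auto simp: interleave_def carrier_G)

lemma evens_fin_supp: "x \<in> fin_supp \<Longrightarrow> evens x \<in> fin_supp" "x \<in> fin_supp \<Longrightarrow> odds x \<in> fin_supp"
proof -
  assume x: "x \<in> fin_supp"
  then have f: "finite {i. x i \<noteq> 0}" by (simp add: fin_supp_def)
  have "finite ((\<lambda>n. 2 * n) -` {i. x i \<noteq> 0})"
    by (rule finite_vimageI[OF f]) (auto intro: injI)
  moreover have "finite ((\<lambda>n. 2 * n + 1) -` {i. x i \<noteq> 0})"
    by (rule finite_vimageI[OF f]) (auto intro: injI)
  ultimately show "evens x \<in> fin_supp" "odds x \<in> fin_supp"
    using x evens_closed by (auto simp: fin_supp_def evens_def odds_def vimage_def)
qed

lemma interleave_fin_supp: "a \<in> fin_supp \<Longrightarrow> b \<in> fin_supp \<Longrightarrow> interleave a b \<in> fin_supp"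
proof -
  assume ab: "a \<in> fin_supp" "b \<in> fin_supp"
  have "{i. interleave a b i \<noteq> 0} \<subseteq> (\<lambda>n. 2 * n) ` {i. a i \<noteq> 0} \<union> (\<lambda>n. 2 * n + 1) ` {i. b i \<noteq> 0}"
  proof
    fix i assume "i \<in> {i. interleave a b i \<noteq> 0}"
    moreover have "i = 2 * (i div 2) \<or> i = 2 * (i div 2) + 1" by presburger
    ultimately show "i \<in> (\<lambda>n. 2 * n) ` {i. a i \<noteq> 0} \<union> (\<lambda>n. 2 * n + 1) ` {i. b i \<noteq> 0}"
      by (cases "even i") (auto simp: interleave_def image_iff intro: exI[of _ "i div 2"])
  qed
  then have "finite {i. interleave a b i \<noteq> 0}"
    by (rule finite_subset) (use ab in \<open>auto simp: fin_supp_def\<close>)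
  then show ?thesis using ab interleave_closed by (auto simp: fin_supp_def)
qed

lemma iso_prod_group_1: "G \<cong> prod_group_1 p"
proof -
  have "(\<lambda>x. (evens x, odds x)) \<in> iso G (prod_group_1 p)"
  proof (rule isoI)
    show "(\<lambda>x. (evens x, odds x)) \<in> hom G (prod_group_1 p)"
      by (auto simp: hom_def prod_group_1_def evens_mult evens_closed)
    show "bij_betw (\<lambda>x. (evens x, odds x)) (carrier G) (carrier (prod_group_1 p))"
    proof (rule bij_betwI')
      show "\<exists>x\<in>carrier G. y = (evens x, odds x)" if "y \<in> carrier (prod_group_1 p)" for y
        using that interleave_closed evens_interleave by (auto simp: prod_group_1_def intro!: bexI[of _ "interleave (fst y) (snd y)"])
    qed (auto simp: prod_group_1_def evens_closed dest: evens_odds_eqD)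
  qed
  then show ?thesis by (auto simp: is_iso_def)
qed

text \<open>A complement of the finitely supported part is left alone, and the finitely supported part
  is split into its even and odd coordinates, the latter becoming the dual factor.\<close>

lemma iso_prod_group_0: "G \<cong> prod_group_0 p"
proof -
  have "{\<one>\<^bsub>G\<^esub>} \<inter> fin_supp = {\<one>\<^bsub>G\<^esub>}" using subgroup.one_closed[OF subgroup_fin_supp] by blast
  then obtain N where N: "subgroup N G" "N \<inter> fin_supp = {\<one>\<^bsub>G\<^esub>}" "N <#>\<^bsub>G\<^esub> fin_supp = carrier G"
    using G.complement_extend[OF G.triv_subgroup subgroup_fin_supp] by metis
  note uni = G.complement_unique[OF N(1) subgroup_fin_supp N(2)]
  have Nc: "n \<in> carrier G" if "n \<in> N" for n using that subgroup.mem_carrier[OF N(1)] by blast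
  have Wc: "w \<in> carrier G" if "w \<in> fin_supp" for w using that subgroup.mem_carrier[OF subgroup_fin_supp] by blast
  have swap: "(a \<otimes>\<^bsub>G\<^esub> b) \<otimes>\<^bsub>G\<^esub> (c \<otimes>\<^bsub>G\<^esub> d) = (a \<otimes>\<^bsub>G\<^esub> c) \<otimes>\<^bsub>G\<^esub> (b \<otimes>\<^bsub>G\<^esub> d)"
    if "a \<in> carrier G" "b \<in> carrier G" "c \<in> carrier G" "d \<in> carrier G" for a b c d
    using that by (simp add: G.m_ac)
  have dec: "\<exists>n w. n \<in> N \<and> w \<in> fin_supp \<and> x = n \<otimes>\<^bsub>G\<^esub> w" if "x \<in> carrier G" for x
    using that N(3) unfolding set_mult_def by blast
  then obtain n w where nw: "\<And>x. x \<in> carrier G \<Longrightarrow> n x \<in> N \<and> w x \<in> fin_supp \<and> x = n x \<otimes>\<^bsub>G\<^esub> w x" by metis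
  have nw_eq: "n (a \<otimes>\<^bsub>G\<^esub> b) = a \<and> w (a \<otimes>\<^bsub>G\<^esub> b) = b" if "a \<in> N" "b \<in> fin_supp" for a b
  proof -
    have "a \<otimes>\<^bsub>G\<^esub> b \<in> carrier G" using that Nc Wc by auto
    note * = nw[OF this]
    show ?thesis using uni[of "n (a \<otimes>\<^bsub>G\<^esub> b)" a "w (a \<otimes>\<^bsub>G\<^esub> b)" b] * that by metis
  qed
  have nw_mult: "n (x \<otimes>\<^bsub>G\<^esub> y) = n x \<otimes>\<^bsub>G\<^esub> n y \<and> w (x \<otimes>\<^bsub>G\<^esub> y) = w x \<otimes>\<^bsub>G\<^esub> w y"
    if "x \<in> carrier G" "y \<in> carrier G" for x y
  proof -
    note X = nw[OF that(1)] and Y = nw[OF that(2)]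
    have "x \<otimes>\<^bsub>G\<^esub> y = (n x \<otimes>\<^bsub>G\<^esub> w x) \<otimes>\<^bsub>G\<^esub> (n y \<otimes>\<^bsub>G\<^esub> w y)" using X Y by metis
    also have "\<dots> = (n x \<otimes>\<^bsub>G\<^esub> n y) \<otimes>\<^bsub>G\<^esub> (w x \<otimes>\<^bsub>G\<^esub> w y)"
      using X Y Nc Wc by (intro swap) auto
    finally show ?thesis
      using nw_eq[of "n x \<otimes>\<^bsub>G\<^esub> n y" "w x \<otimes>\<^bsub>G\<^esub> w y"] X Y subgroup.m_closed[OF N(1)] subgroup.m_closed[OF subgroup_fin_supp]
      by simp
  qed
  define \<psi> where "\<psi> x = (n x \<otimes>\<^bsub>G\<^esub> evens (w x), pairing (odds (w x)))" for x
  have c: "carrier (prod_group_0 p) = carrier G \<times> carrier dual" by (simp add: prod_group_0_def)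
  have "\<psi> \<in> iso G (prod_group_0 p)"
  proof (rule isoI)
    show "\<psi> \<in> hom G (prod_group_0 p)"
    proof (rule homI)
      fix x assume "x \<in> carrier G"
      then show "\<psi> x \<in> carrier (prod_group_0 p)"
        unfolding c \<psi>_def using nw[of x] Nc Wc evens_fin_supp[of "w x"] pairing_in_dual by auto
    next
      fix x y assume xy: "x \<in> carrier G" "y \<in> carrier G"
      note X = nw[OF xy(1)] and Y = nw[OF xy(2)]
      have "(n x \<otimes>\<^bsub>G\<^esub> n y) \<otimes>\<^bsub>G\<^esub> (evens (w x) \<otimes>\<^bsub>G\<^esub> evens (w y))
          = (n x \<otimes>\<^bsub>G\<^esub> evens (w x)) \<otimes>\<^bsub>G\<^esub> (n y \<otimes>\<^bsub>G\<^esub> evens (w y))"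
        using X Y Nc Wc evens_closed by (intro swap) auto
      then show "\<psi> (x \<otimes>\<^bsub>G\<^esub> y) = \<psi> x \<otimes>\<^bsub>prod_group_0 p\<^esub> \<psi> y"
        unfolding \<psi>_def prod_group_0_def using nw_mult[OF xy] X Y
        by (simp add: evens_mult pairing_mult_dual evens_fin_supp)
    qed
    show "bij_betw \<psi> (carrier G) (carrier (prod_group_0 p))"
    proof (rule bij_betw_imageI)
      show "inj_on \<psi> (carrier G)"
      proof (rule inj_onI)
        fix x y assume xy: "x \<in> carrier G" "y \<in> carrier G" and eq: "\<psi> x = \<psi> y"
        note X = nw[OF xy(1)] and Y = nw[OF xy(2)]
        have "n x = n y \<and> evens (w x) = evens (w y)"
          by (rule uni) (use X Y eq evens_fin_supp in \<open>auto simp: \<psi>_def\<close>)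
        moreover have "odds (w x) = odds (w y)"
        proof (rule inj_onD[OF pairing_inj])
          show "pairing (odds (w x)) = pairing (odds (w y))" using eq by (simp add: \<psi>_def)
        qed (use X Y evens_fin_supp in blast)+
        ultimately have "n x = n y" "w x = w y" using evens_odds_eqD by blast+
        then show "x = y" using X Y by metis
      qed
      show "\<psi> ` carrier G = carrier (prod_group_0 p)"
      proof
        show "\<psi> ` carrier G \<subseteq> carrier (prod_group_0 p)"
          using \<open>\<psi> \<in> hom G (prod_group_0 p)\<close> by (auto simp: hom_def)
        show "carrier (prod_group_0 p) \<subseteq> \<psi> ` carrier G"
        proof
          fix z assume "z \<in> carrier (prod_group_0 p)"
          then obtain y f where z: "z = (y, f)" "y \<in> carrier G" "f \<in> carrier dual" unfolding c by blast
          obtain v where v: "v \<in> fin_supp" "f = pairing v" using pairing_surj[OF z(3)] .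
          note Y = nw[OF z(2)]
          let ?x = "n y \<otimes>\<^bsub>G\<^esub> interleave (w y) v"
          have i: "interleave (w y) v \<in> fin_supp" using interleave_fin_supp Y v by blast
          have "\<psi> ?x = z"
            using nw_eq[of "n y" "interleave (w y) v"] Y i v z by (simp add: \<psi>_def evens_interleave)
          moreover have "?x \<in> carrier G" using Y i Nc Wc by auto
          ultimately show "z \<in> \<psi> ` carrier G" by blast
        qed
      qed
    qed
  qed
  then show ?thesis by (auto simp: is_iso_def)
qed

subsection \<open>Locally compact topologies\<close>

lemma homeomorphic_space_eqpoll:
  "X homeomorphic_space Y \<Longrightarrow> topspace X \<approx> topspace Y"
  unfolding homeomorphic_space eqpoll_def
  by (metis bij_betw_def homeomorphic_imp_injective_map homeomorphic_imp_surjective_map)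

text \<open>For uncountable B the hypothesis gives \<open>carrier G \<lesssim> B\<close>, while the
  power has at least as many points as \<open>Pow B\<close>; Cantor's theorem forbids this.\<close>

lemma countable_power_index:
  assumes CH: continuum_hypothesis
    and B: "topspace (product_topology (\<lambda>_. discrete_topology {z::complex. z ^ p = 1}) B) \<lesssim> carrier G"
  shows "countable B"
proof (rule ccontr)
  assume "uncountable B"
  then have "(UNIV :: nat set set) \<lesssim> B" by (rule continuum_hypothesis_uncountable[OF CH])
  then have "carrier G \<lesssim> B" using carrier_G_eqpoll lepoll_trans1 by blast
  moreover have "Pow B \<lesssim> (\<Pi>\<^sub>E i\<in>B. {z::complex. z ^ p = 1})"
  proof -
    let ?f = "\<lambda>S. \<lambda>i\<in>B. if i \<in> S then unit_root else 1"
    have "inj_on ?f (Pow B)"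
    proof (rule inj_onI)
      fix S T assume ST: "S \<in> Pow B" "T \<in> Pow B" "?f S = ?f T"
      have "i \<in> S \<longleftrightarrow> i \<in> T" if "i \<in> B" for i
        using fun_cong[OF ST(3), of i] that unit_root(2) by (auto split: if_splits)
      then show "S = T" using ST by blast
    qed
    moreover have "?f ` Pow B \<subseteq> (\<Pi>\<^sub>E i\<in>B. {z::complex. z ^ p = 1})" using unit_root by auto
    ultimately show ?thesis unfolding lepoll_def by blast
  qed
  ultimately have "Pow B \<lesssim> B" using B by (simp add: topspace_product_topology) (meson lepoll_trans)
  then show False using lesspoll_Pow_self[of B] lepoll_Pow_self[of B] by (meson lepoll_antisym lesspoll_def)
qed

lemma power_homeomorphic_tau_c:
  assumes "countable B" "infinite B"
  shows "product_topology (\<lambda>_. discrete_topology {z::complex. z ^ p = 1}) B homeomorphic_space tau_c p"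
proof -
  have "B \<approx> (UNIV :: nat set)" using assms by (meson eqpoll_def countableE_infinite)
  then show ?thesis unfolding tau_c_eq using homeomorphic_space_product_discrete roots_eqpoll by blast
qed

lemma finite_power:
  "finite B \<Longrightarrow> finite (topspace (product_topology (\<lambda>_. discrete_topology {z::complex. z ^ p = 1}) B))"
  using finite_roots by (auto intro!: finite_PiE)

lemma locally_compact_cases:
  assumes CH: continuum_hypothesis and T: "hausdorff_group_topology G \<tau>" and lc: "locally_compact_space \<tau>"
  shows "\<tau> = tau_d p \<or> \<tau> homeomorphic_space tau_c p \<or>
    (\<exists>D. D \<subseteq> carrier G \<and> infinite D \<and> \<tau> homeomorphic_space prod_topology (tau_c p) (discrete_topology D))"
proof -
  interpret T: hausdorff_exponent_group G p \<tau>
    using T by unfold_locales (auto simp: hausdorff_group_topology_def)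
  show ?thesis
  proof (cases "compact_space \<tau>")
    case True
    then obtain B :: "((nat \<Rightarrow> int) \<Rightarrow> complex) set"
      where B: "\<tau> homeomorphic_space product_topology (\<lambda>_. discrete_topology {z::complex. z ^ p = 1}) B"
      using T.compact_homeomorphic_power by blast
    note e = homeomorphic_space_eqpoll[OF B]
    have "countable B" using countable_power_index[OF CH] e by (metis T.topspace eqpoll_imp_lepoll eqpoll_sym)
    moreover have "infinite B"
    proof
      assume "finite B"
      then have "finite (carrier G)" using finite_power e by (metis T.topspace eqpoll_finite_iff)
      then show False using uncountable_G countable_finite by blast
    qed
    ultimately show ?thesis using power_homeomorphic_tau_c B homeomorphic_space_trans by blast
  next
    case False
    obtain K where K: "subgroup K G" "openin \<tau> K" "compactin \<tau> K" using T.ex_compact_open_subgroup[OF lc] .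
    interpret K: hausdorff_exponent_group "G\<lparr>carrier := K\<rparr>" p "subtopology \<tau> K"
      using T.subgroup_hausdorff_exponent_group[OF K(1)] .
    have Kc: "K \<subseteq> carrier G" using K(1) subgroup.subset by blast
    have "compact_space (subtopology \<tau> K)" using K(3) compactin_subspace by blast
    then obtain B :: "((nat \<Rightarrow> int) \<Rightarrow> complex) set"
      where B: "subtopology \<tau> K homeomorphic_space product_topology (\<lambda>_. discrete_topology {z::complex. z ^ p = 1}) B"
      using K.compact_homeomorphic_power by blast
    have e: "K \<approx> topspace (product_topology (\<lambda>_. discrete_topology {z::complex. z ^ p = 1}) B)"
      using homeomorphic_space_eqpoll[OF B] Kc by (simp add: Int_absorb1)
    have cB: "countable B"
      by (rule countable_power_index[OF CH lepoll_trans1[OF eqpoll_sym[OF e] subset_imp_lepoll[OF Kc]]])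
    show ?thesis
    proof (cases "finite B")
      case True
      \<comment> \<open>With K finite and open the singleton of \<open>\<one>\<close> is open, and
        by translation the topology is discrete.\<close>
      then have "finite K" using finite_power e eqpoll_finite_iff by blast
      then have "closedin \<tau> (K - {\<one>\<^bsub>G\<^esub>})"
        using T.Hausdorff Kc by (intro closedin_Hausdorff_finite) auto
      then have "openin \<tau> (K - (K - {\<one>\<^bsub>G\<^esub>}))" using K(2) by blast
      moreover have "K - (K - {\<one>\<^bsub>G\<^esub>}) = {\<one>\<^bsub>G\<^esub>}" using subgroup.one_closed[OF K(1)] by blast
      ultimately have "openin \<tau> {\<one>\<^bsub>G\<^esub>}" by simp
      then have "openin \<tau> {x}" if "x \<in> carrier G" for x
        using T.openin_translate[of "{\<one>\<^bsub>G\<^esub>}" x] that by simp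
      then have "\<tau> = tau_d p" unfolding tau_d_def using T.topspace discrete_topology_unique by metis
      then show ?thesis by blast
    next
      case inf: False
      have Kt: "subtopology \<tau> K homeomorphic_space tau_c p"
        using power_homeomorphic_tau_c[OF cB inf] B homeomorphic_space_trans by blast
      obtain D where D: "D \<subseteq> carrier G" "\<tau> homeomorphic_space prod_topology (subtopology \<tau> K) (discrete_topology D)"
        using T.open_subgroup_homeomorphic_prod[OF K(1,2)] .
      have P: "\<tau> homeomorphic_space prod_topology (tau_c p) (discrete_topology D)"
        using D(2) Kt by (meson homeomorphic_space_prod_topology homeomorphic_space_refl homeomorphic_space_trans)
      \<comment> \<open>Finitely many compact cosets would make the whole space compact, contrary to
        the present case.\<close>
      moreover have "infinite D"
      proof
        assume "finite D"
        then have "compact_space (prod_topology (tau_c p) (discrete_topology D))"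
          using compact_tau_c by (simp add: compact_space_prod_topology compact_space_discrete_topology)
        then show False using False P homeomorphic_compact_space by blast
      qed
      ultimately show ?thesis using D(1) by blast
    qed
  qed
qed

section \<open>The topologies \<open>tau_0\<close> and \<open>tau_1\<close>\<close>

lemma pullback_homeomorphic:
  assumes "\<phi> \<in> iso G H" "topspace T = carrier H"
  shows "pullback_topology (carrier G) \<phi> T homeomorphic_space T"
  using homeomorphic_map_pullback_topology[of \<phi> "carrier G" T] assms
  by (auto simp: iso_def intro: homeomorphic_map_imp_homeomorphic_space)

lemma hausdorff_pullback:
  assumes "group H" "\<phi> \<in> iso G H" "hausdorff_group_topology H T"
  shows "hausdorff_group_topology G (pullback_topology (carrier G) \<phi> T)"
proof -
  have T: "group_topology H T" "Hausdorff_space T" using assms(3) by (auto simp: hausdorff_group_topology_def)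
  then have "Hausdorff_space (pullback_topology (carrier G) \<phi> T)"
    using pullback_homeomorphic[OF assms(2)] homeomorphic_Hausdorff_space by (metis group_topology_def)
  then show ?thesis
    using group_topology_pullback[OF group_G assms(1,2) T(1)] by (simp add: hausdorff_group_topology_def)
qed

lemma hausdorff_DirProd_discrete:
  assumes "group H"
  shows "hausdorff_group_topology (G \<times>\<times> H) (prod_topology (tau_c p) (discrete_topology (carrier H)))"
  using group_topology_DirProd[OF group_G assms _ group_topology_discrete[OF assms], of "tau_c p"] hausdorff_tau_c
  by (auto simp: hausdorff_group_topology_def Hausdorff_space_prod_topology)

lemma
  assumes "\<phi> \<in> iso G (prod_group_0 p)"
  shows tau_0_homeomorphic: "tau_0 p \<phi> homeomorphic_space prod_topology (tau_c p) (discrete_topology (carrier dual))"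
    and hausdorff_tau_0: "hausdorff_group_topology G (tau_0 p \<phi>)"
proof -
  show "tau_0 p \<phi> homeomorphic_space prod_topology (tau_c p) (discrete_topology (carrier dual))"
    unfolding tau_0_def character_topology_discrete
    by (rule pullback_homeomorphic[OF assms]) (simp add: prod_group_0_def)
  show "hausdorff_group_topology G (tau_0 p \<phi>)"
    unfolding tau_0_def character_topology_discrete
    by (rule hausdorff_pullback[OF _ assms])
       (auto simp: prod_group_0_def hausdorff_DirProd_discrete group_dual group_G intro: DirProd_group)
qed

lemma
  assumes "\<psi> \<in> iso G (prod_group_1 p)"
  shows tau_1_homeomorphic: "tau_1 p \<psi> homeomorphic_space prod_topology (tau_c p) (discrete_topology (carrier G))"
    and hausdorff_tau_1: "hausdorff_group_topology G (tau_1 p \<psi>)"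
proof -
  show "tau_1 p \<psi> homeomorphic_space prod_topology (tau_c p) (discrete_topology (carrier G))"
    unfolding tau_1_def tau_d_def
    by (rule pullback_homeomorphic[OF assms]) (simp add: prod_group_1_def)
  show "hausdorff_group_topology G (tau_1 p \<psi>)"
    unfolding tau_1_def tau_d_def
    by (rule hausdorff_pullback[OF _ assms])
       (auto simp: prod_group_1_def hausdorff_DirProd_discrete group_G intro: DirProd_group)
qed

section \<open>Telling the four topologies apart\<close>

lemma infinite_G: "infinite (carrier G)"
  using uncountable_G countable_finite by blast

lemma locally_compact_prod: "locally_compact_space (prod_topology (tau_c p) (discrete_topology D))"
  using compact_tau_c by (simp add: locally_compact_space_prod_topology locally_compact_space_discrete_topology compact_imp_locally_compact_space)

lemma not_compact_prod:
  assumes "infinite D"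
  shows "\<not> compact_space (prod_topology (tau_c p) (discrete_topology D))"
proof -
  have "prod_topology (tau_c p) (discrete_topology D) \<noteq> trivial_topology"
    unfolding null_topspace_iff_trivial[symmetric] topspace_prod_topology using assms infinite_G by auto
  then show ?thesis using assms by (simp add: compact_space_prod_topology compact_space_discrete_topology)
qed

lemma not_compact_tau_d: "\<not> compact_space (tau_d p)"
  by (simp add: tau_d_def compact_space_discrete_topology infinite_G)

text \<open>Otherwise the points of the slice over one d would be open, making
  \<open>tau_c p\<close> discrete, although it is compact and infinite.\<close>

lemma tau_d_not_homeomorphic_prod:
  assumes "D \<noteq> {}"
  shows "\<not> tau_d p homeomorphic_space prod_topology (tau_c p) (discrete_topology D)"
proof
  assume "tau_d p homeomorphic_space prod_topology (tau_c p) (discrete_topology D)"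
  then obtain f where f: "homeomorphic_map (tau_d p) (prod_topology (tau_c p) (discrete_topology D)) f"
    unfolding homeomorphic_space by blast
  obtain d where d: "d \<in> D" using assms by blast
  have "openin (tau_c p) {x}" if x: "x \<in> carrier G" for x
  proof -
    obtain y where y: "y \<in> carrier G" "f y = (x, d)"
      using homeomorphic_imp_surjective_map[OF f] x d by (metis (no_types, lifting) SigmaI imageE topspace_discrete_topology topspace_prod_topology topspace_tau_c topspace_tau_d)
    have "openin (prod_topology (tau_c p) (discrete_topology D)) (f ` {y})"
      by (rule homeomorphic_imp_open_map[OF f, unfolded open_map_def, rule_format]) (use y in \<open>simp add: tau_d_def\<close>)
    then have "openin (prod_topology (tau_c p) (discrete_topology D)) ({x} \<times> {d})" using y by simp
    then show ?thesis unfolding openin_prod_Times_iff by auto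
  qed
  then have "tau_c p = tau_d p" unfolding tau_d_def using topspace_tau_c discrete_topology_unique by metis
  then show False using compact_tau_c not_compact_tau_d by simp
qed

text \<open>Each slice over d in D is compact, so its projection to the discrete space E is finite;
  countably many slices cannot cover E.\<close>

lemma countable_uncountable_not_homeomorphic:
  assumes D: "countable D" and E: "uncountable E"
  shows "\<not> prod_topology (tau_c p) (discrete_topology D) homeomorphic_space prod_topology (tau_c p) (discrete_topology E)"
proof
  let ?P = "prod_topology (tau_c p) (discrete_topology D)" and ?Q = "prod_topology (tau_c p) (discrete_topology E)"
  assume "?P homeomorphic_space ?Q"
  then obtain f where f: "homeomorphic_map ?P ?Q f" unfolding homeomorphic_space by blast
  have cont: "continuous_map ?P (discrete_topology E) (\<lambda>x. snd (f x))"
    by (rule continuous_map_comp2[OF homeomorphic_imp_continuous_map[OF f] continuous_map_snd])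
  have "countable ((\<lambda>x. snd (f x)) ` (carrier G \<times> {d}))" if "d \<in> D" for d
  proof -
    have "compactin ?P (carrier G \<times> {d})"
      using compact_tau_c that by (simp add: compactin_Times compact_space_def)
    then have "compactin (discrete_topology E) ((\<lambda>x. snd (f x)) ` (carrier G \<times> {d}))"
      using image_compactin cont by blast
    then show ?thesis by (simp add: compactin_discrete_topology countable_finite)
  qed
  then have "countable (\<Union>d\<in>D. (\<lambda>x. snd (f x)) ` (carrier G \<times> {d}))" using D by blast
  moreover have "E \<subseteq> (\<Union>d\<in>D. (\<lambda>x. snd (f x)) ` (carrier G \<times> {d}))"
  proof
    fix e assume e: "e \<in> E"
    have "(\<one>\<^bsub>G\<^esub>, e) \<in> f ` topspace ?P" using homeomorphic_imp_surjective_map[OF f] e by simp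
    then obtain x d where "x \<in> carrier G" "d \<in> D" "f (x, d) = (\<one>\<^bsub>G\<^esub>, e)" by auto
    then show "e \<in> (\<Union>d\<in>D. (\<lambda>x. snd (f x)) ` (carrier G \<times> {d}))" by force
  qed
  ultimately show False using E countable_subset by blast
qed

theorem locally_compact_group_topologies:
  assumes CH: continuum_hypothesis
    and \<phi>: "\<phi> \<in> iso G (prod_group_0 p)" and \<psi>: "\<psi> \<in> iso G (prod_group_1 p)"
  shows "(\<forall>\<tau> \<in> {tau_c p, tau_d p, tau_0 p \<phi>, tau_1 p \<psi>}.
            hausdorff_group_topology G \<tau> \<and> locally_compact_space \<tau>) \<and>
         (\<forall>\<tau>. hausdorff_group_topology G \<tau> \<and> locally_compact_space \<tau> \<longrightarrow>
            (\<exists>\<sigma> \<in> {tau_c p, tau_d p, tau_0 p \<phi>, tau_1 p \<psi>}. \<tau> homeomorphic_space \<sigma>)) \<and>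
         sorted_wrt (\<lambda>\<sigma> \<tau>. \<not> \<sigma> homeomorphic_space \<tau>) [tau_c p, tau_d p, tau_0 p \<phi>, tau_1 p \<psi>] \<and>
         compact_space (tau_c p) \<and> \<not> compact_space (tau_d p) \<and>
         \<not> compact_space (tau_0 p \<phi>) \<and> \<not> compact_space (tau_1 p \<psi>)"
proof -
  note h0 = tau_0_homeomorphic[OF \<phi>] and h1 = tau_1_homeomorphic[OF \<psi>]
  have dual_inf: "infinite (carrier dual)" and dual_cnt: "countable (carrier dual)"
    using dual_eqpoll_nat eqpoll_finite_iff[OF dual_eqpoll_nat] countable_eqpoll[OF _ dual_eqpoll_nat] by auto
  have n0: "\<not> compact_space (tau_0 p \<phi>)" and n1: "\<not> compact_space (tau_1 p \<psi>)"
    using homeomorphic_compact_space[OF h0] homeomorphic_compact_space[OF h1]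
      not_compact_prod[OF dual_inf] not_compact_prod[OF infinite_G] by blast+
  have l0: "locally_compact_space (tau_0 p \<phi>)" and l1: "locally_compact_space (tau_1 p \<psi>)"
    using homeomorphic_locally_compact_space[OF h0] homeomorphic_locally_compact_space[OF h1] locally_compact_prod by auto
  have ld: "locally_compact_space (tau_d p)" by (simp add: tau_d_def locally_compact_space_discrete_topology)
  have lc: "locally_compact_space (tau_c p)" using compact_tau_c compact_imp_locally_compact_space by blast
  have "\<exists>\<sigma> \<in> {tau_c p, tau_d p, tau_0 p \<phi>, tau_1 p \<psi>}. \<tau> homeomorphic_space \<sigma>"
    if \<tau>: "hausdorff_group_topology G \<tau>" "locally_compact_space \<tau>" for \<tau>
    using locally_compact_cases[OF CH \<tau>]
  proof (elim disjE exE conjE)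
    fix D assume D: "D \<subseteq> carrier G" "infinite D"
      and h: "\<tau> homeomorphic_space prod_topology (tau_c p) (discrete_topology D)"
    have go: "\<tau> homeomorphic_space prod_topology (tau_c p) (discrete_topology E)" if "D \<approx> E" for E :: "'x set"
      using h homeomorphic_space_discrete[OF that]
      by (meson homeomorphic_space_prod_topology homeomorphic_space_refl homeomorphic_space_trans)
    show ?thesis
    proof (cases "countable D")
      case True
      then have "D \<approx> (UNIV :: nat set)" using D by (meson eqpoll_def countableE_infinite)
      then have "D \<approx> carrier dual" using dual_eqpoll_nat eqpoll_sym eqpoll_trans by blast
      then have "\<tau> homeomorphic_space tau_0 p \<phi>" using go h0 homeomorphic_space_sym homeomorphic_space_trans by blast
      then show ?thesis by blast
    next
      case False
      then have "carrier G \<lesssim> D"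
        using continuum_hypothesis_uncountable[OF CH] carrier_G_eqpoll lepoll_trans1 by blast
      then have "D \<approx> carrier G" using D(1) by (simp add: lepoll_antisym subset_imp_lepoll)
      then have "\<tau> homeomorphic_space tau_1 p \<psi>" using go h1 homeomorphic_space_sym homeomorphic_space_trans by blast
      then show ?thesis by blast
    qed
  qed auto
  moreover have "\<not> tau_c p homeomorphic_space \<tau>" if "\<not> compact_space \<tau>" for \<tau> :: "(nat \<Rightarrow> int) topology"
    using that compact_tau_c homeomorphic_compact_space by blast
  moreover have "\<not> tau_d p homeomorphic_space tau_0 p \<phi>"
    using tau_d_not_homeomorphic_prod[of "carrier dual"] h0 dual_inf homeomorphic_space_trans by fastforce
  moreover have "\<not> tau_d p homeomorphic_space tau_1 p \<psi>"
    using tau_d_not_homeomorphic_prod[of "carrier G"] h1 infinite_G homeomorphic_space_trans by fastforce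
  moreover have "\<not> tau_0 p \<phi> homeomorphic_space tau_1 p \<psi>"
    using countable_uncountable_not_homeomorphic[OF dual_cnt uncountable_G] h0 h1
    by (meson homeomorphic_space_sym homeomorphic_space_trans)
  ultimately show ?thesis
    using n0 n1 l0 l1 ld lc not_compact_tau_d compact_tau_c hausdorff_tau_0[OF \<phi>] hausdorff_tau_1[OF \<psi>] hausdorff_tau_c hausdorff_tau_d
    by auto
qed

end

subsection \<open>Topologies induced by characters\<close>

context prime_exponent_group
begin

definition initial_topology :: "('a \<Rightarrow> complex) set \<Rightarrow> 'a topology" where
  "initial_topology F = pullback_topology (carrier G) (\<lambda>x. \<lambda>f\<in>F. f x)
     (product_topology (\<lambda>_. discrete_topology {z. z ^ p = 1}) F)"

context
  fixes F :: "('a \<Rightarrow> complex) set"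
  assumes F: "\<And>f. f \<in> F \<Longrightarrow> is_char (carrier G) f"
begin

lemma topspace_initial_topology: "topspace (initial_topology F) = carrier G"
  unfolding initial_topology_def topspace_pullback_topology using is_char_pow_p[OF F] by auto

lemma continuous_map_into_initial:
  assumes "h \<in> topspace X \<rightarrow> carrier G"
    and "\<And>f. f \<in> F \<Longrightarrow> continuous_map X (discrete_topology {z. z ^ p = 1}) (\<lambda>x. f (h x))"
  shows "continuous_map X (initial_topology F) h"
  unfolding initial_topology_def
proof (rule continuous_map_pullback')
  show "continuous_map X (product_topology (\<lambda>_. discrete_topology {z. z ^ p = 1}) F) ((\<lambda>x. \<lambda>f\<in>F. f x) \<circ> h)"
    unfolding continuous_map_componentwise using assms(2) by (auto simp: o_def)
qed (use assms(1) in auto)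

lemma continuous_map_initial_char:
  assumes "f \<in> F"
  shows "continuous_map (initial_topology F) (discrete_topology {z. z ^ p = 1}) f"
proof -
  let ?e = "\<lambda>x. \<lambda>f\<in>F. f x"
  have "continuous_map (product_topology (\<lambda>_. discrete_topology {z::complex. z ^ p = 1}) F) (discrete_topology {z. z ^ p = 1}) (\<lambda>x. x f)"
    using assms by (rule continuous_map_product_projection)
  then have "continuous_map (initial_topology F) (discrete_topology {z. z ^ p = 1}) ((\<lambda>x. x f) \<circ> ?e)"
    unfolding initial_topology_def by (rule continuous_map_pullback)
  then show ?thesis using assms by (simp add: o_def)
qed

lemma group_topology_initial: "group_topology G (initial_topology F)"
proof -
  let ?T = "initial_topology F" and ?R = "discrete_topology {z::complex. z ^ p = 1}"
  note ts = topspace_initial_topology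
  have "continuous_map (prod_topology ?T ?T) ?T (\<lambda>(x, y). x \<otimes> y)"
  proof (rule continuous_map_into_initial)
    fix f assume f: "f \<in> F"
    note c = continuous_map_initial_char[OF f]
    have "continuous_map (prod_topology ?T ?T) (prod_topology ?R ?R) (\<lambda>z. (f (fst z), f (snd z)))"
      unfolding continuous_map_paired
      by (intro conjI continuous_map_comp2[OF continuous_map_fst c] continuous_map_comp2[OF continuous_map_snd c])
    moreover have "continuous_map (prod_topology ?R ?R) ?R (\<lambda>(a, b). a * b)"
      by (auto simp: power_mult_distrib simp flip: prod_topology_discrete_topology)
    ultimately have "continuous_map (prod_topology ?T ?T) ?R (\<lambda>z. (\<lambda>(a, b). a * b) (f (fst z), f (snd z)))"
      by (rule continuous_map_comp2)
    then show "continuous_map (prod_topology ?T ?T) ?R (\<lambda>z. f (case z of (x, y) \<Rightarrow> x \<otimes> y))"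
      by (rule continuous_map_eq) (auto simp: ts is_char_mult[OF F[OF f]])
  qed (auto simp: ts)
  moreover have "continuous_map ?T ?T (\<lambda>x. inv x)"
  proof (rule continuous_map_into_initial)
    fix f assume f: "f \<in> F"
    have "continuous_map ?R ?R cnj" by (auto simp flip: complex_cnj_power)
    from continuous_map_comp2[OF continuous_map_initial_char[OF f] this]
    show "continuous_map ?T ?R (\<lambda>x. f (inv x))"
      by (rule continuous_map_eq) (auto simp: ts is_char_inv[OF F[OF f] subgroup_self])
  qed (auto simp: ts)
  ultimately show ?thesis by (simp add: group_topology_def ts)
qed

lemma Hausdorff_initial:
  assumes sep: "\<And>x y. x \<in> carrier G \<Longrightarrow> y \<in> carrier G \<Longrightarrow> (\<And>f. f \<in> F \<Longrightarrow> f x = f y) \<Longrightarrow> x = y"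
  shows "Hausdorff_space (initial_topology F)"
  unfolding Hausdorff_space_def topspace_initial_topology
proof (intro allI impI)
  fix x y assume xy: "x \<in> carrier G \<and> y \<in> carrier G \<and> x \<noteq> y"
  then obtain f where f: "f \<in> F" "f x \<noteq> f y" using sep by meson
  have o: "openin (initial_topology F) {u \<in> topspace (initial_topology F). f u \<in> {f v}}" if "v \<in> carrier G" for v
    by (rule openin_continuous_map_preimage[OF continuous_map_initial_char[OF f(1)]])
       (use that is_char_pow_p[OF F[OF f(1)]] in auto)
  show "\<exists>U V. openin (initial_topology F) U \<and> openin (initial_topology F) V \<and> x \<in> U \<and> y \<in> V \<and> disjnt U V"
    using xy f o[of x] o[of y]
    by (intro exI[of _ "{u \<in> topspace (initial_topology F). f u \<in> {f x}}"] exI[of _ "{u \<in> topspace (initial_topology F). f u \<in> {f y}}"])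
       (auto simp: topspace_initial_topology disjnt_def)
qed

text \<open>Basic neighborhoods restrict finitely many characters only. This is behind total
  boundedness and also behind the recovery of the family from its topology.\<close>

lemma nhd_initial:
  assumes V: "openin (initial_topology F) V" "\<one> \<in> V"
  obtains I where "finite I" "I \<subseteq> F" "{x \<in> carrier G. \<forall>f\<in>I. f x = 1} \<subseteq> V"
proof -
  let ?R = "{z::complex. z ^ p = 1}" and ?e = "\<lambda>x. \<lambda>f\<in>F. f x"
  obtain U where U: "openin (product_topology (\<lambda>_. discrete_topology ?R) F) U" "V = ?e -` U \<inter> carrier G"
    using V(1) unfolding initial_topology_def openin_pullback_topology by blast
  have "?e \<one> \<in> U" using U V by auto
  then obtain W where W: "finite {i \<in> F. W i \<noteq> ?R}" "?e \<one> \<in> Pi\<^sub>E F W" "Pi\<^sub>E F W \<subseteq> U"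
    using U(1) unfolding openin_product_topology_alt topspace_discrete_topology by blast
  have "x \<in> V" if x: "x \<in> carrier G" "\<forall>f\<in>{i \<in> F. W i \<noteq> ?R}. f x = 1" for x
  proof -
    have "f x \<in> W f" if f: "f \<in> F" for f
    proof (cases "W f = ?R")
      case True
      then show ?thesis using is_char_pow_p[OF F[OF f] x(1)] by simp
    next
      case False
      then have "f x = f \<one>" using x(2) f is_char_one[OF F[OF f] subgroup_self] by simp
      then show ?thesis using W(2) f by (metis (no_types, lifting) PiE_mem restrict_apply')
    qed
    then have "?e x \<in> Pi\<^sub>E F W" by auto
    then have "?e x \<in> U" by (rule subsetD[OF W(3)])
    then show ?thesis using U(2) x(1) by simp
  qed
  then have "{x \<in> carrier G. \<forall>f\<in>{i \<in> F. W i \<noteq> ?R}. f x = 1} \<subseteq> V" by blast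
  then show ?thesis using that[of "{i \<in> F. W i \<noteq> ?R}"] W(1) by blast
qed

text \<open>Every neighborhood contains the common kernel of finitely many characters, which has
  finite index.\<close>

lemma totally_bounded_initial: "totally_bounded_topology G (initial_topology F)"
  unfolding totally_bounded_topology_def
proof (intro allI impI)
  fix U assume "U \<subseteq> carrier G \<and> (\<exists>V. openin (initial_topology F) V \<and> \<one> \<in> V \<and> V \<subseteq> U)"
  then obtain V where U: "U \<subseteq> carrier G" and V: "openin (initial_topology F) V" "\<one> \<in> V" "V \<subseteq> U" by blast
  obtain I where I: "finite I" "I \<subseteq> F" "{x \<in> carrier G. \<forall>f\<in>I. f x = 1} \<subseteq> V" using nhd_initial[OF V(1,2)] .
  have Ich: "is_char (carrier G) f" if "f \<in> I" for f using F I(2) that by blast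
  obtain T where T: "finite T" "T \<subseteq> carrier G"
    "carrier G \<subseteq> (\<Union>g\<in>T. (\<lambda>x. g \<otimes> x) ` {x \<in> carrier G. \<forall>f\<in>I. f x = 1})"
    by (rule finite_chars_kernel_index[OF I(1) Ich])
  have "(\<Union>g\<in>insert \<one> T. g <# U) = carrier G"
  proof
    show "(\<Union>g\<in>insert \<one> T. g <# U) \<subseteq> carrier G" using T(2) U by (auto simp: l_coset_def)
    show "carrier G \<subseteq> (\<Union>g\<in>insert \<one> T. g <# U)"
    proof
      fix x assume "x \<in> carrier G"
      then obtain g y where "g \<in> T" "x = g \<otimes> y" "y \<in> U" using T(3) I(3) V(3) by blast
      then show "x \<in> (\<Union>g\<in>insert \<one> T. g <# U)" by (auto simp: l_coset_def)
    qed
  qed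
  then show "\<exists>F. finite F \<and> \<one> \<in> F \<and> F \<subseteq> carrier G \<and> (\<Union>g\<in>F. g <# U) = carrier G"
    using T by (intro exI[of _ "insert \<one> T"]) auto
qed

end
end

subsection \<open>An independent family of characters\<close>

text \<open>Lets a single set of naturals carry a sequence of sets.\<close>

definition column :: "nat set \<Rightarrow> nat \<Rightarrow> nat set" where
  "column r j = {n. prod_encode (j, n) \<in> r}"

text \<open>An independent family in the sense of Hausdorff: \<open>r\<close> encodes finitely many conditions
  "\<open>q\<close> belongs (does not belong) to \<open>X\<close>", listed in the columns of \<open>r\<close>; column 0 holds their number.\<close>

definition indep_family :: "nat set set \<Rightarrow> nat set set" where
  "indep_family X = {r. \<exists>k. column r 0 = {k} \<and> (\<forall>j<k. 0 \<in> column r (2 * j + 1) \<longleftrightarrow> column r (2 * j + 2) \<in> X)}"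

text \<open>For each Y in \<open>\<Y>\<close> choose a set q in exactly one of X and Y and impose
  the condition that q belongs, or does not belong, as X decides; r lists these conditions. X meets
  all of them, while Y fails its own.\<close>

lemma indep_family_avoid:
  assumes "finite \<Y>" "X \<notin> \<Y>"
  obtains r where "r \<in> indep_family X" "\<And>Y. Y \<in> \<Y> \<Longrightarrow> r \<notin> indep_family Y"
proof -
  obtain ys where ys: "set ys = \<Y>" using finite_list[OF assms(1)] by blast
  have "\<exists>q. q \<in> X \<longleftrightarrow> q \<notin> ys ! j" if "j < length ys" for j
  proof -
    have "ys ! j \<noteq> X" using that ys assms(2) nth_mem by metis
    then show ?thesis by auto
  qed
  then obtain q where q: "\<And>j. j < length ys \<Longrightarrow> q j \<in> X \<longleftrightarrow> q j \<notin> ys ! j" by metis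
  \<comment> \<open>Column 0 holds the number of conditions, column 2 j + 2 is the set
    \<open>q j\<close>, and column 2 j + 1 contains 0 exactly if \<open>q j\<close> belongs to
    X.\<close>
  define r where "r = {prod_encode (0, length ys)} \<union> {prod_encode (2 * j + 1, 0) | j. q j \<in> X}
      \<union> {prod_encode (2 * j + 2, n) | j n. n \<in> q j}"
  have c0: "column r 0 = {length ys}" by (auto simp: column_def r_def)
  have c1: "0 \<in> column r (2 * j + 1) \<longleftrightarrow> q j \<in> X" for j
    by (auto simp: column_def r_def) presburger
  have c2: "column r (2 * j + 2) = q j" for j
    by (auto simp: column_def r_def) presburger+
  have "r \<in> indep_family X" unfolding indep_family_def using c0 c1 c2 by simp
  moreover have "r \<notin> indep_family Y" if Y: "Y \<in> \<Y>" for Y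
  proof
    assume "r \<in> indep_family Y"
    then have all: "\<forall>j<length ys. q j \<in> X \<longleftrightarrow> q j \<in> Y" unfolding indep_family_def using c0 c1 c2 by simp
    obtain j where "j < length ys" "ys ! j = Y" using Y ys by (metis in_set_conv_nth)
    then show False using all q by blast
  qed
  ultimately show ?thesis using that by blast
qed

text \<open>Limits along almost disjoint branches serve as coordinates modulo the finitely supported
  sequences.\<close>

definition branch :: "nat set \<Rightarrow> nat \<Rightarrow> nat" where
  "branch r n = prod_encode (n, set_encode (r \<inter> {..<n}))"

text \<open>A node stores its level next to the initial segment, whose code alone does not determine
  the level; branches that differ at i therefore share no node above level i.\<close>

lemma branch_eqD: "branch r n = branch s m \<Longrightarrow> n = m \<and> r \<inter> {..<n} = s \<inter> {..<n}"
  unfolding branch_def by (auto simp: set_encode_eq)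

lemma branch_almost_disjoint:
  assumes "r \<noteq> s"
  shows "\<forall>\<^sub>F n in sequentially. branch r n \<notin> range (branch s)"
proof -
  obtain i where i: "i \<in> r \<longleftrightarrow> i \<notin> s" using assms by blast
  have "branch r n \<notin> range (branch s)" if "n > i" for n
    using branch_eqD[of r n s] i that by fastforce
  then show ?thesis by (metis eventually_at_top_dense)
qed

lemma branch_eventually_notin:
  assumes "finite I"
  shows "\<forall>\<^sub>F n in sequentially. branch r n \<notin> I"
proof -
  have "inj (branch r)" by (rule injI) (use branch_eqD in blast)
  then have "finite (branch r -` I)" using assms finite_vimageI by blast
  then obtain k where "branch r -` I \<subseteq> {..<k}" using finite_nat_bounded by blast
  then show ?thesis unfolding eventually_sequentially by (intro exI[of _ k]) auto
qed

context prime_power_group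
begin

section \<open>Characters read off from limits along branches\<close>

definition branch_lim :: "(nat \<Rightarrow> int) \<Rightarrow> nat set \<Rightarrow> int" where
  "branch_lim a r = (THE c. \<forall>\<^sub>F n in sequentially. a (branch r n) = c)"

text \<open>The limits map this subgroup homomorphically to a direct sum of continuum many copies of
  Z_p; the finiteness condition keeps the products over branches finite.\<close>

definition branch_group :: "(nat \<Rightarrow> int) set" where
  "branch_group = {a \<in> carrier G. (\<forall>r. \<forall>\<^sub>F n in sequentially. a (branch r n) = branch_lim a r) \<and> finite {r. branch_lim a r \<noteq> 0}}"

lemma branch_limI:
  assumes "\<forall>\<^sub>F n in sequentially. a (branch r n) = c"
  shows "branch_lim a r = c"
  unfolding branch_lim_def
proof (rule the_equality, rule assms)
  fix d assume "\<forall>\<^sub>F n in sequentially. a (branch r n) = d"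
  then have "\<forall>\<^sub>F n in sequentially. c = d" using assms by eventually_elim simp
  then show "d = c" by simp
qed

lemma branch_groupI:
  assumes "a \<in> carrier G" "\<And>r. \<forall>\<^sub>F n in sequentially. a (branch r n) = c r" "finite {r. c r \<noteq> 0}"
  shows "a \<in> branch_group" "branch_lim a = c"
proof -
  show "branch_lim a = c" using branch_limI[OF assms(2)] by blast
  then show "a \<in> branch_group" using assms by (simp add: branch_group_def)
qed

lemma branch_group_mult:
  assumes a: "a \<in> branch_group" and b: "b \<in> branch_group"
  shows "a \<otimes>\<^bsub>G\<^esub> b \<in> branch_group" "branch_lim (a \<otimes>\<^bsub>G\<^esub> b) = (\<lambda>r. (branch_lim a r + branch_lim b r) mod int p)"
proof -
  have c: "a \<otimes>\<^bsub>G\<^esub> b \<in> carrier G" using assms by (auto simp: branch_group_def)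
  have e: "\<forall>\<^sub>F n in sequentially. (a \<otimes>\<^bsub>G\<^esub> b) (branch r n) = (branch_lim a r + branch_lim b r) mod int p" for r
  proof -
    have "\<forall>\<^sub>F n in sequentially. a (branch r n) = branch_lim a r" "\<forall>\<^sub>F n in sequentially. b (branch r n) = branch_lim b r"
      using a b by (auto simp: branch_group_def)
    then show ?thesis by eventually_elim (simp add: mult_G)
  qed
  have "finite ({r. branch_lim a r \<noteq> 0} \<union> {r. branch_lim b r \<noteq> 0})" using a b by (auto simp: branch_group_def)
  then have f: "finite {r. (branch_lim a r + branch_lim b r) mod int p \<noteq> 0}" by (rule rev_finite_subset) auto
  show "a \<otimes>\<^bsub>G\<^esub> b \<in> branch_group" "branch_lim (a \<otimes>\<^bsub>G\<^esub> b) = (\<lambda>r. (branch_lim a r + branch_lim b r) mod int p)"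
    using branch_groupI[OF c e f] by auto
qed

lemma subgroup_branch_group: "subgroup branch_group G"
proof (rule G.subgroup_mult_closedI)
  show "\<one>\<^bsub>G\<^esub> \<in> branch_group"
    by (rule branch_groupI[of _ "\<lambda>_. 0"]) (simp_all add: one_G[symmetric], simp add: one_G)
qed (auto simp: branch_group_mult, auto simp: branch_group_def)

text \<open>In additive terms this is the sum of the limits along the branches in S, made
  complex-valued by \<open>root_exp\<close>.\<close>

definition branch_char0 :: "nat set set \<Rightarrow> (nat \<Rightarrow> int) \<Rightarrow> complex" where
  "branch_char0 S a = (\<Prod>r | r \<in> S \<and> branch_lim a r \<noteq> 0. root_exp (branch_lim a r))"

lemma branch_char0_superset:
  assumes "finite I" "{r. branch_lim a r \<noteq> 0} \<subseteq> I"
  shows "branch_char0 S a = (\<Prod>r\<in>S \<inter> I. root_exp (branch_lim a r))"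
  unfolding branch_char0_def using assms by (intro prod.mono_neutral_left) auto

lemma is_char_branch_char0: "G.is_char branch_group (branch_char0 S)"
  unfolding G.is_char_def
proof (intro conjI ballI)
  fix a b assume ab: "a \<in> branch_group" "b \<in> branch_group"
  let ?I = "{r. branch_lim a r \<noteq> 0} \<union> {r. branch_lim b r \<noteq> 0}"
  have I: "finite ?I" using ab by (auto simp: branch_group_def)
  have "{r. branch_lim (a \<otimes>\<^bsub>G\<^esub> b) r \<noteq> 0} \<subseteq> ?I" by (auto simp: branch_group_mult[OF ab])
  then have "branch_char0 S (a \<otimes>\<^bsub>G\<^esub> b) = (\<Prod>r\<in>S \<inter> ?I. root_exp (branch_lim a r) * root_exp (branch_lim b r))"
    by (subst branch_char0_superset[OF I]) (simp_all add: branch_group_mult[OF ab] root_exp_mod root_exp_add)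
  also have "\<dots> = branch_char0 S a * branch_char0 S b"
    by (subst (1 2) branch_char0_superset[OF I]) (auto simp: prod.distrib)
  finally show "branch_char0 S (a \<otimes>\<^bsub>G\<^esub> b) = branch_char0 S a * branch_char0 S b" .
  show "branch_char0 S a ^ p = 1"
    by (simp add: branch_char0_def prod_power_distrib root_exp_pow_p)
qed

text \<open>An arbitrary extension to the whole group; later arguments use only that it is a
  character with the prescribed values on \<open>branch_group\<close>.\<close>

definition branch_char :: "nat set set \<Rightarrow> (nat \<Rightarrow> int) \<Rightarrow> complex" where
  "branch_char S = (SOME f. G.is_char (carrier G) f \<and> (\<forall>a\<in>branch_group. f a = branch_char0 S a))"

lemma branch_char: "G.is_char (carrier G) (branch_char S)" "a \<in> branch_group \<Longrightarrow> branch_char S a = branch_char0 S a"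
proof -
  have "\<exists>f. G.is_char (carrier G) f \<and> (\<forall>a\<in>branch_group. f a = branch_char0 S a)"
    using G.is_char_extend[OF subgroup_branch_group is_char_branch_char0] by metis
  then have "G.is_char (carrier G) (branch_char S) \<and> (\<forall>a\<in>branch_group. branch_char S a = branch_char0 S a)"
    unfolding branch_char_def by (rule someI_ex)
  then show "G.is_char (carrier G) (branch_char S)" "a \<in> branch_group \<Longrightarrow> branch_char S a = branch_char0 S a" by auto
qed

text \<open>Take the indicator of one branch without the finite set I: its limit is 1 along r and 0
  along all others, and removing I kills the coordinates in I without changing any limit. This gives
  independence modulo the coordinates.\<close>

lemma branch_char_witness:
  assumes "finite I"
  obtains a where "a \<in> carrier G" "\<And>i. i \<in> I \<Longrightarrow> a i = 0"
    "\<And>S. branch_char S a = (if r \<in> S then root_exp 1 else 1)"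
proof -
  define a :: "nat \<Rightarrow> int" where "a = (\<lambda>i. if i \<in> range (branch r) - I then 1 else 0)"
  have c: "a \<in> carrier G" using p_gt_1 by (auto simp: a_def carrier_G)
  have e: "\<forall>\<^sub>F n in sequentially. a (branch s n) = (if s = r then 1 else 0)" for s
  proof (cases "s = r")
    case True
    from branch_eventually_notin[OF assms, of r] show ?thesis
      by eventually_elim (simp add: a_def True)
  next
    case False
    from branch_almost_disjoint[OF False] show ?thesis by eventually_elim (simp add: a_def False)
  qed
  have f: "finite {s. (if s = r then 1 else 0 :: int) \<noteq> 0}" by simp
  note bl = branch_groupI[OF c e f]
  have "branch_char S a = (if r \<in> S then root_exp 1 else 1)" for S
  proof -
    have "branch_char S a = (\<Prod>s | s \<in> S \<and> s = r. root_exp 1)"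
      unfolding branch_char(2)[OF bl(1)] branch_char0_def bl(2) by (intro prod.cong) auto
    also have "{s. s \<in> S \<and> s = r} = (if r \<in> S then {r} else {})" by auto
    finally show ?thesis by simp
  qed
  then show ?thesis using that c by (auto simp: a_def)
qed

definition coord_chars :: "((nat \<Rightarrow> int) \<Rightarrow> complex) set" where
  "coord_chars = range (\<lambda>n x. root_exp (x n))"

text \<open>The coordinate characters make every such topology Hausdorff; only the remaining
  characters depend on A.\<close>

definition tb_topology :: "nat set set set \<Rightarrow> (nat \<Rightarrow> int) topology" where
  "tb_topology A = G.initial_topology (coord_chars \<union> (\<lambda>X. branch_char (indep_family X)) ` A)"

lemma root_exp_1: "root_exp 1 \<noteq> 1"
  using unit_root(2) by (simp add: root_exp_def)

lemma tb_chars: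
  assumes "f \<in> coord_chars \<union> (\<lambda>X. branch_char (indep_family X)) ` A"
  shows "G.is_char (carrier G) f"
proof -
  have "G.is_char (carrier G) (\<lambda>x. root_exp (x n))" for n
    by (auto simp: G.is_char_def mult_G root_exp_mod root_exp_add root_exp_pow_p)
  then show ?thesis using assms branch_char by (auto simp: coord_chars_def)
qed

lemma tb_topology: "hausdorff_group_topology G (tb_topology A)" "totally_bounded_topology G (tb_topology A)"
proof -
  let ?F = "coord_chars \<union> (\<lambda>X. branch_char (indep_family X)) ` A"
  have "x = y" if xy: "x \<in> carrier G" "y \<in> carrier G" and eq: "\<And>f. f \<in> ?F \<Longrightarrow> f x = f y" for x y
  proof
    fix n
    have "(\<lambda>x. root_exp (x n)) \<in> ?F" by (auto simp: coord_chars_def)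
    from eq[OF this] have "root_exp (x n) = root_exp (y n)" .
    moreover have "x n \<in> {0..<int p}" "y n \<in> {0..<int p}" using xy by (auto simp: carrier_G)
    ultimately show "x n = y n" using root_exp_bij by (meson bij_betw_def inj_onD)
  qed
  then have "Hausdorff_space (tb_topology A)"
    unfolding tb_topology_def by (intro G.Hausdorff_initial tb_chars) auto
  moreover have "group_topology G (tb_topology A)"
    unfolding tb_topology_def by (intro G.group_topology_initial tb_chars)
  ultimately show "hausdorff_group_topology G (tb_topology A)" by (simp add: hausdorff_group_topology_def)
  show "totally_bounded_topology G (tb_topology A)"
    unfolding tb_topology_def by (intro G.totally_bounded_initial tb_chars)
qed

text \<open>For X in A the kernel of its character is open. If X were not in B, this kernel would
  contain a common kernel of finitely many characters from the family of B, but independence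
  provides a point of the latter at which the character of X is not 1.\<close>

lemma tb_topology_eqD:
  assumes eq: "tb_topology A = tb_topology B"
  shows "A \<subseteq> B"
proof (rule subsetI, rule ccontr)
  fix X assume X: "X \<in> A" "X \<notin> B"
  let ?f = "branch_char (indep_family X)"
  let ?F = "\<lambda>A. coord_chars \<union> (\<lambda>X. branch_char (indep_family X)) ` A"
  have "continuous_map (tb_topology A) (discrete_topology {z. z ^ p = 1}) ?f"
    unfolding tb_topology_def by (rule G.continuous_map_initial_char[OF tb_chars]) (use X in auto)
  then have "continuous_map (tb_topology B) (discrete_topology {z. z ^ p = 1}) ?f" by (simp only: eq)
  then have "openin (tb_topology B) {x \<in> topspace (tb_topology B). ?f x \<in> {1}}"
    by (rule openin_continuous_map_preimage) simp
  moreover have ts: "topspace (tb_topology B) = carrier G"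
    unfolding tb_topology_def by (rule G.topspace_initial_topology[OF tb_chars])
  ultimately have o: "openin (G.initial_topology (?F B)) {x \<in> carrier G. ?f x = 1}"
    by (simp add: tb_topology_def)
  have one: "\<one>\<^bsub>G\<^esub> \<in> {x \<in> carrier G. ?f x = 1}" using G.is_char_one[OF branch_char(1) G.subgroup_self] by simp
  obtain I where I: "finite I" "I \<subseteq> ?F B" "{x \<in> carrier G. \<forall>f\<in>I. f x = 1} \<subseteq> {x \<in> carrier G. ?f x = 1}"
    by (rule G.nhd_initial[OF tb_chars o one])
  have "finite (I \<inter> coord_chars)" "I \<inter> coord_chars \<subseteq> range (\<lambda>n x. root_exp (x n))" using I(1) by (auto simp: coord_chars_def)
  then obtain N where N: "finite N" "I \<inter> coord_chars = (\<lambda>n x. root_exp (x n)) ` N" by (meson finite_subset_image)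
  have "finite (I - coord_chars)" "I - coord_chars \<subseteq> (\<lambda>X. branch_char (indep_family X)) ` B" using I by auto
  then obtain \<Y> where Y: "\<Y> \<subseteq> B" "finite \<Y>" "I - coord_chars = (\<lambda>X. branch_char (indep_family X)) ` \<Y>" by (meson finite_subset_image)
  \<comment> \<open>The branch r belongs to the set of X and to none of the finitely many others;
    its indicator, cleared on the coordinates in N, is the separating point.\<close>
  obtain r where r: "r \<in> indep_family X" "\<And>Y. Y \<in> \<Y> \<Longrightarrow> r \<notin> indep_family Y"
    using indep_family_avoid[OF Y(2)] X(2) Y(1) by (metis subsetD)
  obtain a where a: "a \<in> carrier G" "\<And>i. i \<in> N \<Longrightarrow> a i = 0"
    "\<And>S. branch_char S a = (if r \<in> S then root_exp 1 else 1)"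
    using branch_char_witness[OF N(1), of r] by blast
  have "f a = 1" if "f \<in> I" for f
  proof (cases "f \<in> coord_chars")
    case True
    then have "f \<in> (\<lambda>n x. root_exp (x n)) ` N" using that N(2) by blast
    then show ?thesis using a(2) by auto
  next
    case False
    then have "f \<in> (\<lambda>X. branch_char (indep_family X)) ` \<Y>" using that Y(3) by blast
    then show ?thesis using a(3) r(2) by auto
  qed
  then have "?f a = 1" using I(3) a(1) by blast
  then show False using a(3) r(1) root_exp_1 by simp
qed

lemma inj_tb_topology: "inj tb_topology"
  by (rule injI) (metis tb_topology_eqD subset_antisym)

end

subsection \<open>Counting totally bounded topologies\<close>

lemma Pow_lepoll_mono:
  assumes "A \<lesssim> B"
  shows "Pow A \<lesssim> Pow B"
proof -
  obtain f where "inj_on f A" "f ` A \<subseteq> B" using assms by (auto simp: lepoll_def)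
  then have "inj_on (image f) (Pow A)" "image f ` Pow A \<subseteq> Pow B"
    by (auto intro: inj_on_image_Pow)
  then show ?thesis unfolding lepoll_def by blast
qed

lemma infinite_times_self_lepoll: "infinite A \<Longrightarrow> A \<times> A \<lesssim> A"
  using card_of_Times_same_infinite eqpoll_iff_card_of_ordIso eqpoll_imp_lepoll by blast

lemma lepoll_total: "A \<lesssim> B \<or> B \<lesssim> A"
  unfolding lepoll_def card_of_ordLeq by (rule ordLeq_total) (rule card_of_Well_order)+

text \<open>For infinite P the product of S and P is no larger than the larger factor, and P alone
  is too small for C.\<close>

lemma lepoll_times_absorb:
  assumes C: "C \<lesssim> S \<times> P" and P: "infinite P" and n: "\<not> C \<lesssim> P"
  shows "C \<lesssim> S"
proof (cases "S \<lesssim> P")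
  case True
  then have "S \<times> P \<lesssim> P \<times> P" by (intro times_lepoll_mono) auto
  then show ?thesis using n C infinite_times_self_lepoll[OF P] lepoll_trans by meson
next
  case False
  then have PS: "P \<lesssim> S" using lepoll_total by blast
  then have "infinite S" using P lepoll_trans[of "UNIV::nat set" P S] by (simp add: infinite_le_lepoll)
  have "S \<times> P \<lesssim> S \<times> S" using PS by (intro times_lepoll_mono) auto
  then show ?thesis using C infinite_times_self_lepoll[OF \<open>infinite S\<close>] lepoll_trans by meson
qed

context prime_power_group
begin

text \<open>A homeomorphism class of topologies on \<open>G\<close> has at most \<open>2 ^ |G|\<close> members, since
  a member is determined by a homeomorphism from a fixed one, whose graph is a subset of \<open>G \<times> G\<close>.\<close>

theorem ex_many_totally_bounded_topologies:
  "\<exists>S \<subseteq> {\<tau>. hausdorff_group_topology G \<tau>}. S \<approx> (UNIV :: nat set set set set) \<and>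
     (\<forall>\<tau>\<in>S. totally_bounded_topology G \<tau>) \<and> pairwise (\<lambda>\<sigma> \<tau>. \<not> \<sigma> homeomorphic_space \<tau>) S"
proof -
  let ?T = tb_topology
  \<comment> \<open>The choice depends only on the homeomorphism class of the topology, as
    \<open>rep_cong\<close> shows, so it picks one index per class.\<close>
  define rep where "rep A = (SOME B. ?T A homeomorphic_space ?T B)" for A
  have rep: "?T A homeomorphic_space ?T (rep A)" for A
    unfolding rep_def by (rule someI[of _ A]) (rule homeomorphic_space_refl)
  have rep_cong: "rep A = rep B" if "?T A homeomorphic_space ?T B" for A B
  proof -
    have "(?T A homeomorphic_space ?T C) = (?T B homeomorphic_space ?T C)" for C
      using that homeomorphic_space_trans homeomorphic_space_sym by blast
    then show ?thesis by (simp add: rep_def)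
  qed
  define S where "S = range (\<lambda>A. ?T (rep A))"
  have nonhomeo: "pairwise (\<lambda>\<sigma> \<tau>. \<not> \<sigma> homeomorphic_space \<tau>) S"
  proof (rule pairwiseI)
    fix \<sigma> \<tau> assume "\<sigma> \<in> S" "\<tau> \<in> S" "\<sigma> \<noteq> \<tau>"
    then obtain A B where AB: "\<sigma> = ?T (rep A)" "\<tau> = ?T (rep B)" unfolding S_def by blast
    have ne: "rep A \<noteq> rep B" using AB \<open>\<sigma> \<noteq> \<tau>\<close> by auto
    show "\<not> \<sigma> homeomorphic_space \<tau>"
      using rep_cong[of A B] AB ne rep homeomorphic_space_trans homeomorphic_space_sym by metis
  qed
  have ts: "topspace (?T A) = carrier G" for A
    using tb_topology(1)[of A] by (simp add: hausdorff_group_topology_def group_topology_def)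
  have "\<exists>h. homeomorphic_map (?T (rep A)) (?T A) h" for A
    using rep[of A] homeomorphic_space_sym homeomorphic_space by blast
  then obtain h where h: "\<And>A. homeomorphic_map (?T (rep A)) (?T A) (h A)" by metis
  \<comment> \<open>The graph is taken over the carrier, since the values of \<open>h A\<close>
    elsewhere are arbitrary and would spoil the count.\<close>
  define gr where "gr A = {(x, h A x) | x. x \<in> carrier G}" for A
  \<comment> \<open>The map \<open>h A\<close> transports the topology of the representative, so
    representative and graph together determine the topology.\<close>
  have gr_eq: "?T A = ?T B" if r: "?T (rep A) = ?T (rep B)" and g: "gr A = gr B" for A B
  proof -
    have hh: "h A x = h B x" if "x \<in> carrier G" for x
    proof -
      have "(x, h A x) \<in> gr B" using that g by (auto simp: gr_def)
      then show ?thesis by (auto simp: gr_def)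
    qed
    have "homeomorphic_map (?T (rep A)) (?T B) (h A)"
      using h[of B] r hh ts by (metis homeomorphic_map_eq)
    then have "openin (?T A) U \<longleftrightarrow> openin (?T B) U" if "U \<subseteq> carrier G" for U
    proof -
      have "h A ` carrier G = carrier G" using homeomorphic_imp_surjective_map[OF h[of A]] by (simp add: ts)
      then obtain W where W: "W \<subseteq> carrier G" "U = h A ` W" using \<open>U \<subseteq> carrier G\<close> by (metis subset_image_iff)
      then show ?thesis
        using homeomorphic_map_openness[OF h[of A], of W] homeomorphic_map_openness[OF \<open>homeomorphic_map (?T (rep A)) (?T B) (h A)\<close>, of W] ts
        by simp
    qed
    then show ?thesis unfolding topology_eq by (metis openin_subset ts)
  qed
  have gr_sub: "gr A \<in> Pow (carrier G \<times> carrier G)" for A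
    using homeomorphic_imp_surjective_map[OF h[of A]] ts by (auto simp: gr_def)
  let ?C = "UNIV :: nat set set set set" and ?P = "Pow (carrier G \<times> carrier G)"
  have "?C \<lesssim> S \<times> ?P"
  proof -
    have "inj (\<lambda>A. (?T (rep A), gr A))"
      by (rule injI) (metis gr_eq prod.inject inj_tb_topology injD)
    moreover have "range (\<lambda>A. (?T (rep A), gr A)) \<subseteq> S \<times> ?P" using gr_sub by (auto simp: S_def)
    ultimately show ?thesis unfolding lepoll_def by blast
  qed
  moreover have "infinite ?P" using infinite_G infinite_imp_nonempty[OF infinite_G] by (simp add: finite_cartesian_product_iff)
  \<comment> \<open>\<open>?P\<close> has size at most 2 ^ c, and \<open>?C\<close> has the size of
    the power set of a set of size 2 ^ c.\<close>
  moreover have "\<not> ?C \<lesssim> ?P"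
  proof
    assume *: "?C \<lesssim> ?P"
    have "carrier G \<times> carrier G \<lesssim> (UNIV :: nat set set)"
      using infinite_times_self_lepoll[OF infinite_G] carrier_G_eqpoll by (meson lepoll_trans2)
    then have "?P \<lesssim> Pow (UNIV :: nat set set)" by (rule Pow_lepoll_mono)
    then have "Pow (UNIV :: nat set set set) \<lesssim> (UNIV :: nat set set set)" using * lepoll_trans by fastforce
    then show False using lesspoll_Pow_self[of "UNIV :: nat set set set"] lepoll_Pow_self by (meson lepoll_antisym lesspoll_def)
  qed
  ultimately have "?C \<lesssim> S" by (rule lepoll_times_absorb)
  moreover have "S \<lesssim> ?C" unfolding S_def by (rule image_lepoll)
  ultimately have "S \<approx> ?C" by (simp add: lepoll_antisym)
  then show ?thesis using nonhomeo tb_topology by (intro exI[of _ S]) (auto simp: S_def)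
qed

end

theorem theorem0p1:
  fixes p :: nat
  assumes "prime p"
  shows
    "(\<exists>S \<subseteq> {\<tau>. hausdorff_group_topology (Zp_power p) \<tau>}.
        S \<approx> (UNIV :: nat set set set set) \<and>
        (\<forall>\<tau>\<in>S. totally_bounded_topology (Zp_power p) \<tau>) \<and>
        pairwise (\<lambda>\<sigma> \<tau>. \<not> \<sigma> homeomorphic_space \<tau>) S)
     \<and>
     (continuum_hypothesis \<longrightarrow>
        Zp_power p \<cong> prod_group_0 p \<and>
        Zp_power p \<cong> prod_group_1 p \<and>
        (\<forall>\<phi> \<in> iso (Zp_power p) (prod_group_0 p). \<forall>\<psi> \<in> iso (Zp_power p) (prod_group_1 p).
           (\<forall>\<tau> \<in> {tau_c p, tau_d p, tau_0 p \<phi>, tau_1 p \<psi>}.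
              hausdorff_group_topology (Zp_power p) \<tau> \<and> locally_compact_space \<tau>) \<and>
           (\<forall>\<tau>. hausdorff_group_topology (Zp_power p) \<tau> \<and> locally_compact_space \<tau> \<longrightarrow>
              (\<exists>\<sigma> \<in> {tau_c p, tau_d p, tau_0 p \<phi>, tau_1 p \<psi>}. \<tau> homeomorphic_space \<sigma>)) \<and>
           sorted_wrt (\<lambda>\<sigma> \<tau>. \<not> \<sigma> homeomorphic_space \<tau>)
             [tau_c p, tau_d p, tau_0 p \<phi>, tau_1 p \<psi>] \<and>
           compact_space (tau_c p) \<and> \<not> compact_space (tau_d p) \<and>
           \<not> compact_space (tau_0 p \<phi>) \<and> \<not> compact_space (tau_1 p \<psi>)))"
proof -
  interpret prime_power_group p by unfold_locales (rule assms)
  show ?thesis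
    using ex_many_totally_bounded_topologies iso_prod_group_0 iso_prod_group_1 locally_compact_group_topologies by blast
qed

end
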